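(* Assume the setting and assumptions (R1), (R2) of the context. For every $m\ge1$, every $r\ge1$ and every $f\in\mathcal{B}(E_m)$, $$\sup_{n\geq1}\sqrt{n}\;\mathbb{E}\left(\left|\left[\overline{\eta}^{[m]}_n-\overline{\pi}^{[m]}\right](f)\right|^r\right)^{1/r}<\infty .$$
   Context: Notation. For a measurable space $S$: $\mathcal{P}(S)$ is the set of probability measures on $S$; $\mathcal{B}(S)$ the bounded measurable real functions with the sup norm $\|\cdot\|$; $\mathcal{B}_1(S)$ its unit ball; $\mathrm{osc}(f)=\sup_{x,y}|f(x)-f(y)|$; $\mathrm{Osc}_1(S)$ the measurable functions with $\mathrm{osc}(f)\le 1$. $\mu(f)=\int f\,d\mu$, and for a finite signed measure $\|\mu\|=\sup_{f\in\mathcal{B}_1(S)}|\mu(f)|$. For a bounded integral operator $M$, $M(f)(x)=\int M(x,dy)f(y)$, $(\mu M)(f)=\mu(M(f))$, $\|M\|=\sup_{f\in\mathcal{B}_1}\|M(f)\|$, and if $M$ is Markov, $\beta(M)=\sup\{\mathrm{osc}(M(f)):f\in\mathrm{Osc}_1\}$. Setting (interacting MCMC). $(S^{(l)})_{l\ge0}$ are measurable spaces, $\pi^{(0)}\in\mathcal{P}(S^{(0)})$, $\Phi_l:\mathcal{P}(S^{(l-1)})\to\mathcal{P}(S^{(l)})$ for $l\ge1$, and $\pi^{(l)}=\Phi_l(\pi^{(l-1)})$. $M^{(0)}$ is a Markov transition on $S^{(0)}$ with $\pi^{(0)}M^{(0)}=\pi^{(0)}$; for $l\ge1$ and $\mu\in\mathcal{P}(S^{(l-1)})$,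 $M^{(l)}_\mu$ is a Markov transition on $S^{(l)}$ with $\Phi_l(\mu)M^{(l)}_\mu=\Phi_l(\mu)$. Convention: $M^{(0)}_\mu=M^{(0)}$. Let $\nu_k\in\mathcal{P}(S^{(k)})$, $k\ge0$, be given. $X^{(0)}=(X^{(0)}_n)_{n\ge0}$ is a Markov chain with initial law $\nu_0$ and transition $M^{(0)}$. For $k\ge1$, given $X^{(k-1)}$, $X^{(k)}=(X^{(k)}_n)_{n\geq 0}$ is a Markov chain with initial law $\nu_k$ and $$\mathbb{P}(X^{(k)}_{n+1}\in dx\mid X^{(k-1)},X^{(k)}_n)=M^{(k)}_{\eta^{(k-1)}_n}(X^{(k)}_n,dx),\qquad \eta^{(k)}_n=\frac1{n+1}\sum_{p=0}^n\delta_{X^{(k)}_p}.$$ For $m\ge 1$ let $E_m=S^{(0)}\times\cdots\times S^{(m)}$ and $\overline{X}^m_n=(X^{(0)}_n,\ldots,X^{(m)}_n)$. The process $\overline X^m$ is $E_m$-valued with, given its past up to time $n$, transition $\prod_{0\le l\le m}M^{(l)}_{\eta_n^{(l-1)}}(x^l,dy^l)$ from $x=(x^0,\dots,x^m)$. Put $\overline{\eta}^{[m]}_n=\frac1{n+1}\sum_{p=0}^n\delta_{\overline{X}^m_p}$ and $\overline{\pi}^{[m]}=\pi^{(0)}\otimes\cdots\otimes\pi^{(m)}$. Standing regularity assumptions. (R1) For each $l\ge1$ there is a kernel $\Gamma_l$ from $\mathcal{B}(S^{(l)})$ into $\mathcal{B}(S^{(l-1)})$ and $\Lambda_l<\infty$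 such that for all $f\in\mathcal{B}(S^{(l)})$, $\mu,\nu\in\mathcal{P}(S^{(l-1)})$: $|[\Phi_l(\mu)-\Phi_l(\nu)](f)|\le\int|[\mu-\nu](g)|\,\Gamma_l(f,dg)$ and $\int\Gamma_l(f,dg)\|g\|\le\Lambda_l\|f\|$. (R2) For each $l\ge0$ there are an integer $n_l\ge0$ and a finite constant $c_l$ with $\|M^{(l)}_\mu-M^{(l)}_\nu\|\le c_l\|\mu-\nu\|$ for all $\mu,\nu\in\mathcal{P}(S^{(l-1)})$, and $b_l(n_l):=\sup_{\mu}\beta((M^{(l)}_\mu)^{n_l})<1$ (for $l=0$, $M^{(0)}_\mu=M^{(0)}$). *)

theory Defs
  imports "HOL-Probability.Probability"
begin

section \<open>Function spaces, norms and oscillations\<close>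

text \<open>
  A measurable space is represented by a \<open>measure\<close> of which only the \<open>space\<close> and the \<open>sets\<close> are
  used.  A function on it is a HOL function whose values outside the space are irrelevant; this is why
  suprema below range over \<open>space S\<close>.
\<close>

abbreviation prob_measures :: "'a measure \<Rightarrow> 'a measure set"
  where "prob_measures S \<equiv> space (prob_algebra S)"

definition bounded_measurable :: "'a measure \<Rightarrow> ('a \<Rightarrow> real) set"
  where "bounded_measurable S = {f \<in> borel_measurable S. bounded (f ` space S)}"

definition sup_norm :: "'a measure \<Rightarrow> ('a \<Rightarrow> real) \<Rightarrow> real"
  where "sup_norm S f = (SUP x\<in>space S. \<bar>f x\<bar>)"

definition unit_ball :: "'a measure \<Rightarrow> ('a \<Rightarrow> real) set"
  where "unit_ball S = {f \<in> bounded_measurable S. sup_norm S f \<le> 1}"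

definition osc :: "'a measure \<Rightarrow> ('a \<Rightarrow> real) \<Rightarrow> real"
  where "osc S f = (SUP (x, y)\<in>space S \<times> space S. \<bar>f x - f y\<bar>)"

text \<open>
  Boundedness is automatic for functions of finite oscillation; it is required explicitly only because
  the supremum of an unbounded set of reals is unspecified.
\<close>

definition Osc1 :: "'a measure \<Rightarrow> ('a \<Rightarrow> real) set"
  where "Osc1 S = {f \<in> bounded_measurable S. osc S f \<le> 1}"

text \<open>
  A finite signed measure enters only through the functional \<open>f \<mapsto> \<mu>(f)\<close>, and a bounded integral
  operator only through its action \<open>f \<mapsto> M(f)\<close>; the norms are defined on those.
\<close>

definition signed_norm :: "'a measure \<Rightarrow> (('a \<Rightarrow> real) \<Rightarrow> real) \<Rightarrow> real"
  where "signed_norm S \<phi> = (SUP f\<in>unit_ball S. \<bar>\<phi> f\<bar>)"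

definition kernel_op :: "('a \<Rightarrow> 'a measure) \<Rightarrow> ('a \<Rightarrow> real) \<Rightarrow> 'a \<Rightarrow> real"
  where "kernel_op K f x = (\<integral>y. f y \<partial>K x)"

definition op_norm :: "'a measure \<Rightarrow> (('a \<Rightarrow> real) \<Rightarrow> 'a \<Rightarrow> real) \<Rightarrow> real"
  where "op_norm S T = (SUP f\<in>unit_ball S. sup_norm S (T f))"

definition dobrushin :: "'a measure \<Rightarrow> (('a \<Rightarrow> real) \<Rightarrow> 'a \<Rightarrow> real) \<Rightarrow> real"
  where "dobrushin S T = (SUP f\<in>Osc1 S. osc S (T f))"


section \<open>Empirical measures and conditional laws\<close>

text \<open>
  \<open>empirical S n x\<close> is \<open>1/(n+1) \<Sum>p\<le>n. \<delta>(x p)\<close>, obtained as the image of the uniform law on \<open>{0..n}\<close>.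
\<close>

definition empirical :: "'a measure \<Rightarrow> nat \<Rightarrow> (nat \<Rightarrow> 'a) \<Rightarrow> 'a measure"
  where "empirical S n x = distr (uniform_count_measure {..n}) S x"

lemma measure_empirical:
  assumes "\<And>p. p \<le> n \<Longrightarrow> x p \<in> space S" and A: "A \<in> sets S"
  shows "measure (empirical S n x) A = 1 / (real n + 1) * (\<Sum>p\<le>n. measure (return S (x p)) A)"
proof -
  have x: "x \<in> uniform_count_measure {..n} \<rightarrow>\<^sub>M S"
    using assms(1) by (simp add: measurable_def uniform_count_measure_def point_measure_def)
  have "measure (empirical S n x) A = measure (uniform_count_measure {..n}) (x -` A \<inter> {..n})"
    unfolding empirical_def using measure_distr[OF x A] by (simp add: space_uniform_count_measure)
  also have "\<dots> = card (x -` A \<inter> {..n}) / (real n + 1)"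
    by (subst measure_uniform_count_measure) (auto simp: add.commute)
  also have "real (card (x -` A \<inter> {..n})) = (\<Sum>p\<le>n. indicator A (x p))"
    by (simp add: indicator_def sum.If_cases Int_commute vimage_def)
  also have "\<dots> = (\<Sum>p\<le>n. measure (return S (x p)) A)"
    using A by (intro sum.cong) (auto simp: measure_return)
  finally show ?thesis by simp
qed

text \<open>The sigma-algebra on \<open>\<Omega>\<close> generated by the variables \<open>X l p\<close>, \<open>(l, p) \<in> J\<close>.\<close>

definition generated ::
    "'w measure \<Rightarrow> (nat \<Rightarrow> 'a measure) \<Rightarrow> (nat \<Rightarrow> nat \<Rightarrow> 'w \<Rightarrow> 'a) \<Rightarrow> (nat \<times> nat) set \<Rightarrow> 'w measure"
  where "generated P S X J =
    sigma (space P) {X l p -` A \<inter> space P | l p A. (l, p) \<in> J \<and> A \<in> sets (S l)}"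

text \<open>Given \<open>F\<close>, the \<open>N\<close>-valued random variable \<open>Y\<close> has the (random) law \<open>K\<close>.\<close>

definition cond_law ::
    "'w measure \<Rightarrow> 'w measure \<Rightarrow> 'b measure \<Rightarrow> ('w \<Rightarrow> 'b) \<Rightarrow> ('w \<Rightarrow> 'b measure) \<Rightarrow> bool"
  where "cond_law P F N Y K \<longleftrightarrow>
    (\<forall>A\<in>sets N. AE \<omega> in P. real_cond_exp P F (\<lambda>\<omega>. indicator A (Y \<omega>)) \<omega> = measure (K \<omega>) A)"


section \<open>Interacting Markov chain Monte Carlo\<close>

text \<open>\<open>E_m\<close> is \<open>\<Pi>\<^sub>M l\<in>{..m}. S l\<close>; a point of it is a function restricted to \<open>{..m}\<close>.\<close>

definition joint_state :: "(nat \<Rightarrow> nat \<Rightarrow> 'w \<Rightarrow> 'a) \<Rightarrow> nat \<Rightarrow> nat \<Rightarrow> 'w \<Rightarrow> nat \<Rightarrow> 'a"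
  where "joint_state X m n \<omega> = (\<lambda>l\<in>{..m}. X l n \<omega>)"

text \<open>
  The spaces \<open>S l\<close> live on one type, which is no restriction: a sequence of sets embeds in its
  disjoint union.  In expressions such as \<open>S (l - 1)\<close> and \<open>X (l - 1)\<close> the subtraction is truncated; at
  level \<open>l = 0\<close> the resulting dummy argument of \<open>M 0\<close> is irrelevant by \<open>M_0\<close>.

  The assumption \<open>M_path_measurable\<close> expresses that \<open>M l\<close>, evaluated at the empirical measure of a
  path of length \<open>n + 1\<close>, is a genuine transition from (path, position) to \<open>S l\<close>.  This is what makes
  the transition probabilities of the process meaningful; it follows from joint measurability of
  \<open>(\<mu>, y) \<mapsto> M l \<mu> y\<close>.

  \<open>X_0_transition\<close>, \<open>X_initial\<close> and \<open>X_transition\<close> describe each level given the whole preceding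
  level (and its own past).  By themselves they only constrain pairs of consecutive levels;
  \<open>joint_transition\<close> is the evolution of the levels \<open>0, \<dots>, m\<close> jointly, given their past.
\<close>

locale interacting_mcmc = prob_space P
  for P :: "'w measure" +
  fixes S :: "nat \<Rightarrow> 'a measure"
    and \<Phi> :: "nat \<Rightarrow> 'a measure \<Rightarrow> 'a measure"
    and \<pi> :: "nat \<Rightarrow> 'a measure"
    and M0 :: "'a \<Rightarrow> 'a measure"
    and M :: "nat \<Rightarrow> 'a measure \<Rightarrow> 'a \<Rightarrow> 'a measure"
    and \<nu> :: "nat \<Rightarrow> 'a measure"
    and X :: "nat \<Rightarrow> nat \<Rightarrow> 'w \<Rightarrow> 'a"
  assumes \<pi>_0: "\<pi> 0 \<in> prob_measures (S 0)"
    and \<Phi>: "\<And>l. l \<ge> 1 \<Longrightarrow> \<Phi> l \<in> prob_measures (S (l - 1)) \<rightarrow> prob_measures (S l)"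
    and \<pi>_rec: "\<And>l. l \<ge> 1 \<Longrightarrow> \<pi> l = \<Phi> l (\<pi> (l - 1))"
    and M0_markov: "M0 \<in> S 0 \<rightarrow>\<^sub>M prob_algebra (S 0)"
    and M0_invariant: "\<pi> 0 \<bind> M0 = \<pi> 0"
    and M_0: "\<And>\<mu>. M 0 \<mu> = M0"
    and M_markov: "\<And>l \<mu>. l \<ge> 1 \<Longrightarrow> \<mu> \<in> prob_measures (S (l - 1)) \<Longrightarrow>
      M l \<mu> \<in> S l \<rightarrow>\<^sub>M prob_algebra (S l)"
    and M_invariant: "\<And>l \<mu>. l \<ge> 1 \<Longrightarrow> \<mu> \<in> prob_measures (S (l - 1)) \<Longrightarrow>
      \<Phi> l \<mu> \<bind> M l \<mu> = \<Phi> l \<mu>"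
    and M_path_measurable: "\<And>l n. l \<ge> 1 \<Longrightarrow>
      (\<lambda>(x, y). M l (empirical (S (l - 1)) n x) y)
        \<in> (\<Pi>\<^sub>M p\<in>{..n}. S (l - 1)) \<Otimes>\<^sub>M S l \<rightarrow>\<^sub>M prob_algebra (S l)"
    and \<nu>: "\<And>k. \<nu> k \<in> prob_measures (S k)"
    and X_measurable: "\<And>k n. X k n \<in> P \<rightarrow>\<^sub>M S k"
    and X_0_initial: "distr P (S 0) (X 0 0) = \<nu> 0"
    and X_0_transition: "\<And>n. cond_law P (generated P S X ({0} \<times> {..n})) (S 0)
      (X 0 (Suc n)) (\<lambda>\<omega>. M0 (X 0 n \<omega>))"
    and X_initial: "\<And>k. k \<ge> 1 \<Longrightarrow>
      cond_law P (generated P S X ({k - 1} \<times> UNIV)) (S k) (X k 0) (\<lambda>\<omega>. \<nu> k)"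
    and X_transition: "\<And>k n. k \<ge> 1 \<Longrightarrow>
      cond_law P (generated P S X ({k - 1} \<times> UNIV \<union> {k} \<times> {..n})) (S k) (X k (Suc n))
        (\<lambda>\<omega>. M k (empirical (S (k - 1)) n (\<lambda>p. X (k - 1) p \<omega>)) (X k n \<omega>))"
    and joint_transition: "\<And>m n. m \<ge> 1 \<Longrightarrow>
      cond_law P (generated P S X ({..m} \<times> {..n})) (\<Pi>\<^sub>M l\<in>{..m}. S l) (joint_state X m (Suc n))
        (\<lambda>\<omega>. \<Pi>\<^sub>M l\<in>{..m}. M l (empirical (S (l - 1)) n (\<lambda>p. X (l - 1) p \<omega>)) (X l n \<omega>))"

text \<open>
  There is no canonical sigma-algebra on a space of bounded measurable functions: on all of it, none
  makes the evaluation \<open>(g, x) \<mapsto> g x\<close> jointly measurable in general (Aumann).  Each measure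
  \<open>\<Gamma> f\<close> therefore carries its own sigma-algebra, on a set of bounded measurable functions, for which
  evaluation is jointly measurable; \<open>g \<mapsto> \<mu>(g)\<close> is then measurable for every probability \<open>\<mu>\<close>.
  The measures \<open>\<Gamma> f\<close> may be infinite.
\<close>

definition R1 :: "(nat \<Rightarrow> 'a measure) \<Rightarrow> (nat \<Rightarrow> 'a measure \<Rightarrow> 'a measure) \<Rightarrow> bool"
  where "R1 S \<Phi> \<longleftrightarrow> (\<forall>l\<ge>1. \<exists>\<Gamma> :: ('a \<Rightarrow> real) \<Rightarrow> ('a \<Rightarrow> real) measure. \<exists>\<Lambda> :: real.
    \<forall>f\<in>bounded_measurable (S l).
      space (\<Gamma> f) \<subseteq> bounded_measurable (S (l - 1)) \<and>
      (\<lambda>(g, x). g x) \<in> borel_measurable (\<Gamma> f \<Otimes>\<^sub>M S (l - 1)) \<and>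
      sup_norm (S (l - 1)) \<in> borel_measurable (\<Gamma> f) \<and>
      (\<forall>\<mu>\<in>prob_measures (S (l - 1)). \<forall>\<nu>\<in>prob_measures (S (l - 1)).
        ennreal \<bar>(\<integral>x. f x \<partial>\<Phi> l \<mu>) - (\<integral>x. f x \<partial>\<Phi> l \<nu>)\<bar>
          \<le> (\<integral>\<^sup>+g. ennreal \<bar>(\<integral>x. g x \<partial>\<mu>) - (\<integral>x. g x \<partial>\<nu>)\<bar> \<partial>\<Gamma> f)) \<and>
      (\<integral>\<^sup>+g. ennreal (sup_norm (S (l - 1)) g) \<partial>\<Gamma> f) \<le> ennreal (\<Lambda> * sup_norm (S l) f))"

text \<open>For \<open>l = 0\<close>, where \<open>M 0 \<mu>\<close> does not depend on \<open>\<mu>\<close>, this reduces to \<open>\<beta>(M0 ^ N) < 1\<close>.\<close>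

definition R2 :: "(nat \<Rightarrow> 'a measure) \<Rightarrow> (nat \<Rightarrow> 'a measure \<Rightarrow> 'a \<Rightarrow> 'a measure) \<Rightarrow> bool"
  where "R2 S M \<longleftrightarrow> (\<forall>l. \<exists>N :: nat. \<exists>c :: real.
    (\<forall>\<mu>\<in>prob_measures (S (l - 1)). \<forall>\<nu>\<in>prob_measures (S (l - 1)).
      op_norm (S l) (\<lambda>f x. kernel_op (M l \<mu>) f x - kernel_op (M l \<nu>) f x)
        \<le> c * signed_norm (S (l - 1)) (\<lambda>f. (\<integral>x. f x \<partial>\<mu>) - (\<integral>x. f x \<partial>\<nu>))) \<and>
    (SUP \<mu>\<in>prob_measures (S (l - 1)). dobrushin (S l) (kernel_op (M l \<mu>) ^^ N)) < 1)"

end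

theory Submission
  imports Defs
begin

text \<open>
  Every estimate below is proved for the chain started from an arbitrary deterministic history and is
  uniform in that history; at the end it is averaged over the initial law.  Write \<open>E j k F h\<close> for
  the expectation of \<open>F\<close> after \<open>k\<close> steps from the history \<open>h\<close> at time \<open>j\<close> (the operator \<open>ev\<close> below).
  The error of the time average \<open>avg n f\<close> is split into its fluctuation around \<open>E 0 n (avg n f)\<close> and
  the error of this mean.  Both are controlled by one property of the dynamics.

  \<^emph>\<open>Stability\<close> (\<open>stability\<close>).  Changing level \<open>l\<close> of the state at time \<open>j\<close> moves the law of the state
  at time \<open>p\<close> by at most a constant times \<open>\<rho>^(p-j) + (p+1)^(-3/4) (j+1)^(-1/4)\<close>.  The first term is
  the direct memory of level \<open>l\<close>, forgotten geometrically because of the mixing assumption.  The second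
  is the indirect memory: the change stays in the empirical measure at every later time \<open>q\<close> with weight
  \<open>1/(q+1)\<close>, and so changes every later kernel of level \<open>l+1\<close> by that order.  Since the interaction is
  triangular, each level multiplies the accumulated effect \<open>1/p\<close> by one logarithm of \<open>p/j\<close> only, and
  every power of this logarithm is at most of order \<open>(p/j)^(1/4)\<close>.

  \<^emph>\<open>Fluctuation\<close> (\<open>concentration\<close>).  By stability the increments of the martingale
  \<open>E j (n-j) (avg n f)\<close> are of order \<open>(n+1)^(-3/4) (j+1)^(-1/4)\<close>, and their squares sum to \<open>O(1/n)\<close>.
  Hoeffding's lemma, applied to each step, gives sub-Gaussian fluctuations of order \<open>n^(-1/2)\<close>.

  \<^emph>\<open>Mean of one level\<close> (\<open>level_means\<close>).  By induction on \<open>l\<close>.  Over a window of about \<open>p^(1/4)\<close> steps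
  the empirical measure \<open>\<eta>\<close> of level \<open>l-1\<close> hardly moves, while the kernel frozen at \<open>\<eta>\<close> reaches
  its invariant law \<open>\<Phi> l \<eta>\<close>.  Hence level \<open>l\<close> at time \<open>p\<close> is distributed like \<open>\<Phi> l \<eta>\<close>, up to
  \<open>O(p^(-1/2))\<close>, and the regularity of \<open>\<Phi>\<close> compares \<open>\<Phi> l \<eta>\<close> with \<open>\<pi> l = \<Phi> l (\<pi> (l-1))\<close> through
  integrals of \<open>\<eta> - \<pi> (l-1)\<close>, which are \<open>O(p^(-1/2))\<close> by the fluctuation bound and the induction
  hypothesis.

  \<^emph>\<open>Joint mean\<close> (\<open>decoupling\<close>, \<open>joint_mean\<close>).  The argument for one level does not extend to functions
  of several levels: integrating out the other levels leaves a random test function, correlated with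
  \<open>\<eta>\<close>, whereas the regularity of \<open>\<Phi>\<close> is an assumption on fixed test functions.  Instead, level \<open>l\<close> at
  time \<open>p\<close> is shown to be independent of the other levels up to \<open>O(p^(-1/2))\<close> in total variation.  The
  conditional laws, given the history up to \<open>j\<close>, of level \<open>l\<close> and of the other levels at time \<open>p\<close> are
  two measure-valued martingales in \<open>j\<close>, and the dependence is the sum over \<open>j\<close> of the conditional
  covariances of their increments.  By stability each covariance is a product in which at least one
  factor is of the small, indirect kind, and their sum is \<open>O(p^(-1/2))\<close>.  So level \<open>l\<close> may be replaced by
  an independent sample of \<open>\<pi> l\<close>, for one \<open>l\<close> after the other.

  The moments of order \<open>r\<close> follow from \<open>x powr r \<le> exp (r * x)\<close>.
\<close>



section \<open>Integrals of bounded functions and product kernels\<close>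

lemma (in prob_space) integrable_bounded:
  fixes f :: "'a \<Rightarrow> real"
  assumes "f \<in> borel_measurable M" and "\<And>x. x \<in> space M \<Longrightarrow> \<bar>f x\<bar> \<le> B"
  shows "integrable M f"
  by (rule integrable_const_bound[where B = B]) (use assms in \<open>auto intro!: AE_I2\<close>)

lemma (in prob_space) abs_integral_le:
  fixes f :: "'a \<Rightarrow> real"
  assumes "\<And>x. x \<in> space M \<Longrightarrow> \<bar>f x\<bar> \<le> B"
  shows "\<bar>\<integral>x. f x \<partial>M\<bar> \<le> B"
proof (cases "integrable M f")
  case True
  have "\<bar>\<integral>x. f x \<partial>M\<bar> \<le> (\<integral>x. \<bar>f x\<bar> \<partial>M)"
    by (rule integral_abs_bound)
  also have "\<dots> \<le> (\<integral>x. B \<partial>M)"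
    using True assms by (intro integral_mono) auto
  finally show ?thesis by (simp add: prob_space)
next
  case False
  obtain x where "x \<in> space M" using not_empty by auto
  with assms have "0 \<le> B" by force
  with False show ?thesis by (simp add: not_integrable_integral_eq)
qed

lemma (in prob_space) abs_integral_diff_le:
  fixes f g :: "'a \<Rightarrow> real"
  assumes "integrable M f" "integrable M g" "\<And>x. x \<in> space M \<Longrightarrow> \<bar>f x - g x\<bar> \<le> B"
  shows "\<bar>(\<integral>x. f x \<partial>M) - (\<integral>x. g x \<partial>M)\<bar> \<le> B"
proof -
  have "(\<integral>x. f x \<partial>M) - (\<integral>x. g x \<partial>M) = (\<integral>x. f x - g x \<partial>M)"
    using assms by simp
  then show ?thesis
    using abs_integral_le[of "\<lambda>x. f x - g x" B] assms by simp
qed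

lemma integral_kernel_measurable:
  fixes f :: "'a \<Rightarrow> 'b \<Rightarrow> real"
  assumes f: "(\<lambda>(x, y). f x y) \<in> borel_measurable (M \<Otimes>\<^sub>M N)"
    and L: "L \<in> M \<rightarrow>\<^sub>M prob_algebra N"
  shows "(\<lambda>x. \<integral>y. f x y \<partial>L x) \<in> borel_measurable M"
proof -
  have "(\<lambda>x. distr (L x) (M \<Otimes>\<^sub>M N) (Pair x)) \<in> M \<rightarrow>\<^sub>M prob_algebra (M \<Otimes>\<^sub>M N)"
    by (rule measurable_distr_prob_space2[OF L]) simp
  from measurable_compose[OF measurable_prob_algebraD[OF this] integral_measurable_subprob_algebra[OF f]]
  have m: "(\<lambda>x. \<integral>z. (case z of (x, y) \<Rightarrow> f x y) \<partial>distr (L x) (M \<Otimes>\<^sub>M N) (Pair x)) \<in> borel_measurable M" .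
  show ?thesis
  proof (subst measurable_cong)
    fix x assume x: "x \<in> space M"
    have "sets (L x) = sets N"
      using measurable_space[OF L x] by (simp add: space_prob_algebra)
    then have "Pair x \<in> L x \<rightarrow>\<^sub>M M \<Otimes>\<^sub>M N"
      using measurable_Pair1'[OF x, of N] measurable_cong_sets[of "L x" N] by blast
    then show "(\<integral>y. f x y \<partial>L x) = (\<integral>z. (case z of (x, y) \<Rightarrow> f x y) \<partial>distr (L x) (M \<Otimes>\<^sub>M N) (Pair x))"
      using f by (subst integral_distr) auto
  qed (rule m)
qed

lemma emeasure_PiM_prob:
  assumes "finite I" "\<And>i. i \<in> I \<Longrightarrow> prob_space (A i)" "\<And>i. i \<in> I \<Longrightarrow> E i \<in> sets (A i)"
  shows "emeasure (PiM I A) (Pi\<^sub>E I E) = (\<Prod>i\<in>I. emeasure (A i) (E i))"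
proof -
  define A' where "A' i = (if i \<in> I then A i else return (count_space UNIV) undefined)" for i
  have p: "prob_space (A' i)" for i
    using assms(2) by (auto simp: A'_def intro!: prob_space_return)
  \<comment> \<open>\<open>product_sigma_finite\<close> concerns all indices of the type, hence the completion by point masses.\<close>
  interpret product_sigma_finite A'
    by (rule product_sigma_finite.intro) (rule prob_space_imp_sigma_finite[OF p])
  have "PiM I A = PiM I A'" by (rule PiM_cong) (auto simp: A'_def)
  then show ?thesis
    using emeasure_PiM[of I E] assms by (auto simp: A'_def intro!: prod.cong)
qed

lemma PiM_prob_eqI:
  assumes "finite I" "\<And>i. i \<in> I \<Longrightarrow> prob_space (A i)" "sets P = sets (PiM I A)"
    and "\<And>E. (\<And>i. i \<in> I \<Longrightarrow> E i \<in> sets (A i)) \<Longrightarrow> emeasure P (Pi\<^sub>E I E) = (\<Prod>i\<in>I. emeasure (A i) (E i))"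
  shows "P = PiM I A"
proof -
  define A' where "A' i = (if i \<in> I then A i else return (count_space UNIV) undefined)" for i
  have p: "prob_space (A' i)" for i
    using assms(2) by (auto simp: A'_def intro!: prob_space_return)
  interpret product_sigma_finite A'
    by (rule product_sigma_finite.intro) (rule prob_space_imp_sigma_finite[OF p])
  have eq: "PiM I A = PiM I A'" by (rule PiM_cong) (auto simp: A'_def)
  have "P = PiM I A'"
  proof (rule PiM_eqI)
    fix E assume "\<And>i. i \<in> I \<Longrightarrow> E i \<in> sets (A' i)"
    then show "emeasure P (Pi\<^sub>E I E) = (\<Prod>i\<in>I. emeasure (A' i) (E i))"
      using assms(4)[of E] by (auto simp: A'_def intro!: prod.cong)
  qed (use assms eq in auto)
  then show ?thesis using eq by simp
qed

lemma prob_space_PiM_on: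
  assumes "\<And>i. i \<in> I \<Longrightarrow> prob_space (A i)"
  shows "prob_space (PiM I A)"
  using prob_space_PiM[of I A] assms by blast

lemma measurable_PiM_kernel:
  assumes I: "finite I" and \<kappa>: "\<And>i. i \<in> I \<Longrightarrow> \<kappa> i \<in> M \<rightarrow>\<^sub>M prob_algebra (N i)"
  shows "(\<lambda>x. PiM I (\<lambda>i. \<kappa> i x)) \<in> M \<rightarrow>\<^sub>M prob_algebra (PiM I N)"
proof -
  have *: "prob_space (\<kappa> i x)" "sets (\<kappa> i x) = sets (N i)" if "i \<in> I" "x \<in> space M" for i x
    using measurable_space[OF \<kappa>] that by (auto simp: space_prob_algebra)
  show ?thesis
  proof (rule measurable_prob_algebra_generated[OF sets_PiM Int_stable_prod_algebra prod_algebra_sets_into_space])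
    show "prob_space (PiM I (\<lambda>i. \<kappa> i x))" if "x \<in> space M" for x
      using * that by (intro prob_space_PiM_on) auto
    show "sets (PiM I (\<lambda>i. \<kappa> i x)) = sets (PiM I N)" if "x \<in> space M" for x
      using * that by (intro sets_PiM_cong) auto
    fix A assume "A \<in> prod_algebra I N"
    then obtain E where E: "A = Pi\<^sub>E I E" "\<And>i. i \<in> I \<Longrightarrow> E i \<in> sets (N i)"
      using I by (auto simp: prod_algebra_eq_finite)
    have "(\<lambda>x. emeasure (PiM I (\<lambda>i. \<kappa> i x)) A) \<in> borel_measurable M \<longleftrightarrow>
        (\<lambda>x. \<Prod>i\<in>I. emeasure (\<kappa> i x) (E i)) \<in> borel_measurable M"
      using * E I by (intro measurable_cong) (auto intro!: emeasure_PiM_prob)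
    also have "\<dots>"
      using E(2) \<kappa> by (intro borel_measurable_prod_ennreal measurable_compose[OF measurable_prob_algebraD[OF \<kappa>] measurable_emeasure_subprob_algebra]) auto
    finally show "(\<lambda>x. emeasure (PiM I (\<lambda>i. \<kappa> i x)) A) \<in> borel_measurable M" .
  qed
qed

lemma measurable_fun_upd_PiM:
  assumes "l \<in> I"
  shows "(\<lambda>(y, z). y(l := z)) \<in> PiM I A \<Otimes>\<^sub>M A l \<rightarrow>\<^sub>M PiM I A"
  using measurable_add_dim[of l I A] assms by (simp add: insert_absorb)

text \<open>
  Overwriting one coordinate of a sample of a product law by an independent sample of \<open>N\<close>
  replaces the corresponding factor by \<open>N\<close>.  All statements below about changing a single
  factor of a product kernel come from this.
\<close>

lemma PiM_resample:
  assumes I: "finite I" and A: "\<And>i. i \<in> I \<Longrightarrow> prob_space (A i)" and l: "l \<in> I"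
    and N: "prob_space N" "sets N = sets (A l)"
  shows "distr (PiM I A \<Otimes>\<^sub>M N) (PiM I A) (\<lambda>(y, z). y(l := z)) = PiM I (A(l := N))"
proof (rule PiM_prob_eqI[OF I])
  show "prob_space ((A(l := N)) i)" if "i \<in> I" for i using A N that by auto
  have sets_eq: "sets (PiM I A) = sets (PiM I (A(l := N)))"
    using N by (intro sets_PiM_cong) auto
  then show "sets (distr (PiM I A \<Otimes>\<^sub>M N) (PiM I A) (\<lambda>(y, z). y(l := z))) = sets (PiM I (A(l := N)))"
    by simp
  interpret N: prob_space N by fact
  interpret PA: prob_space "PiM I A" using A by (rule prob_space_PiM_on)
  fix E assume E: "\<And>i. i \<in> I \<Longrightarrow> E i \<in> sets ((A(l := N)) i)"
  then have E': "\<And>i. i \<in> I \<Longrightarrow> E i \<in> sets (A i)" using N by (metis fun_upd_apply)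
  define E0 where "E0 = E(l := space (A l))"
  have El: "E l \<in> sets N" using E[OF l] by simp
  have E0: "\<And>i. i \<in> I \<Longrightarrow> E0 i \<in> sets (A i)" using E' l by (auto simp: E0_def)
  have m: "(\<lambda>(y, z). y(l := z)) \<in> PiM I A \<Otimes>\<^sub>M N \<rightarrow>\<^sub>M PiM I A"
    using measurable_fun_upd_PiM[OF l, of A] N(2)
    by (metis (no_types, lifting) measurable_cong_sets sets_pair_measure_cong)
  have box: "(\<lambda>(y, z). y(l := z)) -` Pi\<^sub>E I E \<inter> space (PiM I A \<Otimes>\<^sub>M N) = Pi\<^sub>E I E0 \<times> E l"
  proof (intro set_eqI iffI; clarsimp simp: space_pair_measure space_PiM)
    fix y z assume "y(l := z) \<in> Pi\<^sub>E I E" "y \<in> (\<Pi>\<^sub>E i\<in>I. space (A i))" "z \<in> space N"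
    then show "y \<in> Pi\<^sub>E I E0 \<and> z \<in> E l"
      using l by (auto simp: E0_def PiE_iff extensional_def split: if_splits)
  next
    fix y z assume *: "y \<in> Pi\<^sub>E I E0" "z \<in> E l"
    have "E i \<subseteq> space (A i)" if "i \<in> I" for i using E'[OF that] sets.sets_into_space by auto
    moreover have "E l \<subseteq> space N" using El sets.sets_into_space by auto
    ultimately show "y(l := z) \<in> Pi\<^sub>E I E \<and> y \<in> (\<Pi>\<^sub>E i\<in>I. space (A i)) \<and> z \<in> space N"
      using * l by (auto simp: E0_def PiE_iff extensional_def split: if_splits)
  qed
  have "emeasure (distr (PiM I A \<Otimes>\<^sub>M N) (PiM I A) (\<lambda>(y, z). y(l := z))) (Pi\<^sub>E I E)
      = emeasure (PiM I A) (Pi\<^sub>E I E0) * emeasure N (E l)"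
    using m E' I by (simp add: emeasure_distr sets_PiM_I_finite box)
       (rule N.emeasure_pair_measure_Times; use E0 I El in \<open>auto intro!: sets_PiM_I_finite\<close>)
  also have "emeasure (PiM I A) (Pi\<^sub>E I E0) = (\<Prod>i\<in>I. emeasure (A i) (E0 i))"
    using I A E0 by (intro emeasure_PiM_prob) auto
  also have "\<dots> = (\<Prod>i\<in>I - {l}. emeasure (A i) (E i))"
    using I l A by (subst prod.remove[of I l]) (auto simp: E0_def prob_space.emeasure_space_1 intro!: prod.cong)
  also have "\<dots> * emeasure N (E l) = (\<Prod>i\<in>I. emeasure ((A(l := N)) i) (E i))"
    using I l by (subst prod.remove[of I l]) (auto simp: mult.commute intro!: prod.cong)
  finally show "emeasure (distr (PiM I A \<Otimes>\<^sub>M N) (PiM I A) (\<lambda>(y, z). y(l := z))) (Pi\<^sub>E I E) =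
      (\<Prod>i\<in>I. emeasure ((A(l := N)) i) (E i))" .
qed

lemma integral_PiM_resample:
  fixes f :: "('i \<Rightarrow> 'a) \<Rightarrow> real"
  assumes I: "finite I" and A: "\<And>i. i \<in> I \<Longrightarrow> prob_space (A i)" and l: "l \<in> I"
    and N: "prob_space N" "sets N = sets (A l)"
    and f: "f \<in> borel_measurable (PiM I A)" "\<And>y. y \<in> space (PiM I A) \<Longrightarrow> \<bar>f y\<bar> \<le> B"
  shows "(\<integral>y. f y \<partial>PiM I (A(l := N))) = (\<integral>y. (\<integral>z. f (y(l := z)) \<partial>N) \<partial>PiM I A)"
    and "(\<integral>y. f y \<partial>PiM I (A(l := N))) = (\<integral>z. (\<integral>y. f (y(l := z)) \<partial>PiM I A) \<partial>N)"
proof -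
  interpret N: prob_space N by fact
  interpret PA: prob_space "PiM I A" using A by (rule prob_space_PiM_on)
  interpret pair_prob_space "PiM I A" N ..
  have m: "(\<lambda>(y, z). y(l := z)) \<in> PiM I A \<Otimes>\<^sub>M N \<rightarrow>\<^sub>M PiM I A"
    using measurable_fun_upd_PiM[OF l, of A] N(2)
    by (metis (no_types, lifting) measurable_cong_sets sets_pair_measure_cong)
  have bm: "(\<lambda>(y, z). f (y(l := z))) \<in> borel_measurable (PiM I A \<Otimes>\<^sub>M N)"
    using measurable_compose[OF m f(1)] by (simp add: case_prod_beta')
  have int: "integrable (PiM I A \<Otimes>\<^sub>M N) (\<lambda>(y, z). f (y(l := z)))"
    using bm f(2)[OF measurable_space[OF m]] by (intro P.integrable_bounded[where B = B]) auto
  have R: "distr (PiM I A \<Otimes>\<^sub>M N) (PiM I A) (\<lambda>(y, z). y(l := z)) = PiM I (A(l := N))"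
    by (rule PiM_resample) (use I A l N in auto)
  have "(\<integral>y. f y \<partial>PiM I (A(l := N))) = (\<integral>p. (case p of (y, z) \<Rightarrow> f (y(l := z))) \<partial>(PiM I A \<Otimes>\<^sub>M N))"
    by (subst R[symmetric], subst integral_distr[OF m f(1)]) (simp add: case_prod_beta')
  also have "\<dots> = (\<integral>y. (\<integral>z. f (y(l := z)) \<partial>N) \<partial>PiM I A)"
    using integral_fst'[OF int] by simp
  finally show 1: "(\<integral>y. f y \<partial>PiM I (A(l := N))) = (\<integral>y. (\<integral>z. f (y(l := z)) \<partial>N) \<partial>PiM I A)" .
  show "(\<integral>y. f y \<partial>PiM I (A(l := N))) = (\<integral>z. (\<integral>y. f (y(l := z)) \<partial>PiM I A) \<partial>N)"
    unfolding 1 using Fubini_integral[of "\<lambda>y z. f (y(l := z))"] int by simp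
qed

text \<open>
  By \<open>PiM_resample\<close> the two integrals differ only in the innermost integral over the coordinate \<open>l\<close>,
  so a bound that is uniform in the other coordinates is enough.
\<close>

lemma PiM_change_factor:
  fixes f :: "('i \<Rightarrow> 'a) \<Rightarrow> real"
  assumes I: "finite I" and A: "\<And>i. i \<in> I \<Longrightarrow> prob_space (A i)" and l: "l \<in> I"
    and N: "prob_space N" "sets N = sets (A l)"
    and f: "f \<in> borel_measurable (PiM I A)" "\<And>y. y \<in> space (PiM I A) \<Longrightarrow> \<bar>f y\<bar> \<le> B"
    and e: "\<And>y. y \<in> space (PiM I A) \<Longrightarrow>
      \<bar>(\<integral>z. f (y(l := z)) \<partial>A l) - (\<integral>z. f (y(l := z)) \<partial>N)\<bar> \<le> e"
  shows "\<bar>(\<integral>y. f y \<partial>PiM I A) - (\<integral>y. f y \<partial>PiM I (A(l := N)))\<bar> \<le> e"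
proof -
  interpret PA: prob_space "PiM I A" using A by (rule prob_space_PiM_on)
  have m: "(\<lambda>(y, z). y(l := z)) \<in> PiM I A \<Otimes>\<^sub>M N' \<rightarrow>\<^sub>M PiM I A" if "sets N' = sets (A l)" for N'
    using measurable_fun_upd_PiM[OF l, of A] that
    by (metis (no_types, lifting) measurable_cong_sets sets_pair_measure_cong)
  have int: "integrable (PiM I A) (\<lambda>y. \<integral>z. f (y(l := z)) \<partial>N')"
    if N': "prob_space N'" "sets N' = sets (A l)" for N'
  proof (rule PA.integrable_bounded[where B = B])
    interpret N': prob_space N' by fact
    show "(\<lambda>y. \<integral>z. f (y(l := z)) \<partial>N') \<in> borel_measurable (PiM I A)"
      using measurable_compose[OF m[OF N'(2)] f(1)]
      by (intro N'.borel_measurable_lebesgue_integral) (simp add: case_prod_beta')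
    fix y assume y: "y \<in> space (PiM I A)"
    show "\<bar>\<integral>z. f (y(l := z)) \<partial>N'\<bar> \<le> B"
    proof (rule N'.abs_integral_le)
      fix z assume "z \<in> space N'"
      then have "(case (y, z) of (y, z) \<Rightarrow> y(l := z)) \<in> space (PiM I A)"
        using y by (intro measurable_space[OF m[OF N'(2)]]) (auto simp: space_pair_measure)
      then show "\<bar>f (y(l := z))\<bar> \<le> B" using f(2) by simp
    qed
  qed
  have "(\<integral>y. f y \<partial>PiM I A) = (\<integral>y. (\<integral>z. f (y(l := z)) \<partial>A l) \<partial>PiM I A)"
    using integral_PiM_resample(1)[OF I A l A[OF l] refl f] by simp
  moreover have "(\<integral>y. f y \<partial>PiM I (A(l := N))) = (\<integral>y. (\<integral>z. f (y(l := z)) \<partial>N) \<partial>PiM I A)"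
    by (rule integral_PiM_resample(1)[OF I A l N f])
  ultimately show ?thesis
    using PA.abs_integral_diff_le[OF int[OF A[OF l] refl] int[OF N] e] by simp
qed



text \<open>
  Constants must depend on a test function only through a bound of it, so the bound is carried as a
  parameter.
\<close>

definition bounded_by :: "'a measure \<Rightarrow> real \<Rightarrow> ('a \<Rightarrow> real) \<Rightarrow> bool"
  where "bounded_by M B f \<longleftrightarrow> f \<in> borel_measurable M \<and> (\<forall>x\<in>space M. \<bar>f x\<bar> \<le> B)"

lemma bounded_byI: "f \<in> borel_measurable M \<Longrightarrow> (\<And>x. x \<in> space M \<Longrightarrow> \<bar>f x\<bar> \<le> B) \<Longrightarrow> bounded_by M B f"
  by (auto simp: bounded_by_def)

lemma bounded_by_measurable: "bounded_by M B f \<Longrightarrow> f \<in> borel_measurable M"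
  by (auto simp: bounded_by_def)

lemma bounded_by_abs: "bounded_by M B f \<Longrightarrow> x \<in> space M \<Longrightarrow> \<bar>f x\<bar> \<le> B"
  by (auto simp: bounded_by_def)

lemma bounded_by_nonneg: "bounded_by M B f \<Longrightarrow> space M \<noteq> {} \<Longrightarrow> 0 \<le> B"
  unfolding bounded_by_def by (metis abs_ge_zero ex_in_conv order_trans)

lemma bounded_by_comp: "bounded_by N B f \<Longrightarrow> g \<in> M \<rightarrow>\<^sub>M N \<Longrightarrow> bounded_by M B (\<lambda>x. f (g x))"
  by (auto simp: bounded_by_def dest: measurable_space)

lemma bounded_by_add: "bounded_by M B f \<Longrightarrow> bounded_by M C g \<Longrightarrow> bounded_by M (B + C) (\<lambda>x. f x + g x)"
  by (fastforce simp: bounded_by_def)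

lemma bounded_by_diff: "bounded_by M B f \<Longrightarrow> bounded_by M C g \<Longrightarrow> bounded_by M (B + C) (\<lambda>x. f x - g x)"
  by (fastforce simp: bounded_by_def)

lemma bounded_by_abs_diff_const:
  assumes "bounded_by M B f" "\<bar>a\<bar> \<le> A"
  shows "bounded_by M (B + A) (\<lambda>x. \<bar>f x - a\<bar>)"
proof (rule bounded_byI)
  show "(\<lambda>x. \<bar>f x - a\<bar>) \<in> borel_measurable M"
    using bounded_by_measurable[OF assms(1)] by measurable
  show "\<bar>\<bar>f x - a\<bar>\<bar> \<le> B + A" if "x \<in> space M" for x
    using bounded_by_abs[OF assms(1) that] assms(2) by linarith
qed

lemma bounded_measurable_iff: "g \<in> bounded_measurable Q \<longleftrightarrow> (\<exists>B. bounded_by Q B g)"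
  by (auto simp: bounded_measurable_def bounded_by_def bounded_iff)

lemma bounded_by_sup_norm: "g \<in> bounded_measurable Q \<Longrightarrow> bounded_by Q (sup_norm Q g) g"
  unfolding bounded_measurable_def bounded_by_def sup_norm_def
  by (auto simp: bounded_iff intro!: cSUP_upper bdd_aboveI)

lemma sup_norm_le: "bounded_by Q B g \<Longrightarrow> space Q \<noteq> {} \<Longrightarrow> sup_norm Q g \<le> B"
  unfolding bounded_by_def sup_norm_def by (auto intro: cSUP_least)

lemma bounded_by_integrable:
  assumes f: "bounded_by M B f" and Q: "Q \<in> space (prob_algebra M)"
  shows "integrable Q f"
proof -
  interpret prob_space Q using Q by (simp add: space_prob_algebra)
  have "sets Q = sets M" using Q by (simp add: space_prob_algebra)
  then show ?thesis
    using f by (intro integrable_bounded[where B = B])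
      (auto simp: bounded_by_def cong: measurable_cong_sets dest: sets_eq_imp_space_eq)
qed

lemma bounded_by_integral_le:
  assumes f: "bounded_by M B f" and Q: "Q \<in> space (prob_algebra M)"
  shows "\<bar>\<integral>x. f x \<partial>Q\<bar> \<le> B"
proof -
  interpret prob_space Q using Q by (simp add: space_prob_algebra)
  show ?thesis using f Q
    by (intro abs_integral_le) (auto simp: bounded_by_def space_prob_algebra dest: sets_eq_imp_space_eq)
qed

lemma bounded_by_integral_diff_le:
  assumes f: "bounded_by M B f" and g: "bounded_by M C g" and Q: "Q \<in> space (prob_algebra M)"
    and e: "\<And>x. x \<in> space M \<Longrightarrow> \<bar>f x - g x\<bar> \<le> e"
  shows "\<bar>(\<integral>x. f x \<partial>Q) - (\<integral>x. g x \<partial>Q)\<bar> \<le> e"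
proof -
  interpret prob_space Q using Q by (simp add: space_prob_algebra)
  have "space Q = space M" using Q by (auto simp: space_prob_algebra dest: sets_eq_imp_space_eq)
  then show ?thesis using bounded_by_integrable[OF f Q] bounded_by_integrable[OF g Q] e
    by (intro abs_integral_diff_le) auto
qed

lemma bounded_by_integral_mono:
  assumes f: "bounded_by M B f" and g: "bounded_by M C g" and Q: "Q \<in> space (prob_algebra M)"
    and e: "\<And>x. x \<in> space M \<Longrightarrow> f x \<le> g x"
  shows "(\<integral>x. f x \<partial>Q) \<le> (\<integral>x. g x \<partial>Q)"
proof -
  have "space Q = space M" using Q by (auto simp: space_prob_algebra dest: sets_eq_imp_space_eq)
  then show ?thesis using bounded_by_integrable[OF f Q] bounded_by_integrable[OF g Q] e
    by (intro integral_mono) auto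
qed

lemma bounded_by_kernel_integral:
  assumes f: "bounded_by (M \<Otimes>\<^sub>M N) B (\<lambda>(x, y). f x y)" and L: "L \<in> M \<rightarrow>\<^sub>M prob_algebra N"
  shows "bounded_by M B (\<lambda>x. \<integral>y. f x y \<partial>L x)"
proof (rule bounded_byI)
  show "(\<lambda>x. \<integral>y. f x y \<partial>L x) \<in> borel_measurable M"
    by (rule integral_kernel_measurable[OF bounded_by_measurable[OF f] L])
  fix x assume x: "x \<in> space M"
  have "bounded_by N B (f x)"
    using bounded_by_comp[OF f measurable_Pair1'[OF x]] by simp
  then show "\<bar>\<integral>y. f x y \<partial>L x\<bar> \<le> B"
    by (rule bounded_by_integral_le[OF _ measurable_space[OF L x]])
qed

lemma Fubini_bounded:
  assumes f: "bounded_by (M \<Otimes>\<^sub>M N) B (\<lambda>(x, y). f x y)"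
    and P: "P \<in> space (prob_algebra M)" and Q: "Q \<in> space (prob_algebra N)"
  shows "(\<integral>x. (\<integral>y. f x y \<partial>Q) \<partial>P) = (\<integral>y. (\<integral>x. f x y \<partial>P) \<partial>Q)"
proof -
  interpret P: prob_space P using P by (simp add: space_prob_algebra)
  interpret Q: prob_space Q using Q by (simp add: space_prob_algebra)
  interpret PQ: pair_prob_space P Q ..
  have s: "sets (P \<Otimes>\<^sub>M Q) = sets (M \<Otimes>\<^sub>M N)"
    using P Q by (intro sets_pair_measure_cong) (auto simp: space_prob_algebra)
  have "integrable (P \<Otimes>\<^sub>M Q) (\<lambda>(x, y). f x y)"
    by (rule bounded_by_integrable[OF f])
       (use s PQ.P.prob_space_axioms in \<open>simp add: space_prob_algebra\<close>)
  from PQ.Fubini_integral[OF this] show ?thesis by simp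
qed

lemma bind_integral_bounded:
  assumes P: "P \<in> space (prob_algebra M)" and L: "L \<in> M \<rightarrow>\<^sub>M prob_algebra N" and f: "bounded_by N B f"
  shows "(\<integral>y. f y \<partial>(P \<bind> L)) = (\<integral>x. (\<integral>y. f y \<partial>L x) \<partial>P)"
proof -
  interpret P: prob_space P using P by (simp add: space_prob_algebra)
  have s: "sets P = sets M" and sp: "space P = space M"
    using P by (auto simp: space_prob_algebra dest: sets_eq_imp_space_eq)
  have L': "L \<in> P \<rightarrow>\<^sub>M subprob_algebra N"
    using measurable_prob_algebraD[OF L] s measurable_cong_sets by blast
  show ?thesis
  proof (rule integral_bind[where K = N and B' = 1 and B = B])
    show "L \<in> P \<rightarrow>\<^sub>M subprob_algebra N" by fact
    show "f \<in> borel_measurable N" using f by (rule bounded_by_measurable)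
    show "\<bar>f x\<bar> \<le> B" if "x \<in> space N" for x using bounded_by_abs[OF f that] .
    show "AE x in P. emeasure (L x) (space (L x)) \<le> ennreal 1"
    proof (rule AE_I2)
      fix x assume "x \<in> space P"
      then have "prob_space (L x)" using measurable_space[OF L] sp by (auto simp: space_prob_algebra)
      then show "emeasure (L x) (space (L x)) \<le> ennreal 1" by (simp add: prob_space.emeasure_space_1)
    qed
  qed (rule P.finite_measure_axioms)
qed

lemma kernel_op_bounded_by:
  assumes K: "K \<in> M \<rightarrow>\<^sub>M prob_algebra M" and f: "bounded_by M B f"
  shows "bounded_by M B (kernel_op K f)"
  unfolding kernel_op_def
  by (rule bounded_by_kernel_integral[OF _ K], rule bounded_byI)
     (use f in \<open>auto simp: bounded_by_def space_pair_measure\<close>)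

lemma kernel_op_pow_bounded_by:
  assumes K: "K \<in> M \<rightarrow>\<^sub>M prob_algebra M" and f: "bounded_by M B f"
  shows "bounded_by M B ((kernel_op K ^^ k) f)"
  by (induction k) (use f kernel_op_bounded_by[OF K] in auto)

text \<open>
  Compare both integrals with the values of \<open>f\<close>: an average of \<open>f\<close> is within \<open>d\<close> of each value.
\<close>

lemma osc_integral:
  assumes f: "bounded_by Q B f" and P: "P \<in> prob_measures Q" "P' \<in> prob_measures Q"
    and d: "\<And>x y. x \<in> space Q \<Longrightarrow> y \<in> space Q \<Longrightarrow> \<bar>f x - f y\<bar> \<le> d"
  shows "\<bar>(\<integral>x. f x \<partial>P) - (\<integral>x. f x \<partial>P')\<bar> \<le> d"
proof -
  have const: "measure R (space R) = 1" if "R \<in> prob_measures Q" for R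
    using that by (simp add: space_prob_algebra prob_space.prob_space)
  have cb: "bounded_by Q \<bar>a\<bar> (\<lambda>_. a)" for a :: real by (simp add: bounded_by_def)
  have "\<bar>(\<integral>x. f x \<partial>P) - f y\<bar> \<le> d" if "y \<in> space Q" for y
    using bounded_by_integral_diff_le[OF f cb P(1), of "f y" d] d that const[OF P(1)] by simp
  then show ?thesis
    using bounded_by_integral_diff_le[OF cb f P(2), of "\<integral>x. f x \<partial>P" d] const[OF P(2)] by simp
qed

lemma kernel_op_pow_osc:
  assumes K: "K \<in> Q \<rightarrow>\<^sub>M prob_algebra Q" and f: "bounded_by Q B f"
    and d: "\<And>x y. x \<in> space Q \<Longrightarrow> y \<in> space Q \<Longrightarrow> \<bar>f x - f y\<bar> \<le> d"
    and "x \<in> space Q" "y \<in> space Q"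
  shows "\<bar>(kernel_op K ^^ k) f x - (kernel_op K ^^ k) f y\<bar> \<le> d"
  using assms(4,5)
proof (induction k arbitrary: x y)
  case (Suc k)
  show ?case
    using osc_integral[OF kernel_op_pow_bounded_by[OF K f] measurable_space[OF K Suc.prems(1)]
      measurable_space[OF K Suc.prems(2)] Suc.IH]
    by (simp add: kernel_op_def[of K "(kernel_op K ^^ k) f"])
qed (use d in auto)

lemma empirical_prob:
  assumes "\<And>p. p \<le> n \<Longrightarrow> x p \<in> space S"
  shows "empirical S n x \<in> prob_measures S"
proof -
  have "x \<in> uniform_count_measure {..n} \<rightarrow>\<^sub>M S"
    using assms by (simp add: measurable_def uniform_count_measure_def point_measure_def)
  then show ?thesis
    by (auto simp: space_prob_algebra empirical_def intro!: prob_space.prob_space_distr prob_space_uniform_count_measure)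
qed

lemma integral_empirical:
  fixes g :: "'a \<Rightarrow> real"
  assumes "\<And>p. p \<le> n \<Longrightarrow> x p \<in> space S" and g: "g \<in> borel_measurable S"
  shows "(\<integral>z. g z \<partial>empirical S n x) = (\<Sum>p\<le>n. g (x p)) / (real n + 1)"
proof -
  have "x \<in> uniform_count_measure {..n} \<rightarrow>\<^sub>M S"
    using assms(1) by (simp add: measurable_def uniform_count_measure_def point_measure_def)
  then have "(\<integral>z. g z \<partial>empirical S n x) = (\<integral>p. g (x p) \<partial>uniform_count_measure {..n})"
    unfolding empirical_def using g by (rule integral_distr)
  also have "\<dots> = (\<Sum>p\<le>n. g (x p)) / (real n + 1)"
    by (simp add: integral_uniform_count_measure add.commute)
  finally show ?thesis .
qed

lemma empirical_cong:
  assumes "\<And>p. p \<le> n \<Longrightarrow> x p = y p"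
  shows "empirical S n x = empirical S n y"
  unfolding empirical_def using assms by (intro distr_cong) (auto simp: space_uniform_count_measure)

section \<open>Triangular self-interacting chains\<close>

text \<open>
  The part of the assumptions that concerns the dynamics, with one power \<open>N\<close>, one rate \<open>\<kappa>\<close> and one
  Lipschitz constant \<open>c\<close> for the finitely many levels \<open>0, \<dots>, m\<close>.  Norms, Dobrushin coefficients and
  suprema over \<open>\<mu>\<close> are replaced by the pointwise inequalities that they stand for.
\<close>

locale triangular_chain =
  fixes m :: nat
    and S :: "nat \<Rightarrow> 'a measure"
    and M :: "nat \<Rightarrow> 'a measure \<Rightarrow> 'a \<Rightarrow> 'a measure"
    and N :: nat and \<kappa> c :: real
  assumes space_S: "\<And>l. l \<le> m \<Longrightarrow> space (S l) \<noteq> {}"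
    and M_markov: "\<And>l \<mu>. l \<le> m \<Longrightarrow> \<mu> \<in> prob_measures (S (l - 1)) \<Longrightarrow> M l \<mu> \<in> S l \<rightarrow>\<^sub>M prob_algebra (S l)"
    and M_path: "\<And>l n. l \<le> m \<Longrightarrow> (\<lambda>(x, y). M l (empirical (S (l - 1)) n x) y)
      \<in> (\<Pi>\<^sub>M p\<in>{..n}. S (l - 1)) \<Otimes>\<^sub>M S l \<rightarrow>\<^sub>M prob_algebra (S l)"
    and M_0: "\<And>\<mu> \<nu>. M 0 \<mu> = M 0 \<nu>"
    and N_pos: "1 \<le> N" and \<kappa>_pos: "0 < \<kappa>" and \<kappa>_less: "\<kappa> < 1" and c_nonneg: "0 \<le> c"
    and contraction: "\<And>l \<mu> f B d x y. l \<le> m \<Longrightarrow> \<mu> \<in> prob_measures (S (l - 1)) \<Longrightarrow> bounded_by (S l) B f \<Longrightarrow>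
      (\<And>x y. x \<in> space (S l) \<Longrightarrow> y \<in> space (S l) \<Longrightarrow> \<bar>f x - f y\<bar> \<le> d) \<Longrightarrow>
      x \<in> space (S l) \<Longrightarrow> y \<in> space (S l) \<Longrightarrow>
      \<bar>(kernel_op (M l \<mu>) ^^ N) f x - (kernel_op (M l \<mu>) ^^ N) f y\<bar> \<le> \<kappa> ^ N * d"
    and lipschitz: "\<And>l \<mu> \<nu> f B \<tau> x. l \<le> m \<Longrightarrow> \<mu> \<in> prob_measures (S (l - 1)) \<Longrightarrow> \<nu> \<in> prob_measures (S (l - 1)) \<Longrightarrow>
      bounded_by (S l) B f \<Longrightarrow>
      (\<And>g. bounded_by (S (l - 1)) 1 g \<Longrightarrow> \<bar>(\<integral>x. g x \<partial>\<mu>) - (\<integral>x. g x \<partial>\<nu>)\<bar> \<le> \<tau>) \<Longrightarrow>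
      x \<in> space (S l) \<Longrightarrow> \<bar>kernel_op (M l \<mu>) f x - kernel_op (M l \<nu>) f x\<bar> \<le> c * \<tau> * B"
begin

abbreviation Em :: "(nat \<Rightarrow> 'a) measure"
  where "Em \<equiv> \<Pi>\<^sub>M l\<in>{..m}. S l"

text \<open>
  A history is an infinite sequence of states of which the entries up to the current time matter.  One
  path space for all times avoids product spaces indexed by the time.
\<close>

abbreviation Hs :: "(nat \<Rightarrow> nat \<Rightarrow> 'a) measure"
  where "Hs \<equiv> \<Pi>\<^sub>M p\<in>(UNIV :: nat set). Em"

definition emp :: "nat \<Rightarrow> nat \<Rightarrow> (nat \<Rightarrow> nat \<Rightarrow> 'a) \<Rightarrow> 'a measure"
  where "emp l j h = empirical (S (l - 1)) j (\<lambda>p. h p (l - 1))"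

text \<open>
  \<open>lk l j h\<close> is the conditional law of level \<open>l\<close> at time \<open>Suc j\<close> given the history \<open>h\<close>; given \<open>h\<close> the
  levels move independently, which is the product \<open>K j h\<close>.
\<close>

definition lk :: "nat \<Rightarrow> nat \<Rightarrow> (nat \<Rightarrow> nat \<Rightarrow> 'a) \<Rightarrow> 'a measure"
  where "lk l j h = M l (emp l j h) (h j l)"

definition K :: "nat \<Rightarrow> (nat \<Rightarrow> nat \<Rightarrow> 'a) \<Rightarrow> (nat \<Rightarrow> 'a) measure"
  where "K j h = (\<Pi>\<^sub>M l\<in>{..m}. lk l j h)"

text \<open>
  The law of the path after \<open>k\<close> steps from the history \<open>h\<close> at time \<open>j\<close>; each step overwrites one entry.
\<close>

primrec run :: "nat \<Rightarrow> nat \<Rightarrow> (nat \<Rightarrow> nat \<Rightarrow> 'a) \<Rightarrow> (nat \<Rightarrow> nat \<Rightarrow> 'a) measure"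
  where "run j 0 h = return Hs h"
  | "run j (Suc k) h = run j k h \<bind> (\<lambda>h'. distr (K (j + k) h') Hs (\<lambda>y. h'(Suc (j + k) := y)))"

definition ev :: "nat \<Rightarrow> nat \<Rightarrow> ((nat \<Rightarrow> nat \<Rightarrow> 'a) \<Rightarrow> real) \<Rightarrow> (nat \<Rightarrow> nat \<Rightarrow> 'a) \<Rightarrow> real"
  where "ev j k F h = (\<integral>h'. F h' \<partial>run j k h)"

lemma space_Em_coord: "x \<in> space Em \<Longrightarrow> l \<le> m \<Longrightarrow> x l \<in> space (S l)"
  by (auto simp: space_PiM)

lemma space_Hs_coord: "h \<in> space Hs \<Longrightarrow> h p \<in> space Em"
  by (auto simp: space_PiM PiE_iff)

lemma space_Hs_coord2: "h \<in> space Hs \<Longrightarrow> l \<le> m \<Longrightarrow> h p l \<in> space (S l)"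
  using space_Em_coord space_Hs_coord by blast

lemma space_Em_upd: "x \<in> space Em \<Longrightarrow> l \<le> m \<Longrightarrow> z \<in> space (S l) \<Longrightarrow> x(l := z) \<in> space Em"
  by (auto simp: space_PiM PiE_iff extensional_def)

lemma space_Hs_upd: "h \<in> space Hs \<Longrightarrow> x \<in> space Em \<Longrightarrow> h(j := x) \<in> space Hs"
  by (auto simp: space_PiM PiE_iff)

lemma space_Hs_upd2: "h \<in> space Hs \<Longrightarrow> l \<le> m \<Longrightarrow> z \<in> space (S l) \<Longrightarrow> h(j := (h j)(l := z)) \<in> space Hs"
  by (intro space_Hs_upd space_Em_upd space_Hs_coord)

lemma space_Em_nonempty: "space Em \<noteq> {}"
  using space_S by (auto simp: space_PiM PiE_eq_empty_iff)

lemma measurable_Hs_coord: "(\<lambda>h. h p) \<in> Hs \<rightarrow>\<^sub>M Em"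
  by (rule measurable_component_singleton) simp

lemma measurable_Em_coord: "l \<le> m \<Longrightarrow> (\<lambda>x. x l) \<in> Em \<rightarrow>\<^sub>M S l"
  by (rule measurable_component_singleton) simp

lemma measurable_Hs_coord2: "l \<le> m \<Longrightarrow> (\<lambda>h. h p l) \<in> Hs \<rightarrow>\<^sub>M S l"
  by (rule measurable_compose[OF measurable_Hs_coord measurable_Em_coord])

lemma measurable_Hs_upd: "(\<lambda>(h, y). h(j := y)) \<in> Hs \<Otimes>\<^sub>M Em \<rightarrow>\<^sub>M Hs"
  by (rule measurable_fun_upd_PiM) simp

lemma measurable_Em_upd: "l \<le> m \<Longrightarrow> (\<lambda>(y, z). y(l := z)) \<in> Em \<Otimes>\<^sub>M S l \<rightarrow>\<^sub>M Em"
  by (rule measurable_fun_upd_PiM) simp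

lemma measurable_Hs_upd': "h \<in> space Hs \<Longrightarrow> (\<lambda>y. h(j := y)) \<in> Em \<rightarrow>\<^sub>M Hs"
  using measurable_compose[OF measurable_Pair1' measurable_Hs_upd[of j]] by simp

lemma measurable_Em_upd': "x \<in> space Em \<Longrightarrow> l \<le> m \<Longrightarrow> (\<lambda>z. x(l := z)) \<in> S l \<rightarrow>\<^sub>M Em"
  using measurable_compose[OF measurable_Pair1' measurable_Em_upd[of l]] by simp

lemma emp_prob: "h \<in> space Hs \<Longrightarrow> l \<le> m \<Longrightarrow> emp l j h \<in> prob_measures (S (l - 1))"
  unfolding emp_def by (rule empirical_prob) (auto intro: space_Hs_coord2)

lemma emp_cong: "(\<And>p. p \<le> j \<Longrightarrow> h p (l - 1) = h' p (l - 1)) \<Longrightarrow> emp l j h = emp l j h'"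
  unfolding emp_def by (rule empirical_cong)

lemma integral_emp:
  "h \<in> space Hs \<Longrightarrow> l \<le> m \<Longrightarrow> bounded_by (S (l - 1)) B g \<Longrightarrow>
    (\<integral>z. g z \<partial>emp l j h) = (\<Sum>p\<le>j. g (h p (l - 1))) / (real j + 1)"
  unfolding emp_def by (rule integral_empirical) (auto intro: space_Hs_coord2 bounded_by_measurable)

lemma measurable_lk:
  assumes l: "l \<le> m"
  shows "lk l j \<in> Hs \<rightarrow>\<^sub>M prob_algebra (S l)"
proof -
  have "(\<lambda>h. ((\<lambda>p\<in>{..j}. h p (l - 1)), h j l)) \<in> Hs \<rightarrow>\<^sub>M (\<Pi>\<^sub>M p\<in>{..j}. S (l - 1)) \<Otimes>\<^sub>M S l"
    using l by (intro measurable_Pair measurable_restrict measurable_Hs_coord2) auto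
  from measurable_compose[OF this M_path[OF l, of j]]
  have "(\<lambda>h. M l (empirical (S (l - 1)) j (\<lambda>p\<in>{..j}. h p (l - 1))) (h j l)) \<in> Hs \<rightarrow>\<^sub>M prob_algebra (S l)"
    by simp
  moreover have "empirical (S (l - 1)) j (\<lambda>p\<in>{..j}. h p (l - 1)) = emp l j h" for h
    unfolding emp_def by (rule empirical_cong) simp
  ultimately show ?thesis by (simp add: lk_def[abs_def])
qed

lemma lk_prob: "h \<in> space Hs \<Longrightarrow> l \<le> m \<Longrightarrow> lk l j h \<in> space (prob_algebra (S l))"
  by (rule measurable_space[OF measurable_lk])

lemma measurable_K: "K j \<in> Hs \<rightarrow>\<^sub>M prob_algebra Em"
  unfolding K_def[abs_def] by (rule measurable_PiM_kernel) (auto intro: measurable_lk)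

lemma K_prob: "h \<in> space Hs \<Longrightarrow> K j h \<in> space (prob_algebra Em)"
  by (rule measurable_space[OF measurable_K])

lemma measurable_step: "(\<lambda>h. distr (K j h) Hs (\<lambda>y. h(i := y))) \<in> Hs \<rightarrow>\<^sub>M prob_algebra Hs"
  by (rule measurable_distr_prob_space2[OF measurable_K measurable_Hs_upd])

lemma measurable_run: "run j k \<in> Hs \<rightarrow>\<^sub>M prob_algebra Hs"
proof (induction k)
  case 0
  then show ?case by (simp add: measurable_return_prob_space)
next
  case (Suc k)
  then show ?case
    using measurable_bind_prob_space[OF Suc measurable_step] by simp
qed

lemma run_prob: "h \<in> space Hs \<Longrightarrow> run j k h \<in> space (prob_algebra Hs)"
  by (rule measurable_space[OF measurable_run])

lemma ev_bounded_by: "bounded_by Hs B F \<Longrightarrow> bounded_by Hs B (ev j k F)"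
  unfolding ev_def[abs_def]
  by (rule bounded_by_kernel_integral[OF _ measurable_run], rule bounded_byI)
     (auto simp: bounded_by_def space_pair_measure)

lemma step_bounded_by:
  assumes "bounded_by Hs B F"
  shows "bounded_by (Hs \<Otimes>\<^sub>M Em) B (\<lambda>(h, y). F (h(j := y)))"
  using bounded_by_comp[OF assms measurable_Hs_upd[of j]] by (simp add: case_prod_beta')

lemma ev_0: "bounded_by Hs B F \<Longrightarrow> h \<in> space Hs \<Longrightarrow> ev j 0 F h = F h"
  by (simp add: ev_def integral_return bounded_by_def)

lemma ev_1:
  assumes F: "bounded_by Hs B F" and h: "h \<in> space Hs"
  shows "ev j (Suc 0) F h = (\<integral>y. F (h(Suc j := y)) \<partial>K j h)"
proof -
  have m: "(\<lambda>y. h(Suc j := y)) \<in> K j h \<rightarrow>\<^sub>M Hs"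
    using measurable_Hs_upd'[OF h] K_prob[OF h, of j]
    by (auto simp: space_prob_algebra cong: measurable_cong_sets)
  have "run j (Suc 0) h = distr (K j h) Hs (\<lambda>y. h(Suc j := y))"
    using bind_return[OF measurable_prob_algebraD[OF measurable_step] h] by simp
  then show ?thesis
    using integral_distr[OF m bounded_by_measurable[OF F]] by (simp add: ev_def)
qed

lemma ev_Suc_right:
  assumes F: "bounded_by Hs B F" and h: "h \<in> space Hs"
  shows "ev j (Suc k) F h = ev j k (ev (j + k) (Suc 0) F) h"
proof -
  have "ev j (Suc k) F h = (\<integral>h'. (\<integral>h''. F h'' \<partial>distr (K (j + k) h') Hs (\<lambda>y. h'(Suc (j + k) := y))) \<partial>run j k h)"
    unfolding ev_def using bind_integral_bounded[OF run_prob[OF h] measurable_step F] by simp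
  also have "\<dots> = ev j k (ev (j + k) (Suc 0) F) h"
    unfolding ev_def[of j k]
  proof (rule Bochner_Integration.integral_cong[OF refl])
    fix h' assume "h' \<in> space (run j k h)"
    then have h': "h' \<in> space Hs"
      using run_prob[OF h, of j k] by (auto simp: space_prob_algebra dest: sets_eq_imp_space_eq)
    have m: "(\<lambda>y. h'(Suc (j + k) := y)) \<in> K (j + k) h' \<rightarrow>\<^sub>M Hs"
      using measurable_Hs_upd'[OF h'] K_prob[OF h', of "j + k"]
      by (auto simp: space_prob_algebra cong: measurable_cong_sets)
    show "(\<integral>h''. F h'' \<partial>distr (K (j + k) h') Hs (\<lambda>y. h'(Suc (j + k) := y))) = ev (j + k) (Suc 0) F h'"
      using integral_distr[OF m bounded_by_measurable[OF F]] ev_1[OF F h', of "j + k"] by simp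
  qed
  finally show ?thesis .
qed

lemma ev_cong:
  assumes h: "h \<in> space Hs" and "\<And>h'. h' \<in> space Hs \<Longrightarrow> F h' = G h'"
  shows "ev j k F h = ev j k G h"
  unfolding ev_def using run_prob[OF h, of j k] assms(2)
  by (intro Bochner_Integration.integral_cong) (auto simp: space_prob_algebra dest: sets_eq_imp_space_eq)

lemma ev_add:
  assumes F: "bounded_by Hs B F" and h: "h \<in> space Hs"
  shows "ev j (a + b) F h = ev j a (ev (j + a) b F) h"
  using F h
proof (induction b arbitrary: B F)
  case 0
  then show ?case using ev_0[OF 0(1)] ev_cong[OF 0(2), of "ev (j + a) 0 F" F j a] by simp
next
  case (Suc b)
  have "ev j (a + Suc b) F h = ev j (a + b) (ev (j + (a + b)) (Suc 0) F) h"
    using ev_Suc_right[OF Suc.prems] by simp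
  also have "\<dots> = ev j a (ev (j + a) b (ev (j + (a + b)) (Suc 0) F)) h"
    by (rule Suc.IH[OF ev_bounded_by[OF Suc.prems(1)] Suc.prems(2)])
  also have "\<dots> = ev j a (ev (j + a) (Suc b) F) h"
    using ev_Suc_right[OF Suc.prems(1), of _ "j + a" b] Suc.prems(2)
    by (intro ev_cong) (auto simp: add.assoc)
  finally show ?case .
qed

lemma ev_const: "h \<in> space Hs \<Longrightarrow> ev j k (\<lambda>_. a) h = a"
  using run_prob[of h j k] by (simp add: ev_def space_prob_algebra prob_space.prob_space)

lemma ev_integrable: "bounded_by Hs B F \<Longrightarrow> h \<in> space Hs \<Longrightarrow> integrable (run j k h) F"
  by (rule bounded_by_integrable[OF _ run_prob])

lemma ev_diff: "bounded_by Hs B F \<Longrightarrow> bounded_by Hs C G \<Longrightarrow> h \<in> space Hs \<Longrightarrow>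
    ev j k (\<lambda>h. F h - G h) h = ev j k F h - ev j k G h"
  unfolding ev_def by (intro Bochner_Integration.integral_diff ev_integrable)

lemma ev_abs_diff_le: "bounded_by Hs B F \<Longrightarrow> bounded_by Hs C G \<Longrightarrow> h \<in> space Hs \<Longrightarrow>
    (\<And>h'. h' \<in> space Hs \<Longrightarrow> \<bar>F h' - G h'\<bar> \<le> e) \<Longrightarrow> \<bar>ev j k F h - ev j k G h\<bar> \<le> e"
  unfolding ev_def by (rule bounded_by_integral_diff_le[OF _ _ run_prob])

lemma ev_mono: "bounded_by Hs B F \<Longrightarrow> bounded_by Hs C G \<Longrightarrow> h \<in> space Hs \<Longrightarrow>
    (\<And>h'. h' \<in> space Hs \<Longrightarrow> F h' \<le> G h') \<Longrightarrow> ev j k F h \<le> ev j k G h"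
  unfolding ev_def by (rule bounded_by_integral_mono[OF _ _ run_prob])

lemma ev_adapted:
  assumes F: "bounded_by Hs B F" and h: "h \<in> space Hs"
    and ad: "\<And>h i y. h \<in> space Hs \<Longrightarrow> y \<in> space Em \<Longrightarrow> j < i \<Longrightarrow> F (h(i := y)) = F h"
  shows "ev j k F h = F h"
  using h
proof (induction k arbitrary: h)
  case 0
  then show ?case using ev_0[OF F] by simp
next
  case (Suc k)
  have "ev j (Suc k) F h = ev j k (ev (j + k) (Suc 0) F) h"
    by (rule ev_Suc_right[OF F Suc.prems])
  also have "\<dots> = ev j k F h"
  proof (rule ev_cong[OF Suc.prems])
    fix h' assume h': "h' \<in> space Hs"
    have K: "prob_space (K (j + k) h')" "space (K (j + k) h') = space Em"
      using K_prob[OF h', of "j + k"] by (auto simp: space_prob_algebra dest: sets_eq_imp_space_eq)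
    have "ev (j + k) (Suc 0) F h' = (\<integral>y. F h' \<partial>K (j + k) h')"
      unfolding ev_1[OF F h'] by (rule Bochner_Integration.integral_cong) (use K ad[OF h'] in auto)
    then show "ev (j + k) (Suc 0) F h' = F h'"
      using K prob_space.prob_space[OF K(1)] by simp
  qed
  finally show ?case using Suc.IH[OF Suc.prems] by simp
qed

end



context triangular_chain
begin

section \<open>Contraction in an adapted oscillation seminorm\<close>

abbreviation T :: "nat \<Rightarrow> 'a measure \<Rightarrow> nat \<Rightarrow> ('a \<Rightarrow> real) \<Rightarrow> 'a \<Rightarrow> real"
  where "T l \<mu> k f \<equiv> (kernel_op (M l \<mu>) ^^ k) f"

text \<open>
  \<open>contr l \<mu> d f\<close> bounds by \<open>d\<close> the seminorm \<open>max {osc (T^k f) / \<kappa>^k | k < N}\<close> of \<open>f\<close>, where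
  \<open>T = M l \<mu>\<close>.  Only the power \<open>N\<close> of \<open>T\<close> contracts oscillations, but for this equivalent seminorm
  \<open>T\<close> itself is a contraction, so that one step of the chain can be analysed at a time.  Inequalities
  for single points, unlike suprema, pass to averages over a parameter of \<open>f\<close>.
\<close>

definition contr :: "nat \<Rightarrow> 'a measure \<Rightarrow> real \<Rightarrow> ('a \<Rightarrow> real) \<Rightarrow> bool"
  where "contr l \<mu> d f \<longleftrightarrow>
    (\<forall>k<N. \<forall>x\<in>space (S l). \<forall>y\<in>space (S l). \<bar>T l \<mu> k f x - T l \<mu> k f y\<bar> \<le> \<kappa> ^ k * d)"

lemma contrD0: "contr l \<mu> d f \<Longrightarrow> x \<in> space (S l) \<Longrightarrow> y \<in> space (S l) \<Longrightarrow> \<bar>f x - f y\<bar> \<le> d"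
  using N_pos unfolding contr_def by (auto dest: spec[of _ 0])

lemma contr_nonneg: "l \<le> m \<Longrightarrow> contr l \<mu> d f \<Longrightarrow> 0 \<le> d"
  using contrD0 space_S by (metis abs_ge_zero all_not_in_conv order_trans)

lemma contr_mono: "contr l \<mu> d f \<Longrightarrow> d \<le> d' \<Longrightarrow> contr l \<mu> d' f"
  unfolding contr_def using \<kappa>_pos by (meson mult_left_mono order_trans zero_le_power less_imp_le)

lemma T_bounded_by: "l \<le> m \<Longrightarrow> \<mu> \<in> prob_measures (S (l - 1)) \<Longrightarrow> bounded_by (S l) B f \<Longrightarrow>
    bounded_by (S l) B (T l \<mu> k f)"
  by (rule kernel_op_pow_bounded_by[OF M_markov])

lemma kernel_op_cong:
  assumes "l \<le> m" "\<mu> \<in> prob_measures (S (l - 1))" "x \<in> space (S l)"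
    and "\<And>x. x \<in> space (S l) \<Longrightarrow> f x = g x"
  shows "kernel_op (M l \<mu>) f x = kernel_op (M l \<mu>) g x"
proof -
  have "space (M l \<mu> x) = space (S l)"
    using measurable_space[OF M_markov[OF assms(1,2)] assms(3)]
    by (auto simp: space_prob_algebra dest: sets_eq_imp_space_eq)
  then show ?thesis
    unfolding kernel_op_def using assms(4) by (intro Bochner_Integration.integral_cong) auto
qed

lemma T_cong:
  assumes "l \<le> m" "\<mu> \<in> prob_measures (S (l - 1))" "x \<in> space (S l)"
    and "\<And>x. x \<in> space (S l) \<Longrightarrow> f x = g x"
  shows "T l \<mu> k f x = T l \<mu> k g x"
  using assms(3)
proof (induction k arbitrary: x)
  case (Suc k)
  then show ?case using kernel_op_cong[OF assms(1,2) Suc.prems Suc.IH] by simp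
qed (use assms(4) in simp)

lemma kernel_op_add:
  assumes "l \<le> m" "\<mu> \<in> prob_measures (S (l - 1))" "x \<in> space (S l)"
    and "bounded_by (S l) B f" "bounded_by (S l) C g"
  shows "kernel_op (M l \<mu>) (\<lambda>x. f x + g x) x = kernel_op (M l \<mu>) f x + kernel_op (M l \<mu>) g x"
  unfolding kernel_op_def using measurable_space[OF M_markov[OF assms(1,2)] assms(3)] assms(4,5)
  by (intro Bochner_Integration.integral_add bounded_by_integrable)

lemma T_add:
  assumes "l \<le> m" "\<mu> \<in> prob_measures (S (l - 1))" "x \<in> space (S l)"
    and "bounded_by (S l) B f" "bounded_by (S l) C g"
  shows "T l \<mu> k (\<lambda>x. f x + g x) x = T l \<mu> k f x + T l \<mu> k g x"
  using assms(3)
proof (induction k arbitrary: x)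
  case (Suc k)
  have "T l \<mu> (Suc k) (\<lambda>x. f x + g x) x = kernel_op (M l \<mu>) (\<lambda>x. T l \<mu> k f x + T l \<mu> k g x) x"
    using kernel_op_cong[OF assms(1,2) Suc.prems Suc.IH] by simp
  also have "\<dots> = T l \<mu> (Suc k) f x + T l \<mu> (Suc k) g x"
    using kernel_op_add[OF assms(1,2) Suc.prems T_bounded_by[OF assms(1,2,4)] T_bounded_by[OF assms(1,2,5)]] by simp
  finally show ?case .
qed simp

lemma contr_add:
  assumes "l \<le> m" "\<mu> \<in> prob_measures (S (l - 1))" "bounded_by (S l) B f" "bounded_by (S l) C g"
    and f: "contr l \<mu> d f" and g: "contr l \<mu> e g"
    and eq: "\<And>x. x \<in> space (S l) \<Longrightarrow> u x = f x + g x"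
  shows "contr l \<mu> (d + e) u"
  unfolding contr_def
proof (intro allI impI ballI)
  fix k x y assume k: "k < N" and x: "x \<in> space (S l)" and y: "y \<in> space (S l)"
  have *: "T l \<mu> k u x = T l \<mu> k f x + T l \<mu> k g x" if "x \<in> space (S l)" for x
    using T_cong[OF assms(1,2) that eq] T_add[OF assms(1,2) that assms(3,4)] by simp
  have "\<bar>T l \<mu> k f x - T l \<mu> k f y\<bar> \<le> \<kappa> ^ k * d" "\<bar>T l \<mu> k g x - T l \<mu> k g y\<bar> \<le> \<kappa> ^ k * e"
    using f g k x y unfolding contr_def by blast+
  then show "\<bar>T l \<mu> k u x - T l \<mu> k u y\<bar> \<le> \<kappa> ^ k * (d + e)"
    unfolding *[OF x] *[OF y] by (simp add: algebra_simps)
qed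

lemma T_osc:
  assumes "l \<le> m" "\<mu> \<in> prob_measures (S (l - 1))" "bounded_by (S l) B f"
    and "\<And>x y. x \<in> space (S l) \<Longrightarrow> y \<in> space (S l) \<Longrightarrow> \<bar>f x - f y\<bar> \<le> d"
    and "x \<in> space (S l)" "y \<in> space (S l)"
  shows "\<bar>T l \<mu> k f x - T l \<mu> k f y\<bar> \<le> d"
  by (rule kernel_op_pow_osc[OF M_markov[OF assms(1,2)] assms(3-6)])

text \<open>
  The seminorm is at most \<open>\<kappa>^(-N)\<close> times the oscillation since \<open>T\<close> does not increase oscillations.
\<close>

lemma contr_of_osc:
  assumes "l \<le> m" "\<mu> \<in> prob_measures (S (l - 1))" "bounded_by (S l) B f"
    and d: "\<And>x y. x \<in> space (S l) \<Longrightarrow> y \<in> space (S l) \<Longrightarrow> \<bar>f x - f y\<bar> \<le> d"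
  shows "contr l \<mu> (d / \<kappa> ^ N) f"
  unfolding contr_def
proof (intro allI impI ballI)
  fix k x y assume k: "k < N" and x: "x \<in> space (S l)" and y: "y \<in> space (S l)"
  have "0 \<le> d" using d[OF x x] by simp
  have "\<bar>T l \<mu> k f x - T l \<mu> k f y\<bar> \<le> d"
    by (rule T_osc[OF assms x y])
  also have "d \<le> \<kappa> ^ k * (d / \<kappa> ^ N)"
    using power_decreasing[of k N \<kappa>] k \<kappa>_pos \<kappa>_less \<open>0 \<le> d\<close>
    by (simp add: pos_le_divide_eq mult.commute mult_left_mono)
  finally show "\<bar>T l \<mu> k f x - T l \<mu> k f y\<bar> \<le> \<kappa> ^ k * (d / \<kappa> ^ N)" .
qed

text \<open>
  Applying \<open>T\<close> shifts \<open>k\<close> by one, which gains a factor \<open>\<kappa>\<close>; the new top index \<open>N\<close> is handled by the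
  contraction of \<open>T^N\<close>.
\<close>

lemma contr_step:
  assumes "l \<le> m" "\<mu> \<in> prob_measures (S (l - 1))" "bounded_by (S l) B f" and f: "contr l \<mu> d f"
  shows "contr l \<mu> (\<kappa> * d) (kernel_op (M l \<mu>) f)"
  unfolding contr_def
proof (intro allI impI ballI)
  fix k x y assume k: "k < N" and x: "x \<in> space (S l)" and y: "y \<in> space (S l)"
  have "\<bar>T l \<mu> (Suc k) f x - T l \<mu> (Suc k) f y\<bar> \<le> \<kappa> ^ Suc k * d"
  proof (cases "Suc k < N")
    case True
    then show ?thesis using f x y unfolding contr_def by blast
  next
    case False
    then have "Suc k = N" using k by simp
    then show ?thesis using contraction[OF assms(1-3) contrD0[OF f] x y] by metis
  qed
  then show "\<bar>T l \<mu> k (kernel_op (M l \<mu>) f) x - T l \<mu> k (kernel_op (M l \<mu>) f) y\<bar> \<le> \<kappa> ^ k * (\<kappa> * d)"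
    by (simp add: funpow_swap1 algebra_simps)
qed

lemma lipschitz_osc:
  assumes l: "l \<le> m" and \<mu>: "\<mu> \<in> prob_measures (S (l - 1))" and \<nu>: "\<nu> \<in> prob_measures (S (l - 1))"
    and f: "bounded_by (S l) B f"
    and d: "\<And>x y. x \<in> space (S l) \<Longrightarrow> y \<in> space (S l) \<Longrightarrow> \<bar>f x - f y\<bar> \<le> d"
    and \<tau>: "\<And>g. bounded_by (S (l - 1)) 1 g \<Longrightarrow> \<bar>(\<integral>x. g x \<partial>\<mu>) - (\<integral>x. g x \<partial>\<nu>)\<bar> \<le> \<tau>"
    and x: "x \<in> space (S l)"
  shows "\<bar>kernel_op (M l \<mu>) f x - kernel_op (M l \<nu>) f x\<bar> \<le> c * \<tau> * d"
proof -
  have g: "bounded_by (S l) d (\<lambda>y. f y + - f x)"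
    using f d[OF _ x] by (auto simp: bounded_by_def)
  have cb: "bounded_by (S l) \<bar>f x\<bar> (\<lambda>_. - f x)" by (simp add: bounded_by_def)
  have "kernel_op (M l \<mu>) (\<lambda>_. - f x) x = - f x" if "\<mu> \<in> prob_measures (S (l - 1))" for \<mu>
    using measurable_space[OF M_markov[OF l that] x]
    by (simp add: kernel_op_def space_prob_algebra prob_space.prob_space)
  then have "kernel_op (M l \<mu>) (\<lambda>y. f y + - f x) x = kernel_op (M l \<mu>) f x - f x"
    if "\<mu> \<in> prob_measures (S (l - 1))" for \<mu>
    using kernel_op_add[OF l that x f cb] that by simp
  then show ?thesis
    using lipschitz[OF l \<mu> \<nu> g \<tau> x] \<mu> \<nu> by simp
qed

text \<open>
  The seminorm depends on \<open>\<mu>\<close>, which drifts with the empirical measure.  Exchanging the kernels one at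
  a time changes \<open>T^k f\<close> by at most \<open>k\<close> times the Lipschitz bound, so a change of \<open>\<mu>\<close> by \<open>\<tau>\<close> costs a
  factor \<open>1 + O(\<tau>)\<close>.
\<close>

lemma contr_change:
  assumes l: "l \<le> m" and \<mu>: "\<mu> \<in> prob_measures (S (l - 1))" and \<nu>: "\<nu> \<in> prob_measures (S (l - 1))"
    and f: "bounded_by (S l) B f"
    and \<tau>: "\<And>g. bounded_by (S (l - 1)) 1 g \<Longrightarrow> \<bar>(\<integral>x. g x \<partial>\<mu>) - (\<integral>x. g x \<partial>\<nu>)\<bar> \<le> \<tau>"
    and d: "contr l \<nu> d f"
  shows "contr l \<mu> ((1 + 2 * real N * c * \<tau> / \<kappa> ^ N) * d) f"
proof -
  have d0: "0 \<le> d" by (rule contr_nonneg[OF l d])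
  have "bounded_by (S (l - 1)) 1 (\<lambda>_. 0)" by (simp add: bounded_by_def)
  from \<tau>[OF this] have \<tau>0: "0 \<le> \<tau>" by simp
  have diff: "\<bar>T l \<mu> k f x - T l \<nu> k f x\<bar> \<le> real k * (c * \<tau> * d)" if "k < N" "x \<in> space (S l)" for k x
    using that
  proof (induction k arbitrary: x)
    case (Suc k)
    have "\<bar>kernel_op (M l \<mu>) (T l \<mu> k f) x - kernel_op (M l \<mu>) (T l \<nu> k f) x\<bar> \<le> real k * (c * \<tau> * d)"
      unfolding kernel_op_def[of _ "T l _ k f"]
      using Suc.IH Suc.prems measurable_space[OF M_markov[OF l \<mu>]]
      by (intro bounded_by_integral_diff_le[OF T_bounded_by[OF l \<mu> f] T_bounded_by[OF l \<nu> f]]) auto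
    moreover have "\<bar>kernel_op (M l \<mu>) (T l \<nu> k f) x - kernel_op (M l \<nu>) (T l \<nu> k f) x\<bar> \<le> c * \<tau> * d"
    proof (rule lipschitz_osc[OF l \<mu> \<nu> T_bounded_by[OF l \<nu> f] _ \<tau> Suc.prems(2)])
      fix x y assume "x \<in> space (S l)" "y \<in> space (S l)"
      then show "\<bar>T l \<nu> k f x - T l \<nu> k f y\<bar> \<le> d"
        using T_osc[OF l \<nu> f, of d x y k] contrD0[OF d] by blast
    qed
    ultimately show ?case by (simp add: algebra_simps)
  qed simp
  show ?thesis
    unfolding contr_def
  proof (intro allI impI ballI)
    fix k x y assume k: "k < N" and x: "x \<in> space (S l)" and y: "y \<in> space (S l)"
    have "\<bar>T l \<nu> k f x - T l \<nu> k f y\<bar> \<le> \<kappa> ^ k * d"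
      using d k x y unfolding contr_def by blast
    with diff[OF k x] diff[OF k y]
    have "\<bar>T l \<mu> k f x - T l \<mu> k f y\<bar> \<le> \<kappa> ^ k * d + 2 * (real k * (c * \<tau> * d))" by linarith
    also have "real k * (c * \<tau> * d) \<le> real N * (c * \<tau> * d)"
      using k c_nonneg \<tau>0 d0 by (intro mult_right_mono) auto
    also have "real N * (c * \<tau> * d) \<le> \<kappa> ^ k * (real N * (c * \<tau> * d) / \<kappa> ^ N)"
    proof -
      have "\<kappa> ^ N * (real N * (c * \<tau> * d)) \<le> \<kappa> ^ k * (real N * (c * \<tau> * d))"
        using power_decreasing[of k N \<kappa>] k \<kappa>_pos \<kappa>_less c_nonneg \<tau>0 d0
        by (intro mult_right_mono mult_nonneg_nonneg) auto
      then show ?thesis using \<kappa>_pos by (simp add: pos_le_divide_eq mult.commute)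
    qed
    finally show "\<bar>T l \<mu> k f x - T l \<mu> k f y\<bar> \<le> \<kappa> ^ k * ((1 + 2 * real N * c * \<tau> / \<kappa> ^ N) * d)"
      by (simp add: field_simps)
  qed
qed

lemma T_mix:
  assumes l: "l \<le> m" and \<mu>: "\<mu> \<in> prob_measures (S (l - 1))" and Q: "Q \<in> prob_measures R"
    and f: "bounded_by (R \<Otimes>\<^sub>M S l) B (\<lambda>(y, z). f y z)"
  shows "bounded_by (R \<Otimes>\<^sub>M S l) B (\<lambda>(y, z). T l \<mu> k (f y) z)"
    and "z \<in> space (S l) \<Longrightarrow> T l \<mu> k (\<lambda>z. \<integral>y. f y z \<partial>Q) z = (\<integral>y. T l \<mu> k (f y) z \<partial>Q)"
proof -
  have bd: "bounded_by (R \<Otimes>\<^sub>M S l) B (\<lambda>(y, z). T l \<mu> k (f y) z)" for k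
  proof (induction k)
    case (Suc k)
    have "bounded_by ((R \<Otimes>\<^sub>M S l) \<Otimes>\<^sub>M S l) B (\<lambda>(p, w). T l \<mu> k (f (fst p)) w)"
      using bounded_by_comp[OF Suc, where M = "(R \<Otimes>\<^sub>M S l) \<Otimes>\<^sub>M S l" and g = "\<lambda>(p, w). (fst p, w)"] by (simp add: case_prod_beta')
    moreover have "(\<lambda>p. M l \<mu> (snd p)) \<in> R \<Otimes>\<^sub>M S l \<rightarrow>\<^sub>M prob_algebra (S l)"
      using M_markov[OF l \<mu>] by simp
    ultimately have "bounded_by (R \<Otimes>\<^sub>M S l) B (\<lambda>p. \<integral>w. T l \<mu> k (f (fst p)) w \<partial>M l \<mu> (snd p))"
      by (rule bounded_by_kernel_integral)
    then show ?case by (simp add: kernel_op_def[of "M l \<mu>" "T l \<mu> k (f _)"] case_prod_beta')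
  qed (use f in simp)
  then show "bounded_by (R \<Otimes>\<^sub>M S l) B (\<lambda>(y, z). T l \<mu> k (f y) z)" .
  show "T l \<mu> k (\<lambda>z. \<integral>y. f y z \<partial>Q) z = (\<integral>y. T l \<mu> k (f y) z \<partial>Q)" if "z \<in> space (S l)"
    using that
  proof (induction k arbitrary: z)
    case (Suc k)
    have "T l \<mu> (Suc k) (\<lambda>z. \<integral>y. f y z \<partial>Q) z = kernel_op (M l \<mu>) (\<lambda>z. \<integral>y. T l \<mu> k (f y) z \<partial>Q) z"
      using kernel_op_cong[OF l \<mu> Suc.prems Suc.IH] by simp
    also have "\<dots> = (\<integral>y. T l \<mu> (Suc k) (f y) z \<partial>Q)"
      unfolding kernel_op_def[of _ "\<lambda>z. \<integral>y. T l \<mu> k (f y) z \<partial>Q"]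
      using Fubini_bounded[OF bd[of k] Q measurable_space[OF M_markov[OF l \<mu>] Suc.prems]]
      by (simp add: kernel_op_def)
    finally show ?case .
  qed simp
qed

lemma contr_mix:
  assumes l: "l \<le> m" and \<mu>: "\<mu> \<in> prob_measures (S (l - 1))" and Q: "Q \<in> prob_measures R"
    and f: "bounded_by (R \<Otimes>\<^sub>M S l) B (\<lambda>(y, z). f y z)"
    and d: "\<And>y. y \<in> space R \<Longrightarrow> contr l \<mu> d (f y)"
  shows "contr l \<mu> d (\<lambda>z. \<integral>y. f y z \<partial>Q)"
  unfolding contr_def
proof (intro allI impI ballI)
  fix k x y assume k: "k < N" and x: "x \<in> space (S l)" and y: "y \<in> space (S l)"
  have b: "bounded_by R B (\<lambda>y. T l \<mu> k (f y) x)" if "x \<in> space (S l)" for x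
    using bounded_by_comp[OF T_mix(1)[OF l \<mu> Q f] measurable_Pair2'[OF that]] by simp
  show "\<bar>T l \<mu> k (\<lambda>z. \<integral>y. f y z \<partial>Q) x - T l \<mu> k (\<lambda>z. \<integral>y. f y z \<partial>Q) y\<bar> \<le> \<kappa> ^ k * d"
    unfolding T_mix(2)[OF l \<mu> Q f x] T_mix(2)[OF l \<mu> Q f y]
    using d k x y unfolding contr_def
    by (intro bounded_by_integral_diff_le[OF b[OF x] b[OF y] Q]) blast
qed

section \<open>Propagation of a change of one coordinate of the history\<close>

text \<open>
  The sensitivity of \<open>F\<close> to coordinate \<open>l\<close> of the newest state, measured in the seminorm of the kernel
  that moves level \<open>l\<close> next.  This kernel does not depend on the coordinate that is varied.
\<close>

definition fresh_bound :: "nat \<Rightarrow> nat \<Rightarrow> real \<Rightarrow> ((nat \<Rightarrow> nat \<Rightarrow> 'a) \<Rightarrow> real) \<Rightarrow> bool"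
  where "fresh_bound l j d F \<longleftrightarrow> (\<forall>h\<in>space Hs. contr l (emp l j h) d (\<lambda>z. F (h(j := (h j)(l := z)))))"

text \<open>
  The sensitivity of \<open>F\<close> to coordinate \<open>l\<close> of a state that has already been left: the chain feels it
  only through empirical measures.
\<close>

definition old_bound :: "nat \<Rightarrow> nat \<Rightarrow> real \<Rightarrow> ((nat \<Rightarrow> nat \<Rightarrow> 'a) \<Rightarrow> real) \<Rightarrow> bool"
  where "old_bound l j g F \<longleftrightarrow>
    (\<forall>h\<in>space Hs. \<forall>i<j. \<forall>z\<in>space (S l). \<bar>F h - F (h(i := (h i)(l := z)))\<bar> \<le> g)"

lemma fresh_bound_mono: "fresh_bound l j d F \<Longrightarrow> d \<le> d' \<Longrightarrow> fresh_bound l j d' F"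
  unfolding fresh_bound_def using contr_mono by blast

lemma fresh_bound_osc:
  assumes "fresh_bound l j d F" "l \<le> m" "h \<in> space Hs" "z \<in> space (S l)"
  shows "\<bar>F h - F (h(j := (h j)(l := z)))\<bar> \<le> d"
proof -
  have "contr l (emp l j h) d (\<lambda>z. F (h(j := (h j)(l := z))))"
    using assms unfolding fresh_bound_def by blast
  from contrD0[OF this space_Hs_coord2[OF assms(3,2), of j] assms(4)] show ?thesis by simp
qed

lemma emp_change:
  assumes l: "l \<le> m" and h: "h \<in> space Hs" and x: "x \<in> space Em" and g: "bounded_by (S (l - 1)) 1 g"
  shows "\<bar>(\<integral>z. g z \<partial>emp l j h) - (\<integral>z. g z \<partial>emp l j (h(i := x)))\<bar> \<le> 2 / (real j + 1)"
proof -
  have l1: "l - 1 \<le> m" using l by simp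
  have h': "h(i := x) \<in> space Hs" by (rule space_Hs_upd[OF h x])
  have "(\<Sum>p\<le>j. g (h p (l - 1))) - (\<Sum>p\<le>j. g ((h(i := x)) p (l - 1)))
      = (\<Sum>p\<le>j. if p = i then g (h i (l - 1)) - g (x (l - 1)) else 0)"
    unfolding sum_subtractf[symmetric] by (rule sum.cong) auto
  also have "\<dots> = (if i \<le> j then g (h i (l - 1)) - g (x (l - 1)) else 0)"
    by simp
  finally have "\<bar>(\<Sum>p\<le>j. g (h p (l - 1))) - (\<Sum>p\<le>j. g ((h(i := x)) p (l - 1)))\<bar> \<le> 2"
    using abs_triangle_ineq4[of "g (h i (l - 1))" "g (x (l - 1))"]
      bounded_by_abs[OF g space_Hs_coord2[OF h l1, of i]] bounded_by_abs[OF g space_Em_coord[OF x l1]] by simp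
  then show ?thesis
    unfolding integral_emp[OF h l g] integral_emp[OF h' l g] diff_divide_distrib[symmetric]
    by (simp add: divide_right_mono)
qed

text \<open>
  One more sample moves an empirical measure by \<open>O(1/j)\<close> in total variation.
\<close>

lemma emp_extend:
  assumes l: "l \<le> m" and h: "h \<in> space Hs" and g: "bounded_by (S (l - 1)) 1 g"
  shows "\<bar>(\<integral>z. g z \<partial>emp l j h) - (\<integral>z. g z \<partial>emp l (Suc j) h)\<bar> \<le> 2 / (real j + 2)"
proof -
  have l1: "l - 1 \<le> m" using l by simp
  have b: "\<bar>g (h p (l - 1))\<bar> \<le> 1" for p by (rule bounded_by_abs[OF g space_Hs_coord2[OF h l1]])
  define A where "A = (\<Sum>p\<le>j. g (h p (l - 1)))"
  have "\<bar>A\<bar> \<le> (\<Sum>p\<le>j. 1)" unfolding A_def by (rule order_trans[OF sum_abs sum_mono]) (rule b)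
  then have A: "\<bar>A\<bar> \<le> real j + 1" by simp
  define u where "u = g (h (Suc j) (l - 1))"
  have u: "\<bar>u\<bar> \<le> 1" unfolding u_def by (rule b)
  have "A / (real j + 1) - (A + u) / (real j + 2) = (A / (real j + 1) - u) / (real j + 2)"
    by (simp add: field_simps)
  moreover have "\<bar>A / (real j + 1) - u\<bar> \<le> 2"
  proof -
    have "\<bar>A / (real j + 1)\<bar> \<le> 1" using A by simp
    with u show ?thesis by linarith
  qed
  ultimately have "\<bar>A / (real j + 1) - (A + u) / (real j + 2)\<bar> \<le> 2 / (real j + 2)"
    by (simp add: divide_right_mono)
  then show ?thesis
    unfolding integral_emp[OF h l g] by (simp add: A_def u_def add.commute)
qed

text \<open>
  The next two lemmas say where a change of level \<open>l\<close> in the history enters the next transition: at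
  level \<open>l\<close> only through the current position, and otherwise only at level \<open>Suc l\<close>, whose kernel sees
  the empirical measure of level \<open>l\<close>.  At level \<open>0\<close> the dummy empirical measure is that of level \<open>0\<close>
  itself, which \<open>M_0\<close> makes harmless.
\<close>

lemma lk_own:
  assumes "i \<le> j"
  shows "lk l j (h(i := (h i)(l := z))) = M l (emp l j h) ((h(i := (h i)(l := z))) j l)"
proof (cases "l = 0")
  case True
  then show ?thesis unfolding lk_def using M_0 by metis
next
  case False
  then have "emp l j (h(i := (h i)(l := z))) = emp l j h" by (intro emp_cong) auto
  then show ?thesis by (simp add: lk_def)
qed

lemma lk_other:
  assumes "l' \<noteq> l" "l' \<noteq> Suc l"
  shows "lk l' j (h(i := (h i)(l := z))) = lk l' j h"
proof -
  have "emp l' j (h(i := (h i)(l := z))) = emp l' j h"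
    using assms by (intro emp_cong) auto
  then show ?thesis using assms by (simp add: lk_def)
qed

text \<open>
  The effect on the next expectation of changing level \<open>l\<close> at time \<open>i\<close>, except for the effect through
  the position of level \<open>l\<close>: on the right the factor of level \<open>l\<close> is still the one of the unchanged
  history.  What remains is the explicit dependence of \<open>F\<close> on the old entry, and the changed kernel of
  level \<open>Suc l\<close>, which differs by \<open>O(1/j)\<close> and acts on a function of oscillation at most \<open>d\<close>.
\<close>

lemma history_change:
  assumes l: "l \<le> m" and F: "bounded_by Hs B F" and h: "h \<in> space Hs" and z: "z \<in> space (S l)"
    and i: "i \<le> j" and h'_def: "h' = h(i := (h i)(l := z))"
    and old: "old_bound l (Suc j) g F" and fresh: "Suc l \<le> m \<Longrightarrow> fresh_bound (Suc l) (Suc j) d F"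
    and d: "0 \<le> d"
  shows "\<bar>(\<integral>y. F (h(Suc j := y)) \<partial>K j h)
      - (\<integral>y. F (h'(Suc j := y)) \<partial>PiM {..m} ((\<lambda>l'. lk l' j h')(l := lk l j h)))\<bar> \<le> g + 2 * c / (real j + 1) * d"
proof -
  define A where "A = (\<lambda>l'. lk l' j h)"
  have h': "h' \<in> space Hs" unfolding h'_def by (rule space_Hs_upd2[OF h l z])
  have Fh': "bounded_by Em B (\<lambda>y. F (h'(Suc j := y)))"
    by (rule bounded_by_comp[OF F measurable_Hs_upd'[OF h']])
  have Fh: "bounded_by Em B (\<lambda>y. F (h(Suc j := y)))"
    by (rule bounded_by_comp[OF F measurable_Hs_upd'[OF h]])
  have KA: "K j h = PiM {..m} A" by (simp add: K_def A_def)
  have 1: "\<bar>(\<integral>y. F (h(Suc j := y)) \<partial>K j h) - (\<integral>y. F (h'(Suc j := y)) \<partial>K j h)\<bar> \<le> g"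
  proof (rule bounded_by_integral_diff_le[OF Fh Fh' K_prob[OF h]])
    fix y assume y: "y \<in> space Em"
    have "h'(Suc j := y) = (h(Suc j := y))(i := ((h(Suc j := y)) i)(l := z))"
      using i unfolding h'_def by (auto simp: fun_upd_twist)
    then show "\<bar>F (h(Suc j := y)) - F (h'(Suc j := y))\<bar> \<le> g"
      using old z i space_Hs_upd[OF h y, of "Suc j"] unfolding old_bound_def by force
  qed
  have pA: "prob_space (A l')" "sets (A l') = sets (S l')" if "l' \<le> m" for l'
    using lk_prob[OF h that, of j] by (auto simp: A_def space_prob_algebra)
  have sA: "sets (PiM {..m} A) = sets Em" using pA by (intro sets_PiM_cong) auto
  have 2: "\<bar>(\<integral>y. F (h'(Suc j := y)) \<partial>PiM {..m} A)
      - (\<integral>y. F (h'(Suc j := y)) \<partial>PiM {..m} ((\<lambda>l'. lk l' j h')(l := lk l j h)))\<bar> \<le> 2 * c / (real j + 1) * d"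
  proof (cases "Suc l \<le> m")
    case False
    have "PiM {..m} ((\<lambda>l'. lk l' j h')(l := lk l j h)) = PiM {..m} A"
      using False l by (intro PiM_cong) (auto simp: A_def h'_def lk_other)
    then show ?thesis using c_nonneg d by simp
  next
    case True
    define Q where "Q = lk (Suc l) j h'"
    have eq: "PiM {..m} ((\<lambda>l'. lk l' j h')(l := lk l j h)) = PiM {..m} (A(Suc l := Q))"
      by (intro PiM_cong) (auto simp: A_def Q_def h'_def lk_other)
    have Q: "prob_space Q" "sets Q = sets (A (Suc l))"
      using lk_prob[OF h' True, of j] pA[OF True] by (auto simp: Q_def space_prob_algebra)
    have e: "\<bar>(\<integral>w. F (h'(Suc j := y(Suc l := w))) \<partial>A (Suc l)) - (\<integral>w. F (h'(Suc j := y(Suc l := w))) \<partial>Q)\<bar>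
        \<le> 2 * c / (real j + 1) * d" if "y \<in> space (PiM {..m} A)" for y
    proof -
      have y: "y \<in> space Em" using that sets_eq_imp_space_eq[OF sA] by simp
      define \<psi> where "\<psi> w = F (h'(Suc j := y(Suc l := w)))" for w
      have \<psi>: "bounded_by (S (Suc l)) B \<psi>"
        unfolding \<psi>_def by (rule bounded_by_comp[OF Fh' measurable_Em_upd'[OF y True]])
      have "contr (Suc l) (emp (Suc l) (Suc j) (h'(Suc j := y))) d \<psi>"
        using fresh[OF True] space_Hs_upd[OF h' y, of "Suc j"] unfolding fresh_bound_def \<psi>_def by fastforce
      note osc = contrD0[OF this]
      have x: "h j (Suc l) \<in> space (S (Suc l))" by (rule space_Hs_coord2[OF h True])
      have "\<bar>kernel_op (M (Suc l) (emp (Suc l) j h)) \<psi> (h j (Suc l)) -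
          kernel_op (M (Suc l) (emp (Suc l) j h')) \<psi> (h j (Suc l))\<bar> \<le> c * (2 / (real j + 1)) * d"
      proof (rule lipschitz_osc[OF True emp_prob[OF h True] emp_prob[OF h' True] \<psi> osc _ x])
        fix g :: "'a \<Rightarrow> real" assume g: "bounded_by (S (Suc l - 1)) 1 g"
        show "\<bar>integral\<^sup>L (emp (Suc l) j h) g - integral\<^sup>L (emp (Suc l) j h') g\<bar> \<le> 2 / (real j + 1)"
          unfolding h'_def by (rule emp_change[OF True h space_Em_upd[OF space_Hs_coord[OF h] l z] g])
      qed auto
      moreover have "h' j (Suc l) = h j (Suc l)" by (auto simp: h'_def)
      ultimately show ?thesis
        by (simp add: kernel_op_def A_def Q_def lk_def \<psi>_def mult.commute)
    qed
    have Fm: "(\<lambda>y. F (h'(Suc j := y))) \<in> borel_measurable (PiM {..m} A)"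
      using bounded_by_measurable[OF Fh'] sA by (simp cong: measurable_cong_sets)
    show ?thesis unfolding eq
      by (rule PiM_change_factor[where B = B])
         (use pA True Q e Fm bounded_by_abs[OF Fh'] sets_eq_imp_space_eq[OF sA] in auto)
  qed
  from 1 2 show ?thesis unfolding KA by linarith
qed

lemma step_old:
  assumes l: "l \<le> m" and F: "bounded_by Hs B F"
    and old: "old_bound l (Suc j) g F" and fresh: "Suc l \<le> m \<Longrightarrow> fresh_bound (Suc l) (Suc j) d F"
    and d: "0 \<le> d"
  shows "old_bound l j (g + 2 * c / (real j + 1) * d) (ev j (Suc 0) F)"
  unfolding old_bound_def
proof (intro ballI allI impI)
  fix h i z assume h: "h \<in> space Hs" and i: "i < j" and z: "z \<in> space (S l)"
  define h' where "h' = h(i := (h i)(l := z))"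
  have h': "h' \<in> space Hs" unfolding h'_def by (rule space_Hs_upd2[OF h l z])
  have "h' j l = h j l" using i by (simp add: h'_def)
  then have "lk l j h' = lk l j h"
    using lk_own[of i j l h z] i by (simp add: h'_def[symmetric] lk_def)
  then have "(\<lambda>l'. lk l' j h')(l := lk l j h) = (\<lambda>l'. lk l' j h')" by auto
  then show "\<bar>ev j (Suc 0) F h - ev j (Suc 0) F (h(i := (h i)(l := z)))\<bar> \<le> g + 2 * c / (real j + 1) * d"
    using history_change[OF l F h z less_imp_le[OF i] h'_def old fresh d]
    unfolding ev_1[OF F h] h'_def[symmetric] ev_1[OF F h'] by (simp add: K_def)
qed

text \<open>
  As a function of the newest coordinate \<open>z\<close> of level \<open>l\<close>, the next expectation is \<open>T \<Psi>\<close> up to the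
  error of \<open>history_change\<close>, where \<open>\<Psi>\<close> averages \<open>F\<close> over the next state with coordinate \<open>l\<close> left
  free.  The seminorm of \<open>\<Psi>\<close> is at most that of \<open>F\<close>, up to the drift of the empirical measure during
  one step, and \<open>T\<close> contracts it.
\<close>

lemma step_fresh:
  assumes l: "l \<le> m" and F: "bounded_by Hs B F"
    and old: "old_bound l (Suc j) g F" and fresh: "Suc l \<le> m \<Longrightarrow> fresh_bound (Suc l) (Suc j) d F"
    and d: "0 \<le> d" and own: "fresh_bound l (Suc j) d0 F"
  shows "fresh_bound l j (\<kappa> * ((1 + 4 * real N * c / \<kappa> ^ N / (real j + 2)) * d0)
      + 2 * (g + 2 * c / (real j + 1) * d) / \<kappa> ^ N) (ev j (Suc 0) F)"
  unfolding fresh_bound_def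
proof (intro ballI)
  fix h assume h: "h \<in> space Hs"
  define \<mu> where "\<mu> = emp l j h"
  define e where "e = g + 2 * c / (real j + 1) * d"
  define G where "G z = ev j (Suc 0) F (h(j := (h j)(l := z)))" for z
  define \<Psi> where "\<Psi> w = (\<integral>y. F (h(Suc j := y(l := w))) \<partial>K j h)" for w
  have \<mu>: "\<mu> \<in> prob_measures (S (l - 1))" unfolding \<mu>_def by (rule emp_prob[OF h l])
  have Fh: "bounded_by Em B (\<lambda>y. F (h(Suc j := y)))"
    by (rule bounded_by_comp[OF F measurable_Hs_upd'[OF h]])
  have Fyw: "bounded_by (Em \<Otimes>\<^sub>M S l) B (\<lambda>(y, w). F (h(Suc j := y(l := w))))"
    using bounded_by_comp[OF Fh measurable_Em_upd[OF l]] by (simp add: case_prod_beta')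
  have \<Psi>: "bounded_by (S l) B \<Psi>"
    unfolding \<Psi>_def
    using bounded_by_comp[OF Fyw, of "\<lambda>(w, y). (y, w)"] K_prob[OF h]
    by (intro bounded_by_kernel_integral[where N = Em]) (auto simp: case_prod_beta')
  have \<Psi>': "bounded_by (S l) B (kernel_op (M l \<mu>) \<Psi>)"
    by (rule kernel_op_bounded_by[OF M_markov[OF l \<mu>] \<Psi>])
  have G: "bounded_by (S l) B G"
    unfolding G_def
    by (rule bounded_by_comp[OF bounded_by_comp[OF ev_bounded_by[OF F] measurable_Hs_upd'[OF h]] measurable_Em_upd'[OF space_Hs_coord[OF h] l]])
  have c\<Psi>: "contr l \<mu> ((1 + 4 * real N * c / \<kappa> ^ N / (real j + 2)) * d0) \<Psi>"
    unfolding \<Psi>_def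
  proof (rule contr_mix[OF l \<mu> K_prob[OF h] Fyw])
    fix y assume y: "y \<in> space Em"
    have hy: "h(Suc j := y) \<in> space Hs" by (rule space_Hs_upd[OF h y])
    have *: "contr l (emp l (Suc j) (h(Suc j := y))) d0 (\<lambda>w. F (h(Suc j := y(l := w))))"
      using own hy unfolding fresh_bound_def by fastforce
    have "contr l \<mu> ((1 + 2 * real N * c * (2 / (real j + 2)) / \<kappa> ^ N) * d0) (\<lambda>w. F (h(Suc j := y(l := w))))"
    proof (rule contr_change[OF l \<mu> emp_prob[OF hy l] _ _ *])
      show "bounded_by (S l) B (\<lambda>w. F (h(Suc j := y(l := w))))"
        by (rule bounded_by_comp[OF Fh measurable_Em_upd'[OF y l]])
      fix g :: "'a \<Rightarrow> real" assume g: "bounded_by (S (l - 1)) 1 g"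
      have "emp l j (h(Suc j := y)) = \<mu>" unfolding \<mu>_def by (rule emp_cong) auto
      with emp_extend[OF l hy g, of j]
      show "\<bar>integral\<^sup>L \<mu> g - integral\<^sup>L (emp l (Suc j) (h(Suc j := y))) g\<bar> \<le> 2 / (real j + 2)" by simp
    qed
    then show "contr l \<mu> ((1 + 4 * real N * c / \<kappa> ^ N / (real j + 2)) * d0) (\<lambda>w. F (h(Suc j := y(l := w))))"
      by (simp add: mult.commute mult.left_commute)
  qed
  have close: "\<bar>G z - kernel_op (M l \<mu>) \<Psi> z\<bar> \<le> e" if z: "z \<in> space (S l)" for z
  proof -
    define hz where "hz = h(j := (h j)(l := z))"
    have hz: "hz \<in> space Hs" unfolding hz_def by (rule space_Hs_upd2[OF h l z])
    have restore: "h = hz(j := (hz j)(l := h j l))" by (simp add: hz_def)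
    have lkz: "lk l j hz = M l \<mu> z"
      using lk_own[of j j l h z] by (simp add: hz_def \<mu>_def)
    define A where "A = (\<lambda>l'. lk l' j h)"
    have pA: "prob_space (A l')" "sets (A l') = sets (S l')" if "l' \<le> m" for l'
      using lk_prob[OF h that, of j] by (auto simp: A_def space_prob_algebra)
    have sA: "sets (PiM {..m} A) = sets Em" using pA by (intro sets_PiM_cong) auto
    have Q: "prob_space (lk l j hz)" "sets (lk l j hz) = sets (A l)"
      using lk_prob[OF hz l, of j] pA[OF l] by (auto simp: space_prob_algebra)
    have "(\<integral>y. F (h(Suc j := y)) \<partial>PiM {..m} (A(l := lk l j hz)))
        = (\<integral>w. (\<integral>y. F (h(Suc j := y(l := w))) \<partial>PiM {..m} A) \<partial>lk l j hz)"
      by (rule integral_PiM_resample(2)[where B = B])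
         (use pA l Q bounded_by_measurable[OF Fh] bounded_by_abs[OF Fh] sA sets_eq_imp_space_eq[OF sA] in
           \<open>auto cong: measurable_cong_sets\<close>)
    also have "\<dots> = kernel_op (M l \<mu>) \<Psi> z"
      unfolding kernel_op_def lkz \<Psi>_def K_def A_def ..
    finally have "kernel_op (M l \<mu>) \<Psi> z = (\<integral>y. F (h(Suc j := y)) \<partial>PiM {..m} ((\<lambda>l'. lk l' j h)(l := lk l j hz)))"
      by (simp add: A_def)
    moreover have "G z = (\<integral>y. F (hz(Suc j := y)) \<partial>K j hz)"
      unfolding G_def hz_def[symmetric] by (rule ev_1[OF F hz])
    ultimately show ?thesis
      using history_change[OF l F hz space_Hs_coord2[OF h l, of j] order_refl restore old fresh d]
      unfolding e_def by simp
  qed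
  have R: "bounded_by (S l) (B + B) (\<lambda>z. G z - kernel_op (M l \<mu>) \<Psi> z)"
    by (rule bounded_by_diff[OF G \<Psi>'])
  have "contr l \<mu> (2 * e / \<kappa> ^ N) (\<lambda>z. G z - kernel_op (M l \<mu>) \<Psi> z)"
  proof (rule contr_of_osc[OF l \<mu> R])
    fix x y assume "x \<in> space (S l)" "y \<in> space (S l)"
    from close[OF this(1)] close[OF this(2)]
    show "\<bar>(G x - kernel_op (M l \<mu>) \<Psi> x) - (G y - kernel_op (M l \<mu>) \<Psi> y)\<bar> \<le> 2 * e" by linarith
  qed
  from contr_add[OF l \<mu> \<Psi>' R contr_step[OF l \<mu> \<Psi> c\<Psi>] this, of G]
  show "contr l (emp l j h) (\<kappa> * ((1 + 4 * real N * c / \<kappa> ^ N / (real j + 2)) * d0)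
      + 2 * (g + 2 * c / (real j + 1) * d) / \<kappa> ^ N) (\<lambda>z. ev j (Suc 0) F (h(j := (h j)(l := z))))"
    unfolding \<mu>_def e_def G_def by simp
qed

end



section \<open>Power sums\<close>

text \<open>
  The increment of a power, compared with its derivative at the right end point; this and the next
  lemma turn power sums into telescoping sums.
\<close>

lemma powr_quarter_step:
  fixes x :: real
  assumes "0 < x"
  shows "(x + 1) powr (-5/4) \<le> 4 * (x powr (-1/4) - (x + 1) powr (-1/4))"
proof -
  have "\<exists>z>x. z < x + 1 \<and> (x + 1) powr (-1/4) - x powr (-1/4) = (x + 1 - x) * (-1/4 * z powr (-1/4 - 1))"
    using assms by (intro MVT2) (auto intro!: derivative_eq_intros)
  then obtain z where z: "x < z" "z < x + 1" "(x + 1) powr (-1/4) - x powr (-1/4) = -1/4 * z powr (-5/4)"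
    by auto
  have "(x + 1) powr (-5/4) \<le> z powr (-5/4)"
    using z assms by (intro powr_mono2') auto
  with z(3) show ?thesis by simp
qed

lemma powr_step:
  fixes x s :: real
  assumes "0 \<le> x" "0 < s" "s < 1"
  shows "s * (x + 1) powr (s - 1) \<le> (x + 1) powr s - x powr s"
proof (cases "x = 0")
  case False
  then have x: "0 < x" using assms by simp
  have "\<exists>z>x. z < x + 1 \<and> (x + 1) powr s - x powr s = (x + 1 - x) * (s * z powr (s - 1))"
    using x by (intro MVT2) (auto intro!: derivative_eq_intros)
  then obtain z where z: "x < z" "z < x + 1" "(x + 1) powr s - x powr s = s * z powr (s - 1)"
    by auto
  have "(x + 1) powr (s - 1) \<le> z powr (s - 1)"
    using z x assms by (intro powr_mono2') auto
  with z(3) assms show ?thesis by simp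
qed (use assms in simp)

lemma sum_powr_le:
  fixes s :: real
  assumes "0 < s" "s < 1"
  shows "(\<Sum>i<n. (real i + 1) powr (s - 1)) \<le> real n powr s / s"
proof (induction n)
  case (Suc n)
  have "s * (\<Sum>i<Suc n. (real i + 1) powr (s - 1)) \<le> real (Suc n) powr s"
    using Suc powr_step[of "real n" s] assms by (simp add: field_simps)
  then show ?case using assms by (simp add: field_simps)
qed simp

lemma sum_powr_tail_le:
  assumes "j \<le> p"
  shows "(\<Sum>q\<in>{j<..p}. (real q + 1) powr (-5/4)) \<le> 4 * ((real j + 1) powr (-1/4) - (real p + 1) powr (-1/4))"
  using assms
proof (induction p rule: dec_induct)
  case (step p)
  have "{j<..Suc p} = insert (Suc p) {j<..p}" using step by auto
  then show ?case
    using step powr_quarter_step[of "real p + 1"] by (simp add: algebra_simps)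
qed simp

lemma sum_arith_geometric_le:
  fixes \<rho> :: real
  assumes "0 < \<rho>" "\<rho> < 1"
  shows "(\<Sum>k<n. (real k + 1) * \<rho> ^ k) \<le> 1 / (1 - \<rho>)\<^sup>2"
proof -
  have "(\<lambda>n. of_nat (Suc n) * \<rho> ^ n) sums (1 / (1 - \<rho>)\<^sup>2)"
    by (rule geometric_deriv_sums) (use assms in simp)
  then have "(\<Sum>k<n. of_nat (Suc k) * \<rho> ^ k) \<le> 1 / (1 - \<rho>)\<^sup>2"
    using assms by (intro sum_le_suminf[THEN order_trans] order.refl)
      (auto simp: sums_iff)
  then show ?thesis by (simp add: add.commute)
qed

text \<open>
  The bound for indirect memory: \<open>1/p\<close> is the weight of one sample in an empirical measure, and
  \<open>(p/j)^(1/4)\<close> dominates the powers of \<open>log (p/j)\<close> that the levels contribute.  The exponent is below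
  \<open>1/2\<close>, so that the squares sum to \<open>O(1/p)\<close> over \<open>j\<close>.
\<close>

definition \<theta> :: "nat \<Rightarrow> nat \<Rightarrow> real"
  where "\<theta> j p = (real p + 1) powr (-3/4) * (real j + 1) powr (-1/4)"

lemma \<theta>_nonneg: "0 \<le> \<theta> j p"
  by (simp add: \<theta>_def)

lemma \<theta>_Suc: "\<theta> (Suc j) p \<le> \<theta> j p"
  unfolding \<theta>_def by (intro mult_left_mono powr_mono2') auto

lemma inverse_le_\<theta>: "j \<le> p \<Longrightarrow> 1 / (real p + 1) \<le> \<theta> j p"
proof -
  assume "j \<le> p"
  have "1 / (real p + 1) = (real p + 1) powr (-3/4) * (real p + 1) powr (-1/4)"
    by (simp add: powr_minus_divide flip: powr_add)
  also have "\<dots> \<le> \<theta> j p"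
    unfolding \<theta>_def using \<open>j \<le> p\<close> by (intro mult_left_mono powr_mono2') auto
  finally show ?thesis .
qed

text \<open>
  A level that perturbs the next one by \<open>\<theta> q p / q\<close> at each time \<open>q\<close> accumulates again only \<open>O(\<theta> j p)\<close>:
  this is what makes the induction over the levels close with a single bound \<open>\<theta>\<close>.
\<close>

lemma sum_\<theta>_over_q:
  assumes "j \<le> p"
  shows "(\<Sum>q\<in>{j<..p}. \<theta> q p / real q) \<le> 8 * \<theta> j p"
proof -
  have "\<theta> q p / real q \<le> 2 * (real p + 1) powr (-3/4) * (real q + 1) powr (-5/4)" if "q \<in> {j<..p}" for q
  proof -
    have q: "1 \<le> real q" using that by simp
    have "(real q + 1) powr (-1/4) = (real q + 1) powr (-5/4) * (real q + 1)"
      using powr_add[of "real q + 1" "-5/4" 1] by simp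
    also have "\<dots> \<le> (real q + 1) powr (-5/4) * (2 * real q)"
      using q by (intro mult_left_mono) auto
    finally have "(real q + 1) powr (-1/4) / real q \<le> 2 * (real q + 1) powr (-5/4)"
      using q by (simp add: field_simps)
    from mult_left_mono[OF this, of "(real p + 1) powr (-3/4)"]
    show ?thesis unfolding \<theta>_def by (simp add: mult.assoc mult.left_commute)
  qed
  then have "(\<Sum>q\<in>{j<..p}. \<theta> q p / real q) \<le> (\<Sum>q\<in>{j<..p}. 2 * (real p + 1) powr (-3/4) * (real q + 1) powr (-5/4))"
    by (rule sum_mono)
  also have "\<dots> = 2 * (real p + 1) powr (-3/4) * (\<Sum>q\<in>{j<..p}. (real q + 1) powr (-5/4))"
    by (simp add: sum_distrib_left)
  also have "\<dots> \<le> 2 * (real p + 1) powr (-3/4) * (4 * (real j + 1) powr (-1/4))"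
  proof (rule mult_left_mono)
    have "0 \<le> (real p + 1) powr (-1/4)" by simp
    with sum_powr_tail_le[OF assms] 
    show "(\<Sum>q\<in>{j<..p}. (real q + 1) powr (-5/4)) \<le> 4 * (real j + 1) powr (-1/4)" by argo
  qed simp
  finally show ?thesis by (simp add: \<theta>_def)
qed

text \<open>
  A geometrically forgotten perturbation only counts near \<open>q = p\<close>, where \<open>1/q\<close> is about \<open>1/p\<close>; in
  general \<open>p + 1 \<le> 2 q (p - q + 1)\<close>.
\<close>

lemma sum_geometric_over_q:
  assumes "j \<le> p" "0 < \<rho>" "\<rho> < 1"
  shows "(\<Sum>q\<in>{j<..p}. \<rho> ^ (p - q) / real q) \<le> 2 / (1 - \<rho>)\<^sup>2 * \<theta> j p"
proof -
  have "\<rho> ^ (p - q) / real q \<le> 2 / (real p + 1) * ((real (p - q) + 1) * \<rho> ^ (p - q))" if "q \<in> {j<..p}" for q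
  proof -
    have q: "1 \<le> real q" "q \<le> p" using that by auto
    have "real p + 1 = real (p - q) + (real q + 1)" using q by simp
    also have "\<dots> \<le> (real (p - q) + 1) * (2 * real q)"
    proof -
      have "real (p - q) * 1 \<le> real (p - q) * (2 * real q)" using q by (intro mult_left_mono) auto
      then show ?thesis using q by (simp add: algebra_simps)
    qed
    finally have "1 / real q \<le> 2 / (real p + 1) * (real (p - q) + 1)"
      using q by (simp add: field_simps)
    from mult_right_mono[OF this, of "\<rho> ^ (p - q)"] assms show ?thesis by (simp add: distrib_right mult.assoc)
  qed
  then have "(\<Sum>q\<in>{j<..p}. \<rho> ^ (p - q) / real q)
      \<le> (\<Sum>q\<in>{j<..p}. 2 / (real p + 1) * ((real (p - q) + 1) * \<rho> ^ (p - q)))"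
    by (rule sum_mono)
  also have "\<dots> = 2 / (real p + 1) * (\<Sum>q\<in>{j<..p}. (real (p - q) + 1) * \<rho> ^ (p - q))"
    by (simp add: sum_distrib_left)
  also have "(\<Sum>q\<in>{j<..p}. (real (p - q) + 1) * \<rho> ^ (p - q)) = (\<Sum>k<p - j. (real k + 1) * \<rho> ^ k)"
    by (rule sum.reindex_bij_witness[of _ "\<lambda>k. p - k" "\<lambda>q. p - q"]) auto
  also have "2 / (real p + 1) * \<dots> \<le> 2 / (real p + 1) * (1 / (1 - \<rho>)\<^sup>2)"
    by (intro mult_left_mono sum_arith_geometric_le assms) auto
  also have "\<dots> = 2 / (1 - \<rho>)\<^sup>2 * (1 / (real p + 1))" by simp
  also have "\<dots> \<le> 2 / (1 - \<rho>)\<^sup>2 * \<theta> j p"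
    by (intro mult_left_mono inverse_le_\<theta> assms) auto
  finally show ?thesis .
qed

section \<open>Stability of the chain\<close>

context triangular_chain
begin

text \<open>
  Any rate between \<open>\<kappa>\<close> and \<open>1\<close> would do: it has to absorb the factors \<open>1 + O(1/j)\<close> from the drift of
  the empirical measures.
\<close>

definition \<rho> :: real where "\<rho> = (1 + \<kappa>) / 2"

lemma \<rho>: "\<kappa> < \<rho>" "0 < \<rho>" "\<rho> < 1"
  using \<kappa>_pos \<kappa>_less by (auto simp: \<rho>_def)

text \<open>
  For test functions that ignore level \<open>l\<close> there is no direct memory of level \<open>l\<close>, and the geometric
  term disappears; the decoupling of the levels depends on this distinction.
\<close>

definition indep :: "nat \<Rightarrow> ((nat \<Rightarrow> 'a) \<Rightarrow> real) \<Rightarrow> bool"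
  where "indep l \<phi> \<longleftrightarrow> (\<forall>x\<in>space Em. \<forall>z\<in>space (S l). \<phi> (x(l := z)) = \<phi> x)"

definition stab :: "nat \<Rightarrow> real \<Rightarrow> real \<Rightarrow> bool"
  where "stab l A E \<longleftrightarrow> 0 \<le> A \<and> 0 \<le> E \<and> (\<forall>B \<phi> p j. bounded_by Em B \<phi> \<longrightarrow> j \<le> p \<longrightarrow>
    fresh_bound l j (B * ((if indep l \<phi> then 0 else A * \<rho> ^ (p - j)) + E * \<theta> j p))
      (ev j (p - j) (\<lambda>h. \<phi> (h p))))"

lemma fresh_bound_cong:
  assumes l: "l \<le> m" and F: "fresh_bound l j d F" and eq: "\<And>h. h \<in> space Hs \<Longrightarrow> G h = F h"
  shows "fresh_bound l j d G"
  unfolding fresh_bound_def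
proof
  fix h assume h: "h \<in> space Hs"
  have *: "T l (emp l j h) k (\<lambda>z. G (h(j := (h j)(l := z)))) x = T l (emp l j h) k (\<lambda>z. F (h(j := (h j)(l := z)))) x"
    if "x \<in> space (S l)" for x k
    by (rule T_cong[OF l emp_prob[OF h l] that]) (rule eq[OF space_Hs_upd2[OF h l]])
  have "contr l (emp l j h) d (\<lambda>z. F (h(j := (h j)(l := z))))"
    using F h unfolding fresh_bound_def by blast
  then show "contr l (emp l j h) d (\<lambda>z. G (h(j := (h j)(l := z))))"
    unfolding contr_def using * by simp
qed

lemma old_bound_cong:
  assumes l: "l \<le> m" and F: "old_bound l j d F" and eq: "\<And>h. h \<in> space Hs \<Longrightarrow> G h = F h"
  shows "old_bound l j d G"
  using F eq space_Hs_upd2[OF _ l] unfolding old_bound_def by simp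

lemma Em_bounded_nonneg: "bounded_by Em B \<phi> \<Longrightarrow> 0 \<le> B"
  using bounded_by_nonneg[OF _ space_Em_nonempty] .

lemma state_fun_bounded: "bounded_by Em B \<phi> \<Longrightarrow> bounded_by Hs B (\<lambda>h. \<phi> (h p))"
  by (rule bounded_by_comp[OF _ measurable_Hs_coord])

lemma ev_split_first:
  assumes F: "bounded_by Hs B F" and h: "h \<in> space Hs" and j: "j < p"
  shows "ev j (p - j) F h = ev j (Suc 0) (ev (Suc j) (p - Suc j) F) h"
  using ev_add[OF F h, of j 1 "p - Suc j"] Suc_diff_Suc[OF j] by simp

text \<open>
  Backward induction on the time \<open>j\<close>, for a given level, from the bounds for the level above.  Old
  entries collect the sum \<open>gs\<close> of the perturbations of the level above; fresh entries are contracted at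
  each step and receive a forcing term of order \<open>\<theta>\<close>.
\<close>

lemma stab_step:
  assumes l: "l \<le> m" and up: "Suc l \<le> m \<Longrightarrow> stab (Suc l) A1 E1" and A1: "0 \<le> A1" and E1: "0 \<le> E1"
  shows "\<exists>A E. stab l A E"
proof -
  define G where "G = 2 * c * (A1 * (2 / (1 - \<rho>)\<^sup>2) + E1 * 8)"
  define C1 where "C1 = 4 * real N * c / \<kappa> ^ N"
  define C2 where "C2 = 2 * G / \<kappa> ^ N"
  define E0 where "E0 = C2 / (1 - \<rho>)"
  define L where "L = (1 + C1) / \<rho>"
  have G0: "0 \<le> G" using c_nonneg A1 E1 \<rho> by (simp add: G_def)
  have C1: "0 \<le> C1" using c_nonneg \<kappa>_pos by (simp add: C1_def)
  have C2: "0 \<le> C2" using G0 \<kappa>_pos by (simp add: C2_def)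
  have E0: "0 \<le> E0" using C2 \<rho> by (simp add: E0_def)
  have L: "1 \<le> L" using C1 \<rho> by (simp add: L_def)
  obtain j0 :: nat where j0: "\<kappa> * C1 / (\<rho> - \<kappa>) < real j0" using reals_Archimedean2 by blast
  \<comment> \<open>Before time \<open>j0\<close> the factor \<open>\<kappa> (1 + O(1/j))\<close> may exceed \<open>\<rho>\<close>; \<open>W\<close> absorbs these finitely many steps.\<close>
  define W where "W j = L ^ (j0 - j)" for j
  have W1: "1 \<le> W j" for j using L by (simp add: W_def)
  have W0: "W j \<le> W 0" for j using L by (simp add: W_def power_increasing)
  have W_step: "\<kappa> * (1 + C1 / (real j + 2)) * W (Suc j) \<le> \<rho> * W j" for j
  proof (cases "j0 \<le> j")
    case True
    then have "\<kappa> * C1 / (\<rho> - \<kappa>) \<le> real j + 2" using j0 by linarith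
    then have "\<kappa> * C1 \<le> (real j + 2) * (\<rho> - \<kappa>)" using \<rho> by (simp add: pos_divide_le_eq)
    then have "\<kappa> * (1 + C1 / (real j + 2)) \<le> \<rho>" by (simp add: field_simps)
    moreover have "W j = 1" "W (Suc j) = 1" using True by (auto simp: W_def)
    ultimately show ?thesis by simp
  next
    case False
    then have "j0 - j = Suc (j0 - Suc j)" by simp
    then have "\<rho> * W j = (1 + C1) * W (Suc j)" using \<rho> by (simp add: W_def L_def)
    moreover have "\<kappa> * (1 + C1 / (real j + 2)) \<le> 1 * (1 + C1 / 1)"
      using \<kappa>_pos \<kappa>_less C1 by (intro mult_mono add_left_mono divide_left_mono) auto
    ultimately show ?thesis using W1[of "Suc j"] mult_right_mono by fastforce
  qed
  define gs where "gs j p = (\<Sum>q\<in>{j<..p}. 2 * c / real q * (A1 * \<rho> ^ (p - q) + E1 * \<theta> q p))" for j p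
  have gs_le: "gs j p \<le> G * \<theta> j p" if "j \<le> p" for j p
  proof -
    have "gs j p = 2 * c * (A1 * (\<Sum>q\<in>{j<..p}. \<rho> ^ (p - q) / real q) + E1 * (\<Sum>q\<in>{j<..p}. \<theta> q p / real q))"
      by (simp add: gs_def sum_distrib_left sum.distrib algebra_simps)
    also have "\<dots> \<le> 2 * c * (A1 * (2 / (1 - \<rho>)\<^sup>2 * \<theta> j p) + E1 * (8 * \<theta> j p))"
      using c_nonneg A1 E1 sum_geometric_over_q[OF that \<rho>(2,3)] sum_\<theta>_over_q[OF that]
      by (intro mult_left_mono add_mono) auto
    finally show ?thesis by (simp add: G_def algebra_simps)
  qed
  have gs_Suc: "gs j p = 2 * c / (real j + 1) * (A1 * \<rho> ^ (p - Suc j) + E1 * \<theta> (Suc j) p) + gs (Suc j) p"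
    if "j < p" for j p
  proof -
    have "{j<..p} = insert (Suc j) {Suc j<..p}" using that by auto
    then show ?thesis by (simp add: gs_def add.commute)
  qed
  have main: "old_bound l j (B * gs j p) (ev j (p - j) (\<lambda>h. \<phi> (h p))) \<and>
      fresh_bound l j (B * (W j * ((if indep l \<phi> then 0 else 2 / \<kappa> ^ N * \<rho> ^ (p - j)) + E0 * \<theta> j p)))
        (ev j (p - j) (\<lambda>h. \<phi> (h p)))"
    if \<phi>: "bounded_by Em B \<phi>" and "j \<le> p" for B \<phi> p j
    using \<open>j \<le> p\<close>
  proof (induction j rule: inc_induct)
    case base
    have F: "bounded_by Hs B (\<lambda>h. \<phi> (h p))" by (rule state_fun_bounded[OF \<phi>])
    have B: "0 \<le> B" by (rule Em_bounded_nonneg[OF \<phi>])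
    have "old_bound l p (B * gs p p) (\<lambda>h. \<phi> (h p))"
      unfolding old_bound_def gs_def by auto
    moreover
    have "fresh_bound l p (B * (W p * ((if indep l \<phi> then 0 else 2 / \<kappa> ^ N * \<rho> ^ (p - p)) + E0 * \<theta> p p))) (\<lambda>h. \<phi> (h p))"
    proof (rule fresh_bound_mono)
      show "fresh_bound l p ((if indep l \<phi> then 0 else 2 * B) / \<kappa> ^ N) (\<lambda>h. \<phi> (h p))"
        unfolding fresh_bound_def
      proof
        fix h assume h: "h \<in> space Hs"
        have x: "h p \<in> space Em" by (rule space_Hs_coord[OF h])
        have b: "bounded_by (S l) B (\<lambda>z. \<phi> ((h p)(l := z)))"
          by (rule bounded_by_comp[OF \<phi> measurable_Em_upd'[OF x l]])
        have "contr l (emp l p h) ((if indep l \<phi> then 0 else 2 * B) / \<kappa> ^ N) (\<lambda>z. \<phi> ((h p)(l := z)))"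
        proof (rule contr_of_osc[OF l emp_prob[OF h l] b])
          fix y z assume yz: "y \<in> space (S l)" "z \<in> space (S l)"
          show "\<bar>\<phi> ((h p)(l := y)) - \<phi> ((h p)(l := z))\<bar> \<le> (if indep l \<phi> then 0 else 2 * B)"
            using bounded_by_abs[OF b yz(1)] bounded_by_abs[OF b yz(2)] yz x
            unfolding indep_def by auto
        qed
        then show "contr l (emp l p h) ((if indep l \<phi> then 0 else 2 * B) / \<kappa> ^ N) (\<lambda>z. \<phi> ((h(p := (h p)(l := z))) p))"
          by simp
      qed
      have "B * (1 * (if indep l \<phi> then 0 else 2 / \<kappa> ^ N))
          \<le> B * (W p * ((if indep l \<phi> then 0 else 2 / \<kappa> ^ N * \<rho> ^ (p - p)) + E0 * \<theta> p p))"
        using B W1[of p] E0 \<theta>_nonneg[of p p] \<kappa>_pos by (intro mult_left_mono mult_mono) auto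
      then show "(if indep l \<phi> then 0 else 2 * B) / \<kappa> ^ N
          \<le> B * (W p * ((if indep l \<phi> then 0 else 2 / \<kappa> ^ N * \<rho> ^ (p - p)) + E0 * \<theta> p p))"
        by (simp split: if_splits add: mult.commute)
    qed
    ultimately show ?case
      using old_bound_cong[OF l] fresh_bound_cong[OF l] ev_0[OF F] by (metis (no_types, lifting) diff_self_eq_0)
  next
    case (step j)
    define F where "F = ev (Suc j) (p - Suc j) (\<lambda>h. \<phi> (h p))"
    define d1 where "d1 = B * (A1 * \<rho> ^ (p - Suc j) + E1 * \<theta> (Suc j) p)"
    define X where "X i = (if indep l \<phi> then 0 else 2 / \<kappa> ^ N * \<rho> ^ (p - i)) + E0 * \<theta> i p" for i
    have F: "bounded_by Hs B F" unfolding F_def by (rule ev_bounded_by[OF state_fun_bounded[OF \<phi>]])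
    have B: "0 \<le> B" by (rule Em_bounded_nonneg[OF \<phi>])
    have j: "j < p" "j \<le> p" "Suc j \<le> p" using step by auto
    have eq: "ev j (p - j) (\<lambda>h. \<phi> (h p)) h = ev j (Suc 0) F h" if "h \<in> space Hs" for h
      unfolding F_def by (rule ev_split_first[OF state_fun_bounded[OF \<phi>] that j(1)])
    have old: "old_bound l (Suc j) (B * gs (Suc j) p) F"
      and own: "fresh_bound l (Suc j) (B * (W (Suc j) * X (Suc j))) F"
      using step.IH unfolding F_def X_def by auto
    have fresh: "fresh_bound (Suc l) (Suc j) d1 F" if "Suc l \<le> m"
    proof (rule fresh_bound_mono)
      show "fresh_bound (Suc l) (Suc j) (B * ((if indep (Suc l) \<phi> then 0 else A1 * \<rho> ^ (p - Suc j)) + E1 * \<theta> (Suc j) p)) F"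
        using up[OF that] \<phi> j unfolding stab_def F_def by blast
      show "B * ((if indep (Suc l) \<phi> then 0 else A1 * \<rho> ^ (p - Suc j)) + E1 * \<theta> (Suc j) p) \<le> d1"
        unfolding d1_def using B A1 \<rho> by (intro mult_left_mono) auto
    qed
    have d1: "0 \<le> d1" unfolding d1_def using B A1 E1 \<rho> \<theta>_nonneg by simp
    have sum: "B * gs (Suc j) p + 2 * c / (real j + 1) * d1 = B * gs j p"
      unfolding gs_Suc[OF j(1)] d1_def by (simp add: algebra_simps)
    have 1: "old_bound l j (B * gs j p) (ev j (Suc 0) F)"
      using step_old[OF l F old fresh d1] unfolding sum .
    have X: "\<rho> * X (Suc j) + C2 * \<theta> j p \<le> X j"
    proof -
      have "\<rho> * (E0 * \<theta> (Suc j) p) \<le> \<rho> * (E0 * \<theta> j p)"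
        using \<theta>_Suc[of j p] E0 \<rho> by (intro mult_left_mono) auto
      moreover have "C2 * \<theta> j p = (1 - \<rho>) * (E0 * \<theta> j p)" using \<rho> by (simp add: E0_def)
      moreover have "\<rho> * \<rho> ^ (p - Suc j) = \<rho> ^ (p - j)"
        using j(1) by (metis Suc_diff_Suc power_Suc)
      then have "\<rho> * (if indep l \<phi> then 0 else 2 / \<kappa> ^ N * \<rho> ^ (p - Suc j))
          = (if indep l \<phi> then 0 else 2 / \<kappa> ^ N * \<rho> ^ (p - j))"
        by (auto simp: mult.left_commute)
      ultimately show ?thesis unfolding X_def by (simp only: distrib_left left_diff_distrib)
    qed
    have X0: "0 \<le> X i" for i using E0 \<theta>_nonneg \<rho> \<kappa>_pos by (simp add: X_def)
    have "\<kappa> * ((1 + C1 / (real j + 2)) * (W (Suc j) * X (Suc j))) + C2 * \<theta> j p \<le> W j * X j"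
    proof -
      have "\<kappa> * ((1 + C1 / (real j + 2)) * (W (Suc j) * X (Suc j)))
          = \<kappa> * (1 + C1 / (real j + 2)) * W (Suc j) * X (Suc j)" by simp
      also have "\<dots> \<le> \<rho> * W j * X (Suc j)"
        by (rule mult_right_mono[OF W_step X0])
      finally have "\<kappa> * ((1 + C1 / (real j + 2)) * (W (Suc j) * X (Suc j))) + C2 * \<theta> j p
          \<le> \<rho> * W j * X (Suc j) + W j * (C2 * \<theta> j p)"
        using mult_right_mono[OF W1[of j], of "C2 * \<theta> j p"] C2 \<theta>_nonneg[of j p] by simp
      also have "\<dots> \<le> W j * X j"
        using mult_left_mono[OF X, of "W j"] W1[of j] by (simp add: algebra_simps)
      finally show ?thesis .
    qed
    from mult_left_mono[OF this B]
    have ineq: "\<kappa> * ((1 + C1 / (real j + 2)) * (B * (W (Suc j) * X (Suc j)))) + 2 * (B * (G * \<theta> j p)) / \<kappa> ^ N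
        \<le> B * (W j * X j)"
      by (simp add: C2_def algebra_simps)
    have 2: "fresh_bound l j (B * (W j * X j)) (ev j (Suc 0) F)"
    proof (rule fresh_bound_mono[OF step_fresh[OF l F old fresh d1 own]])
      have "2 * (B * gs j p) / \<kappa> ^ N \<le> 2 * (B * (G * \<theta> j p)) / \<kappa> ^ N"
        using gs_le[OF j(2)] B \<kappa>_pos by (intro divide_right_mono mult_left_mono) auto
      with ineq show "\<kappa> * ((1 + 4 * real N * c / \<kappa> ^ N / (real j + 2)) * (B * (W (Suc j) * X (Suc j))))
          + 2 * (B * gs (Suc j) p + 2 * c / (real j + 1) * d1) / \<kappa> ^ N \<le> B * (W j * X j)"
        unfolding sum C1_def by linarith
    qed
    show ?case
      using old_bound_cong[OF l 1 eq] fresh_bound_cong[OF l 2 eq] unfolding X_def by blast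
  qed
  have "stab l (W 0 * (2 / \<kappa> ^ N)) (W 0 * E0)"
    unfolding stab_def
  proof (intro conjI allI impI)
    show "0 \<le> W 0 * (2 / \<kappa> ^ N)" "0 \<le> W 0 * E0" using W1[of 0] \<kappa>_pos E0 by auto
    fix B \<phi> and p j :: nat assume \<phi>: "bounded_by Em B \<phi>" and j: "j \<le> p"
    have B: "0 \<le> B" by (rule Em_bounded_nonneg[OF \<phi>])
    show "fresh_bound l j (B * ((if indep l \<phi> then 0 else W 0 * (2 / \<kappa> ^ N) * \<rho> ^ (p - j)) + W 0 * E0 * \<theta> j p))
        (ev j (p - j) (\<lambda>h. \<phi> (h p)))"
    proof (rule fresh_bound_mono[OF conjunct2[OF main[OF \<phi> j]]])
      have "B * (W j * ((if indep l \<phi> then 0 else 2 / \<kappa> ^ N * \<rho> ^ (p - j)) + E0 * \<theta> j p))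
          \<le> B * (W 0 * ((if indep l \<phi> then 0 else 2 / \<kappa> ^ N * \<rho> ^ (p - j)) + E0 * \<theta> j p))"
        using B W0[of j] E0 \<theta>_nonneg \<kappa>_pos \<rho> by (intro mult_left_mono mult_right_mono) auto
      also have "\<dots> = B * ((if indep l \<phi> then 0 else W 0 * (2 / \<kappa> ^ N) * \<rho> ^ (p - j)) + W 0 * E0 * \<theta> j p)"
        by (simp add: algebra_simps)
      finally show "B * (W j * ((if indep l \<phi> then 0 else 2 / \<kappa> ^ N * \<rho> ^ (p - j)) + E0 * \<theta> j p))
          \<le> B * ((if indep l \<phi> then 0 else W 0 * (2 / \<kappa> ^ N) * \<rho> ^ (p - j)) + W 0 * E0 * \<theta> j p)" .
    qed
  qed
  then show ?thesis by blast
qed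

lemma stab_mono: "stab l A E \<Longrightarrow> A \<le> A' \<Longrightarrow> E \<le> E' \<Longrightarrow> stab l A' E'"
  unfolding stab_def
proof (intro conjI allI impI; (elim conjE)?)
  fix B \<phi> and p j :: nat
  assume "0 \<le> A" "0 \<le> E" "A \<le> A'" "E \<le> E'" and \<phi>: "bounded_by Em B \<phi>" and j: "j \<le> p"
    and *: "\<forall>B \<phi> p j. bounded_by Em B \<phi> \<longrightarrow> j \<le> p \<longrightarrow>
      fresh_bound l j (B * ((if indep l \<phi> then 0 else A * \<rho> ^ (p - j)) + E * \<theta> j p)) (ev j (p - j) (\<lambda>h. \<phi> (h p)))"
  have B: "0 \<le> B" by (rule Em_bounded_nonneg[OF \<phi>])
  show "fresh_bound l j (B * ((if indep l \<phi> then 0 else A' * \<rho> ^ (p - j)) + E' * \<theta> j p)) (ev j (p - j) (\<lambda>h. \<phi> (h p)))"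
  proof (rule fresh_bound_mono)
    show "fresh_bound l j (B * ((if indep l \<phi> then 0 else A * \<rho> ^ (p - j)) + E * \<theta> j p)) (ev j (p - j) (\<lambda>h. \<phi> (h p)))"
      using * \<phi> j by blast
    show "B * ((if indep l \<phi> then 0 else A * \<rho> ^ (p - j)) + E * \<theta> j p)
        \<le> B * ((if indep l \<phi> then 0 else A' * \<rho> ^ (p - j)) + E' * \<theta> j p)"
      using B \<open>A \<le> A'\<close> \<open>E \<le> E'\<close> \<rho> \<theta>_nonneg by (intro mult_left_mono add_mono mult_right_mono) (auto intro!: mult_right_mono)
  qed
qed auto

lemma stability: "\<exists>A E. 0 \<le> A \<and> 0 \<le> E \<and> (\<forall>l\<le>m. stab l A E)"
proof -
  have ex: "\<exists>A E. stab l A E" if "l \<le> m" for l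
    using that
  proof (induction l rule: inc_induct)
    case base
    show ?case by (rule stab_step[of m 0 0]) auto
  next
    case (step l)
    then obtain A1 E1 where "stab (Suc l) A1 E1" by blast
    then show ?case using step(2) by (intro stab_step[of l A1 E1]) (auto simp: stab_def)
  qed
  then obtain A E where AE: "\<And>l. l \<le> m \<Longrightarrow> stab l (A l) (E l)" by metis
  then have nn: "0 \<le> A l" "0 \<le> E l" if "l \<le> m" for l using that by (auto simp: stab_def)
  have "stab l (\<Sum>l\<le>m. A l) (\<Sum>l\<le>m. E l)" if "l \<le> m" for l
    using that nn by (intro stab_mono[OF AE[OF that]] member_le_sum) auto
  moreover have "0 \<le> (\<Sum>l\<le>m. A l)" "0 \<le> (\<Sum>l\<le>m. E l)" using nn by (auto intro: sum_nonneg)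
  ultimately show ?thesis by blast
qed

end



section \<open>Concentration of time averages\<close>

lemma Hoeffding_exponential_moment:
  assumes Q: "prob_space Q" and X: "bounded_by Q d X" and X0: "(\<integral>x. X x \<partial>Q) = 0"
  shows "(\<integral>x. exp (t * X x) \<partial>Q) \<le> exp (t\<^sup>2 * d\<^sup>2 / 2)"
proof -
  interpret prob_space Q by fact
  have pos: "(\<integral>x. exp (t * Y x) \<partial>Q) \<le> exp (t\<^sup>2 * d\<^sup>2 / 2)"
    if Y: "bounded_by Q d Y" and Y0: "(\<integral>x. Y x \<partial>Q) = 0" and t: "0 < t" for Y t
  proof -
    interpret interval_bounded_random_variable Q Y "- d" d
      by unfold_locales (use Y in \<open>auto simp: bounded_by_def abs_le_iff intro!: AE_I2\<close>)
    have "ennreal (\<integral>x. exp (t * Y x) \<partial>Q) = (\<integral>\<^sup>+x. exp (t * Y x) \<partial>Q)"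
    proof (rule nn_integral_eq_integral[symmetric])
      show "integrable Q (\<lambda>x. exp (t * Y x))"
      proof (rule integrable_bounded[where B = "exp (t * d)"])
        fix x assume "x \<in> space Q"
        then have "Y x \<le> d" using bounded_by_abs[OF Y] by fastforce
        then show "\<bar>exp (t * Y x)\<bar> \<le> exp (t * d)" using t by simp
      qed (use random_variable in measurable)
    qed simp
    also have "\<dots> \<le> ennreal (exp (t\<^sup>2 * (d - (- d))\<^sup>2 / 8))"
      by (rule Hoeffdings_lemma_nn_integral_0[OF t Y0])
    finally show ?thesis by (simp add: power2_eq_square algebra_simps)
  qed
  show ?thesis
  proof (cases "0 < t")
    case True
    then show ?thesis using pos[OF X X0] by simp
  next
    case False
    show ?thesis
    proof (cases "t = 0")
      case True
      then show ?thesis by (simp add: prob_space)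
    next
      case neq: False
      have "bounded_by Q d (\<lambda>x. - X x)" using X by (auto simp: bounded_by_def)
      from pos[OF this, of "- t"] show ?thesis using False neq X0 by simp
    qed
  qed
qed

context triangular_chain
begin

definition avg :: "nat \<Rightarrow> ((nat \<Rightarrow> 'a) \<Rightarrow> real) \<Rightarrow> (nat \<Rightarrow> nat \<Rightarrow> 'a) \<Rightarrow> real"
  where "avg n f h = (\<Sum>p\<le>n. f (h p)) / (real n + 1)"

lemma avg_bounded:
  assumes f: "bounded_by Em B f"
  shows "bounded_by Hs B (avg n f)"
proof (rule bounded_byI)
  show "avg n f \<in> borel_measurable Hs"
    unfolding avg_def[abs_def]
    by (intro borel_measurable_divide borel_measurable_sum bounded_by_measurable[OF state_fun_bounded[OF f]]) simp
  fix h assume h: "h \<in> space Hs"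
  have "\<bar>\<Sum>p\<le>n. f (h p)\<bar> \<le> (\<Sum>p\<le>n. B)"
    by (rule order_trans[OF sum_abs sum_mono]) (rule bounded_by_abs[OF f space_Hs_coord[OF h]])
  then show "\<bar>avg n f h\<bar> \<le> B" by (simp add: avg_def pos_divide_le_eq mult.commute add.commute)
qed

lemma ev_avg:
  assumes f: "bounded_by Em B f" and h: "h \<in> space Hs"
  shows "ev j k (avg n f) h = (\<Sum>p\<le>n. ev j k (\<lambda>h. f (h p)) h) / (real n + 1)"
  unfolding ev_def avg_def[abs_def]
  using ev_integrable[OF state_fun_bounded[OF f] h] by simp

lemma ev_state:
  assumes f: "bounded_by Em B f" and h: "h \<in> space Hs"
  shows "p \<le> j \<Longrightarrow> ev j k (\<lambda>h. f (h p)) h = f (h p)"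
    and "j \<le> p \<Longrightarrow> p \<le> n \<Longrightarrow> ev j (n - j) (\<lambda>h. f (h p)) h = ev j (p - j) (\<lambda>h. f (h p)) h"
proof -
  have ad: "ev j k (\<lambda>h. f (h p)) h = f (h p)" if "p \<le> j" "h \<in> space Hs" for j k h
    by (rule ev_adapted[OF state_fun_bounded[OF f] that(2)]) (use that in auto)
  then show "p \<le> j \<Longrightarrow> ev j k (\<lambda>h. f (h p)) h = f (h p)" using h by simp
  assume jp: "j \<le> p" "p \<le> n"
  have "ev j (n - j) (\<lambda>h. f (h p)) h = ev j (p - j) (ev (j + (p - j)) (n - p) (\<lambda>h. f (h p))) h"
    using ev_add[OF state_fun_bounded[OF f] h, of j "p - j" "n - p"] jp by simp
  also have "\<dots> = ev j (p - j) (\<lambda>h. f (h p)) h"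
    using jp by (intro ev_cong[OF h] ad) auto
  finally show "ev j (n - j) (\<lambda>h. f (h p)) h = ev j (p - j) (\<lambda>h. f (h p)) h" .
qed

text \<open>
  Change one coordinate after the other.
\<close>

lemma state_change:
  fixes F :: "(nat \<Rightarrow> nat \<Rightarrow> 'a) \<Rightarrow> real"
  assumes d: "\<And>l h z. l \<le> m \<Longrightarrow> h \<in> space Hs \<Longrightarrow> z \<in> space (S l) \<Longrightarrow> \<bar>F h - F (h(j := (h j)(l := z)))\<bar> \<le> d l"
    and h: "h \<in> space Hs" and x: "x \<in> space Em"
  shows "\<bar>F h - F (h(j := x))\<bar> \<le> (\<Sum>l\<le>m. d l)"
proof -
  define y where "y k = (\<lambda>l. if l < k then x l else h j l)" for k :: nat
  have hj: "h j \<in> space Em" by (rule space_Hs_coord[OF h])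
  have y: "y k \<in> space Em" if "k \<le> Suc m" for k
    using that hj x by (auto simp: y_def space_PiM PiE_iff extensional_def)
  have "\<bar>F h - F (h(j := y k))\<bar> \<le> (\<Sum>l<k. d l)" if "k \<le> Suc m" for k
    using that
  proof (induction k)
    case 0
    have "y 0 = h j" by (auto simp: y_def)
    then show ?case by simp
  next
    case (Suc k)
    have "y (Suc k) = (y k)(k := x k)" by (auto simp: y_def)
    then have "h(j := y (Suc k)) = (h(j := y k))(j := ((h(j := y k)) j)(k := x k))" by simp
    then have "\<bar>F (h(j := y k)) - F (h(j := y (Suc k)))\<bar> \<le> d k"
      using d[of k "h(j := y k)" "x k"] Suc.prems space_Hs_upd[OF h y[of k], of j] space_Em_coord[OF x, of k] by simp
    with Suc.IH[OF Suc_leD[OF Suc.prems]] show ?case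
      unfolding sum.lessThan_Suc by linarith
  qed
  moreover have "y (Suc m) = x"
    using hj x by (auto simp: y_def fun_eq_iff space_PiM PiE_iff extensional_def)
  ultimately show ?thesis by (metis lessThan_Suc_atMost order_refl)
qed

lemma stab_osc:
  assumes "stab l A E" "l \<le> m" "bounded_by Em B \<phi>" "j \<le> p" "h \<in> space Hs" "z \<in> space (S l)"
  shows "\<bar>ev j (p - j) (\<lambda>h. \<phi> (h p)) h - ev j (p - j) (\<lambda>h. \<phi> (h p)) (h(j := (h j)(l := z)))\<bar>
    \<le> B * ((if indep l \<phi> then 0 else A * \<rho> ^ (p - j)) + E * \<theta> j p)"
  using assms(1,3,4) fresh_bound_osc[OF _ assms(2,5,6)] unfolding stab_def by blast

text \<open>
  The increments of the martingale \<open>ev j (n - j) (avg n f)\<close>: the states before \<open>j\<close> do not move, and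
  the others contribute the stability bounds, before division by \<open>n + 1\<close> in total \<open>O(1)\<close> from the geometric
  terms and \<open>O((n/j)^(1/4))\<close> from the terms \<open>\<theta> j p\<close>.
\<close>

lemma avg_osc:
  "\<exists>C\<ge>0. \<forall>B f n j h x. bounded_by Em B f \<longrightarrow> j \<le> n \<longrightarrow> h \<in> space Hs \<longrightarrow> x \<in> space Em \<longrightarrow>
    \<bar>ev j (n - j) (avg n f) h - ev j (n - j) (avg n f) (h(j := x))\<bar> \<le> B * C * \<theta> j n"
proof -
  obtain A E where AE: "0 \<le> A" "0 \<le> E" "\<And>l. l \<le> m \<Longrightarrow> stab l A E" using stability by blast
  define C where "C = (real m + 1) * (A / (1 - \<rho>) + 4 * E)"
  have "\<bar>ev j (n - j) (avg n f) h - ev j (n - j) (avg n f) (h(j := x))\<bar> \<le> B * C * \<theta> j n"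
    if f: "bounded_by Em B f" and jn: "j \<le> n" and h: "h \<in> space Hs" and x: "x \<in> space Em" for B f n j h x
  proof -
    have B: "0 \<le> B" by (rule Em_bounded_nonneg[OF f])
    have hx: "h(j := x) \<in> space Hs" by (rule space_Hs_upd[OF h x])
    have summand: "\<bar>ev j (n - j) (\<lambda>h. f (h p)) h - ev j (n - j) (\<lambda>h. f (h p)) (h(j := x))\<bar>
        \<le> (if p < j then 0 else B * (real m + 1) * (A * \<rho> ^ (p - j) + E * \<theta> j p))" if p: "p \<le> n" for p
    proof (cases "p < j")
      case True
      then show ?thesis using ev_state(1)[OF f h, of p j] ev_state(1)[OF f hx, of p j] by simp
    next
      case False
      then have jp: "j \<le> p" by simp
      have "\<bar>ev j (p - j) (\<lambda>h. f (h p)) h - ev j (p - j) (\<lambda>h. f (h p)) (h(j := x))\<bar>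
          \<le> (\<Sum>l\<le>m. B * (A * \<rho> ^ (p - j) + E * \<theta> j p))"
      proof (rule state_change[OF _ h x])
        fix l h z assume l: "l \<le> m" and "h \<in> space Hs" "z \<in> space (S l)"
        then have "\<bar>ev j (p - j) (\<lambda>h. f (h p)) h - ev j (p - j) (\<lambda>h. f (h p)) (h(j := (h j)(l := z)))\<bar>
          \<le> B * ((if indep l f then 0 else A * \<rho> ^ (p - j)) + E * \<theta> j p)"
          by (intro stab_osc[OF AE(3)[OF l] l f jp])
        also have "\<dots> \<le> B * (A * \<rho> ^ (p - j) + E * \<theta> j p)"
          using B AE \<rho> by (intro mult_left_mono) auto
        finally show "\<bar>ev j (p - j) (\<lambda>h. f (h p)) h - ev j (p - j) (\<lambda>h. f (h p)) (h(j := (h j)(l := z)))\<bar>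
          \<le> B * (A * \<rho> ^ (p - j) + E * \<theta> j p)" .
      qed
      then show ?thesis
        using False ev_state(2)[OF f h jp p] ev_state(2)[OF f hx jp p]
        by (simp add: mult.commute mult.left_commute add.commute)
    qed
    have "\<bar>ev j (n - j) (avg n f) h - ev j (n - j) (avg n f) (h(j := x))\<bar>
        = \<bar>\<Sum>p\<le>n. ev j (n - j) (\<lambda>h. f (h p)) h - ev j (n - j) (\<lambda>h. f (h p)) (h(j := x))\<bar> / (real n + 1)"
      unfolding ev_avg[OF f h] ev_avg[OF f hx] by (simp add: sum_subtractf diff_divide_distrib[symmetric])
    also have "\<dots> \<le> (\<Sum>p\<le>n. if p < j then 0 else B * (real m + 1) * (A * \<rho> ^ (p - j) + E * \<theta> j p)) / (real n + 1)"
      using summand by (intro divide_right_mono order_trans[OF sum_abs sum_mono]) auto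
    also have "(\<Sum>p\<le>n. if p < j then 0 else B * (real m + 1) * (A * \<rho> ^ (p - j) + E * \<theta> j p))
        = (\<Sum>p\<in>{j..n}. B * (real m + 1) * (A * \<rho> ^ (p - j) + E * \<theta> j p))"
      by (rule sum.mono_neutral_cong_right) auto
    also have "\<dots> = B * (real m + 1) * (A * (\<Sum>p\<in>{j..n}. \<rho> ^ (p - j)) + E * (\<Sum>p\<in>{j..n}. \<theta> j p))"
      by (simp add: sum_distrib_left sum.distrib algebra_simps)
    finally have bound: "\<bar>ev j (n - j) (avg n f) h - ev j (n - j) (avg n f) (h(j := x))\<bar>
        \<le> B * (real m + 1) * (A * (\<Sum>p\<in>{j..n}. \<rho> ^ (p - j)) + E * (\<Sum>p\<in>{j..n}. \<theta> j p)) / (real n + 1)" .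
    have "(\<Sum>p\<in>{j..n}. \<rho> ^ (p - j)) = (\<Sum>k<Suc (n - j). \<rho> ^ k)"
      using jn by (intro sum.reindex_bij_witness[of _ "\<lambda>k. k + j" "\<lambda>p. p - j"]) auto
    also have "\<dots> \<le> 1 / (1 - \<rho>)"
      using \<rho> by (subst sum_gp_strict) (auto simp: divide_right_mono)
    finally have geo: "(\<Sum>p\<in>{j..n}. \<rho> ^ (p - j)) \<le> 1 / (1 - \<rho>)" .
    have the: "(\<Sum>p\<in>{j..n}. \<theta> j p) \<le> 4 * (real n + 1) powr (1/4) * (real j + 1) powr (-1/4)"
    proof -
      have "(\<Sum>p\<in>{j..n}. \<theta> j p) \<le> (\<Sum>p<Suc n. \<theta> j p)"
        by (rule sum_mono2) (auto simp: \<theta>_nonneg)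
      also have "\<dots> = (\<Sum>p<Suc n. (real p + 1) powr (1/4 - 1)) * (real j + 1) powr (-1/4)"
        unfolding \<theta>_def sum_distrib_right by simp
      also have "\<dots> \<le> (real (Suc n) powr (1/4) / (1/4)) * (real j + 1) powr (-1/4)"
        by (intro mult_right_mono sum_powr_le) auto
      finally show ?thesis by (simp add: add.commute mult.commute)
    qed
    note bound
    also have "B * (real m + 1) * (A * (\<Sum>p\<in>{j..n}. \<rho> ^ (p - j)) + E * (\<Sum>p\<in>{j..n}. \<theta> j p)) / (real n + 1)
        \<le> B * (real m + 1) * (A * (1 / (1 - \<rho>)) + E * (4 * (real n + 1) powr (1/4) * (real j + 1) powr (-1/4))) / (real n + 1)"
      using B AE geo the by (intro divide_right_mono mult_left_mono add_mono) auto
    also have "\<dots> = B * (real m + 1) * (A / (1 - \<rho>) * (1 / (real n + 1))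
        + 4 * E * ((real n + 1) powr (1/4) / (real n + 1) * (real j + 1) powr (-1/4)))"
      by (simp only: divide_inverse mult_1_left) (simp only: algebra_simps)
    also have "(real n + 1) powr (1/4) / (real n + 1) = (real n + 1) powr (-3/4)"
      using powr_diff[of "real n + 1" "1/4" 1] by simp
    also have "(real n + 1) powr (-3/4) * (real j + 1) powr (-1/4) = \<theta> j n" by (simp add: \<theta>_def)
    also have "B * (real m + 1) * (A / (1 - \<rho>) * (1 / (real n + 1)) + 4 * E * \<theta> j n)
        \<le> B * (real m + 1) * (A / (1 - \<rho>) * \<theta> j n + 4 * E * \<theta> j n)"
      using B AE \<rho> inverse_le_\<theta>[OF jn] by (intro mult_left_mono add_right_mono) auto
    also have "\<dots> = B * C * \<theta> j n" by (simp add: C_def algebra_simps)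
    finally show ?thesis .
  qed
  moreover have "0 \<le> C" using AE \<rho> by (simp add: C_def)
  ultimately show ?thesis by blast
qed

lemma sum_\<theta>_squares: "(\<Sum>q\<in>{0<..n}. (\<theta> q n)\<^sup>2) \<le> 2 / (real n + 1)"
proof -
  have "(\<Sum>q\<in>{0<..n}. (\<theta> q n)\<^sup>2) \<le> (\<Sum>q<Suc n. (\<theta> q n)\<^sup>2)"
    by (rule sum_mono2) auto
  also have "\<dots> = (real n + 1) powr (-3/2) * (\<Sum>q<Suc n. (real q + 1) powr (1/2 - 1))"
    unfolding \<theta>_def sum_distrib_left
    by (intro sum.cong) (simp_all add: power_mult_distrib powr_power)
  also have "\<dots> \<le> (real n + 1) powr (-3/2) * (real (Suc n) powr (1/2) / (1/2))"
    by (intro mult_left_mono sum_powr_le) auto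
  also have "\<dots> = 2 * (real n + 1) powr (-1)"
    using powr_add[of "real n + 1" "-3/2" "1/2"] by (simp add: add.commute)
  also have "\<dots> = 2 / (real n + 1)" by (simp add: powr_minus_divide)
  finally show ?thesis .
qed

lemma ev_exp_bounded: "bounded_by Hs B F \<Longrightarrow> bounded_by Hs (exp (\<bar>t\<bar> * B)) (\<lambda>h. exp (t * F h))"
proof (rule bounded_byI)
  assume F: "bounded_by Hs B F"
  show "(\<lambda>h. exp (t * F h)) \<in> borel_measurable Hs"
    using bounded_by_measurable[OF F] by measurable
  fix h assume h: "h \<in> space Hs"
  have "t * F h \<le> \<bar>t\<bar> * \<bar>F h\<bar>" by (metis abs_ge_self abs_mult)
  also have "\<dots> \<le> \<bar>t\<bar> * B" by (intro mult_left_mono bounded_by_abs[OF F h]) simp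
  finally show "\<bar>exp (t * F h)\<bar> \<le> exp (\<bar>t\<bar> * B)" by simp
qed

text \<open>
  Backward induction on \<open>j\<close>: one step multiplies the exponential moment by at most the factor in
  Hoeffding's lemma for the martingale increment at time \<open>Suc j\<close>.
\<close>

lemma concentration:
  "\<exists>C\<ge>0. \<forall>B f n h t. bounded_by Em B f \<longrightarrow> h \<in> space Hs \<longrightarrow>
    ev 0 n (\<lambda>h. exp (t * avg n f h)) h \<le> exp (t * ev 0 n (avg n f) h + t\<^sup>2 * B\<^sup>2 * C / (real n + 1))"
proof -
  obtain D where D: "0 \<le> D" "\<And>B f n j h x. bounded_by Em B f \<Longrightarrow> j \<le> n \<Longrightarrow> h \<in> space Hs \<Longrightarrow> x \<in> space Em \<Longrightarrow>
    \<bar>ev j (n - j) (avg n f) h - ev j (n - j) (avg n f) (h(j := x))\<bar> \<le> B * D * \<theta> j n"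
    using avg_osc by blast
  have "ev 0 n (\<lambda>h. exp (t * avg n f h)) h \<le> exp (t * ev 0 n (avg n f) h + t\<^sup>2 * B\<^sup>2 * D\<^sup>2 / (real n + 1))"
    if f: "bounded_by Em B f" and h: "h \<in> space Hs" for B f n h t
  proof -
    define F where "F j = ev j (n - j) (avg n f)" for j
    define s where "s j = (\<Sum>q\<in>{j<..n}. (B * D * \<theta> q n)\<^sup>2) / 2" for j
    define G where "G = (\<lambda>h. exp (t * avg n f h))"
    have F: "bounded_by Hs B (F j)" for j unfolding F_def by (rule ev_bounded_by[OF avg_bounded[OF f]])
    have G: "bounded_by Hs (exp (\<bar>t\<bar> * B)) G" unfolding G_def by (rule ev_exp_bounded[OF avg_bounded[OF f]])
    have "ev j (n - j) G h \<le> exp (t * F j h + t\<^sup>2 * s j)" if "j \<le> n" "h \<in> space Hs" for j h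
      using that
    proof (induction j arbitrary: h rule: inc_induct)
      case base
      then show ?case
        using ev_0[OF G base] ev_0[OF avg_bounded[OF f] base] by (simp add: F_def s_def G_def)
    next
      case (step j)
      have jn: "Suc j \<le> n" and j: "j < n" using step by auto
      have h: "h \<in> space Hs" by fact
      define X where "X y = F (Suc j) (h(Suc j := y)) - F j h" for y
      have K: "prob_space (K j h)" "sets (K j h) = sets Em" "space (K j h) = space Em"
        using K_prob[OF h, of j] by (auto simp: space_prob_algebra dest: sets_eq_imp_space_eq)
      interpret K: prob_space "K j h" by fact
      have FS: "bounded_by Em B (\<lambda>y. F (Suc j) (h(Suc j := y)))"
        by (rule bounded_by_comp[OF F measurable_Hs_upd'[OF h]])
      have Fj: "F j h = (\<integral>y. F (Suc j) (h(Suc j := y)) \<partial>K j h)"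
        unfolding F_def ev_split_first[OF avg_bounded[OF f] h j]
        by (rule ev_1[OF ev_bounded_by[OF avg_bounded[OF f]] h])
      have X: "bounded_by (K j h) (B * D * \<theta> (Suc j) n) X"
      proof (rule bounded_byI)
        show "X \<in> borel_measurable (K j h)"
          unfolding X_def using bounded_by_measurable[OF FS] K(2) by (simp cong: measurable_cong_sets)
        fix y assume "y \<in> space (K j h)"
        then have y: "y \<in> space Em" using K by simp
        have "\<bar>(\<integral>y'. F (Suc j) (h(Suc j := y)) \<partial>K j h) - (\<integral>y'. F (Suc j) (h(Suc j := y')) \<partial>K j h)\<bar> \<le> B * D * \<theta> (Suc j) n"
        proof (rule K.abs_integral_diff_le)
          show "integrable (K j h) (\<lambda>y'. F (Suc j) (h(Suc j := y')))"
            by (rule bounded_by_integrable[OF FS K_prob[OF h]])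
          fix y' assume "y' \<in> space (K j h)"
          then have "y' \<in> space Em" using K by simp
          from D(2)[OF f jn space_Hs_upd[OF h y, of "Suc j"] this]
          show "\<bar>F (Suc j) (h(Suc j := y)) - F (Suc j) (h(Suc j := y'))\<bar> \<le> B * D * \<theta> (Suc j) n"
            by (simp add: F_def)
        qed simp
        then show "\<bar>X y\<bar> \<le> B * D * \<theta> (Suc j) n"
          unfolding X_def Fj by (simp add: K.prob_space)
      qed
      have X0: "(\<integral>y. X y \<partial>K j h) = 0"
        unfolding X_def using bounded_by_integrable[OF FS K_prob[OF h, of j]] Fj by (simp add: K.prob_space)
      have ub: "bounded_by Hs (exp (\<bar>t\<bar> * B) * exp (t\<^sup>2 * s (Suc j))) (\<lambda>h. exp (t * F (Suc j) h) * exp (t\<^sup>2 * s (Suc j)))"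
        using ev_exp_bounded[OF F, of t "Suc j"] by (auto simp: bounded_by_def abs_mult)
      have "ev j (n - j) G h = ev j (Suc 0) (ev (Suc j) (n - Suc j) G) h"
        by (rule ev_split_first[OF G h j])
      also have "\<dots> \<le> ev j (Suc 0) (\<lambda>h. exp (t * F (Suc j) h) * exp (t\<^sup>2 * s (Suc j))) h"
        by (rule ev_mono[OF ev_bounded_by[OF G] ub h]) (use step.IH in \<open>simp add: exp_add\<close>)
      also have "\<dots> = (\<integral>y. exp (t * X y) * (exp (t * F j h) * exp (t\<^sup>2 * s (Suc j))) \<partial>K j h)"
        unfolding ev_1[OF ub h] X_def
        by (rule Bochner_Integration.integral_cong) (simp_all add: algebra_simps flip: exp_add)
      also have "\<dots> = (\<integral>y. exp (t * X y) \<partial>K j h) * (exp (t * F j h) * exp (t\<^sup>2 * s (Suc j)))"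
        by simp
      also have "\<dots> \<le> exp (t\<^sup>2 * (B * D * \<theta> (Suc j) n)\<^sup>2 / 2) * (exp (t * F j h) * exp (t\<^sup>2 * s (Suc j)))"
        by (intro mult_right_mono Hoeffding_exponential_moment[OF K(1) X X0]) auto
      also have "\<dots> = exp (t * F j h + t\<^sup>2 * ((B * D * \<theta> (Suc j) n)\<^sup>2 / 2 + s (Suc j)))"
        by (simp add: algebra_simps flip: exp_add)
      also have "(B * D * \<theta> (Suc j) n)\<^sup>2 / 2 + s (Suc j) = s j"
      proof -
        have "{j<..n} = insert (Suc j) {Suc j<..n}" using j by auto
        then show ?thesis by (simp add: s_def add_divide_distrib)
      qed
      finally show ?case .
    qed
    from this[of 0 h] h have "ev 0 n G h \<le> exp (t * F 0 h + t\<^sup>2 * s 0)" by simp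
    also have "\<dots> \<le> exp (t * F 0 h + t\<^sup>2 * B\<^sup>2 * D\<^sup>2 / (real n + 1))"
    proof -
      have "s 0 = (B * D)\<^sup>2 * (\<Sum>q\<in>{0<..n}. (\<theta> q n)\<^sup>2) / 2"
        by (simp add: s_def power_mult_distrib sum_distrib_left)
      also have "\<dots> \<le> (B * D)\<^sup>2 * (2 / (real n + 1)) / 2"
        by (intro divide_right_mono mult_left_mono sum_\<theta>_squares) auto
      also have "\<dots> = (B * D)\<^sup>2 / (real n + 1)" by (simp add: field_simps)
      finally have "t\<^sup>2 * s 0 \<le> t\<^sup>2 * ((B * D)\<^sup>2 / (real n + 1))"
        by (intro mult_left_mono) auto
      then show ?thesis by (simp add: power_mult_distrib mult.assoc)
    qed
    finally show ?thesis by (simp add: F_def G_def)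
  qed
  moreover have "0 \<le> D\<^sup>2" by simp
  ultimately show ?thesis by blast
qed

lemma concentration_abs:
  "\<exists>C\<ge>0. \<forall>B f n h t. bounded_by Em B f \<longrightarrow> h \<in> space Hs \<longrightarrow> 0 \<le> t \<longrightarrow>
    ev 0 n (\<lambda>h'. exp (t * (sqrt (real n + 1) * \<bar>avg n f h' - ev 0 n (avg n f) h\<bar>))) h \<le> 2 * exp (t\<^sup>2 * B\<^sup>2 * C)"
proof -
  obtain C where C: "0 \<le> C" "\<And>B f n h t. bounded_by Em B f \<Longrightarrow> h \<in> space Hs \<Longrightarrow>
    ev 0 n (\<lambda>h. exp (t * avg n f h)) h \<le> exp (t * ev 0 n (avg n f) h + t\<^sup>2 * B\<^sup>2 * C / (real n + 1))"
    using concentration by blast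
  have "ev 0 n (\<lambda>h'. exp (t * (sqrt (real n + 1) * \<bar>avg n f h' - ev 0 n (avg n f) h\<bar>))) h \<le> 2 * exp (t\<^sup>2 * B\<^sup>2 * C)"
    if f: "bounded_by Em B f" and h: "h \<in> space Hs" and t: "0 \<le> t" for B f n h t
  proof -
    define a where "a = ev 0 n (avg n f) h"
    define u where "u = t * sqrt (real n + 1)"
    have u2: "u\<^sup>2 = t\<^sup>2 * (real n + 1)" by (simp add: u_def power_mult_distrib)
    have bd: "bounded_by Hs (exp (\<bar>v\<bar> * B) * exp (- v * a)) (\<lambda>h'. exp (v * avg n f h') * exp (- v * a))" for v
      using ev_exp_bounded[OF avg_bounded[OF f, of n], of v] by (auto simp: bounded_by_def abs_mult)
    have one: "ev 0 n (\<lambda>h'. exp (v * avg n f h') * exp (- v * a)) h \<le> exp (t\<^sup>2 * B\<^sup>2 * C)" if "v\<^sup>2 = u\<^sup>2" for v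
    proof -
      have "ev 0 n (\<lambda>h'. exp (v * avg n f h') * exp (- v * a)) h = ev 0 n (\<lambda>h'. exp (v * avg n f h')) h * exp (- v * a)"
        unfolding ev_def by simp
      also have "\<dots> \<le> exp (v * a + v\<^sup>2 * B\<^sup>2 * C / (real n + 1)) * exp (- v * a)"
        unfolding a_def by (intro mult_right_mono C(2)[OF f h]) simp
      also have "\<dots> = exp (v\<^sup>2 * B\<^sup>2 * C / (real n + 1))" by (simp flip: exp_add)
      also have "v\<^sup>2 * B\<^sup>2 * C / (real n + 1) = t\<^sup>2 * B\<^sup>2 * C" using that u2 by simp
      finally show ?thesis .
    qed
    have sum_bd: "bounded_by Hs (exp (\<bar>u\<bar> * B) * exp (- u * a) + exp (\<bar>- u\<bar> * B) * exp (- (- u) * a))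
        (\<lambda>h'. exp (u * avg n f h') * exp (- u * a) + exp (- u * avg n f h') * exp (- (- u) * a))"
      by (rule bounded_by_add[OF bd bd])
    have abs_bd: "bounded_by Hs (exp (\<bar>u\<bar> * (B + \<bar>a\<bar>))) (\<lambda>h'. exp (u * \<bar>avg n f h' - a\<bar>))"
    proof (rule ev_exp_bounded)
      show "bounded_by Hs (B + \<bar>a\<bar>) (\<lambda>h'. \<bar>avg n f h' - a\<bar>)"
        using avg_bounded[OF f, of n] by (fastforce simp: bounded_by_def)
    qed
    have "ev 0 n (\<lambda>h'. exp (u * \<bar>avg n f h' - a\<bar>)) h
        \<le> ev 0 n (\<lambda>h'. exp (u * avg n f h') * exp (- u * a) + exp (- u * avg n f h') * exp (- (- u) * a)) h"
    proof (rule ev_mono[OF abs_bd sum_bd h])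
      fix h' assume "h' \<in> space Hs"
      show "exp (u * \<bar>avg n f h' - a\<bar>)
          \<le> exp (u * avg n f h') * exp (- u * a) + exp (- u * avg n f h') * exp (- (- u) * a)"
        by (cases "0 \<le> avg n f h' - a") (simp_all add: algebra_simps flip: exp_add)
    qed
    also have "\<dots> = ev 0 n (\<lambda>h'. exp (u * avg n f h') * exp (- u * a)) h
        + ev 0 n (\<lambda>h'. exp (- u * avg n f h') * exp (- (- u) * a)) h"
      unfolding ev_def by (rule Bochner_Integration.integral_add[OF ev_integrable[OF bd h] ev_integrable[OF bd h]])
    also have "\<dots> \<le> 2 * exp (t\<^sup>2 * B\<^sup>2 * C)"
      using one[of u] one[of "- u"] by simp
    finally show ?thesis by (simp add: u_def a_def mult.assoc)
  qed
  with C(1) show ?thesis by blast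
qed

end



section \<open>Asymptotic independence of the levels\<close>

text \<open>
  Under a product law, the difference between \<open>g y y\<close> and its decoupled mean (which is \<open>0\<close>) is a
  covariance.  If coordinate \<open>l\<close> of the first argument is the only one that matters, up to \<open>b1\<close>, then
  only the dependence of the second argument on the same coordinate can contribute, and it does so
  through the mixed difference bounded by \<open>b2\<close>.
\<close>

lemma PiM_decouple:
  fixes g :: "('i \<Rightarrow> 'a) \<Rightarrow> ('i \<Rightarrow> 'a) \<Rightarrow> real"
  assumes I: "finite I" and A: "\<And>i. i \<in> I \<Longrightarrow> prob_space (A i)" and l: "l \<in> I"
    and g: "bounded_by (PiM I A \<Otimes>\<^sub>M PiM I A) C (\<lambda>(x, y). g x y)"
    and zero: "\<And>x. x \<in> space (PiM I A) \<Longrightarrow> (\<integral>y. g x y \<partial>PiM I A) = 0"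
    and yr: "yr \<in> space (PiM I A)"
    and b1: "\<And>y. y \<in> space (PiM I A) \<Longrightarrow> \<bar>g y y - g (yr(l := y l)) y\<bar> \<le> b1"
    and b2: "\<And>y w. y \<in> space (PiM I A) \<Longrightarrow> w \<in> space (A l) \<Longrightarrow>
      \<bar>(g (yr(l := w)) (y(l := w)) - g yr (y(l := w))) - (g (yr(l := w)) y - g yr y)\<bar> \<le> b2"
  shows "\<bar>\<integral>y. g y y \<partial>PiM I A\<bar> \<le> b1 + b2"
proof -
  let ?K = "PiM I A"
  have K: "?K \<in> prob_measures ?K" and Al: "A l \<in> prob_measures (A l)"
    using prob_space_PiM_on[OF A] A[OF l] by (simp_all add: space_prob_algebra)
  have upd: "(\<lambda>(y, z). y(l := z)) \<in> ?K \<Otimes>\<^sub>M A l \<rightarrow>\<^sub>M ?K" by (rule measurable_fun_upd_PiM[OF l])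
  have upd0: "(\<lambda>z. yr(l := z)) \<in> A l \<rightarrow>\<^sub>M ?K"
    using measurable_compose[OF measurable_Pair1'[OF yr] upd] by simp
  have coord: "(\<lambda>y. y l) \<in> ?K \<rightarrow>\<^sub>M A l" using l by (rule measurable_component_singleton)
  have updc: "(\<lambda>y. yr(l := y l)) \<in> ?K \<rightarrow>\<^sub>M ?K" by (rule measurable_compose[OF coord upd0])
  have gm: "bounded_by R C (\<lambda>r. g (a r) (b r))" if "a \<in> R \<rightarrow>\<^sub>M ?K" "b \<in> R \<rightarrow>\<^sub>M ?K" for R a b
    using bounded_by_comp[OF g measurable_Pair[OF that]] by simp
  have g1: "bounded_by ?K C (\<lambda>y. g y y)" by (rule gm) auto
  have g2: "bounded_by ?K C (\<lambda>y. g (yr(l := y l)) y)" by (rule gm[OF updc]) auto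
  have u: "(\<lambda>p. (fst p)(l := snd p)) \<in> ?K \<Otimes>\<^sub>M A l \<rightarrow>\<^sub>M ?K" using upd by (simp add: case_prod_beta')
  have u0: "(\<lambda>p. yr(l := snd p)) \<in> ?K \<Otimes>\<^sub>M A l \<rightarrow>\<^sub>M ?K" by (rule measurable_compose[OF measurable_snd upd0])
  have c0: "(\<lambda>p. yr) \<in> ?K \<Otimes>\<^sub>M A l \<rightarrow>\<^sub>M ?K" using yr by simp
  have h1: "bounded_by (?K \<Otimes>\<^sub>M A l) C (\<lambda>(y, w). g (yr(l := w)) (y(l := w)))"
    using gm[OF u0 u] by (simp add: case_prod_beta')
  have h2: "bounded_by (?K \<Otimes>\<^sub>M A l) C (\<lambda>(y, w). g yr (y(l := w)))"
    using gm[OF c0 u] by (simp add: case_prod_beta')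
  have h3: "bounded_by (?K \<Otimes>\<^sub>M A l) C (\<lambda>(y, w). g (yr(l := w)) y)"
    using gm[OF u0 measurable_fst] by (simp add: case_prod_beta')
  have sect: "bounded_by (A l) C (\<lambda>w. f y w)" if "bounded_by (?K \<Otimes>\<^sub>M A l) C (\<lambda>(y, w). f y w)" "y \<in> space ?K" for f y
    using bounded_by_comp[OF that(1) measurable_Pair1'[OF that(2)]] by simp
  have outer: "bounded_by ?K C (\<lambda>y. \<integral>w. f y w \<partial>A l)" if "bounded_by (?K \<Otimes>\<^sub>M A l) C (\<lambda>(y, w). f y w)" for f
    by (rule bounded_by_kernel_integral[OF that]) (use Al in simp)
  have resample: "(\<integral>y. f y \<partial>?K) = (\<integral>y. (\<integral>w. f (y(l := w)) \<partial>A l) \<partial>?K)" if "bounded_by ?K C f" for f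
    using integral_PiM_resample(1)[OF I A l A[OF l] refl bounded_by_measurable[OF that] bounded_by_abs[OF that]] by simp
  have gy0: "bounded_by ?K C (\<lambda>y. g yr y)" by (rule gm) (use yr in auto)
  have i1: "(\<integral>y. g (yr(l := y l)) y \<partial>?K) = (\<integral>y. (\<integral>w. g (yr(l := w)) (y(l := w)) \<partial>A l) \<partial>?K)"
    using resample[OF g2] by simp
  have i2: "(\<integral>y. (\<integral>w. g yr (y(l := w)) \<partial>A l) \<partial>?K) = 0"
    using resample[OF gy0] zero[OF yr] by simp
  have i3: "(\<integral>y. (\<integral>w. g (yr(l := w)) y \<partial>A l) \<partial>?K) = 0"
  proof -
    have "(\<integral>y. (\<integral>w. g (yr(l := w)) y \<partial>A l) \<partial>?K) = (\<integral>w. (\<integral>y. g (yr(l := w)) y \<partial>?K) \<partial>A l)"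
      by (rule Fubini_bounded[OF h3 K Al])
    also have "\<dots> = (\<integral>w. 0 \<partial>A l)"
      by (rule Bochner_Integration.integral_cong) (use zero measurable_space[OF upd0] in auto)
    finally show ?thesis by simp
  qed
  have i4: "(\<integral>y. (\<integral>w. g yr y \<partial>A l) \<partial>?K) = 0"
    using zero[OF yr] A[OF l] by (simp add: prob_space.prob_space)
  \<comment> \<open>The last three of the four terms of \<open>q\<close> have integral zero.\<close>
  define q where "q y w = (g (yr(l := w)) (y(l := w)) - g yr (y(l := w))) - (g (yr(l := w)) y - g yr y)" for y w
  have h4: "bounded_by (?K \<Otimes>\<^sub>M A l) C (\<lambda>(y, w). g yr y)"
    using gm[OF c0 measurable_fst] by (simp add: case_prod_beta')
  have "(\<integral>y. (\<integral>w. q y w \<partial>A l) \<partial>?K) = (\<integral>y. ((\<integral>w. g (yr(l := w)) (y(l := w)) \<partial>A l) - (\<integral>w. g yr (y(l := w)) \<partial>A l))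
      - ((\<integral>w. g (yr(l := w)) y \<partial>A l) - (\<integral>w. g yr y \<partial>A l)) \<partial>?K)"
  proof (rule Bochner_Integration.integral_cong[OF refl])
    fix y assume y: "y \<in> space ?K"
    note int = bounded_by_integrable[OF sect[OF _ y] Al]
    show "(\<integral>w. q y w \<partial>A l) = ((\<integral>w. g (yr(l := w)) (y(l := w)) \<partial>A l) - (\<integral>w. g yr (y(l := w)) \<partial>A l))
      - ((\<integral>w. g (yr(l := w)) y \<partial>A l) - (\<integral>w. g yr y \<partial>A l))"
      unfolding q_def
      by (simp only: Bochner_Integration.integral_diff int[OF h1] int[OF h2] int[OF h3] int[OF h4]
        Bochner_Integration.integrable_diff)
  qed
  also have "\<dots> = (\<integral>y. g (yr(l := y l)) y \<partial>?K)"
    using i1 i2 i3 i4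
    by (simp only: Bochner_Integration.integral_diff Bochner_Integration.integrable_diff
        bounded_by_integrable[OF outer[OF h1] K] bounded_by_integrable[OF outer[OF h2] K]
        bounded_by_integrable[OF outer[OF h3] K] bounded_by_integrable[OF outer[OF h4] K])
  finally have eq: "(\<integral>y. g (yr(l := y l)) y \<partial>?K) = (\<integral>y. (\<integral>w. q y w \<partial>A l) \<partial>?K)" ..
  have "\<bar>\<integral>y. (\<integral>w. q y w \<partial>A l) \<partial>?K\<bar> \<le> b2"
    using b2 unfolding q_def
    by (intro prob_space.abs_integral_le[OF prob_space_PiM_on[OF A]] prob_space.abs_integral_le[OF A[OF l]])
  moreover have "\<bar>(\<integral>y. g y y \<partial>?K) - (\<integral>y. g (yr(l := y l)) y \<partial>?K)\<bar> \<le> b1"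
    by (rule bounded_by_integral_diff_le[OF g1 g2 K b1])
  ultimately show ?thesis unfolding eq by linarith
qed

context triangular_chain
begin

text \<open>The law of all levels but \<open>l\<close>, tested on the section of \<open>\<phi>\<close> at \<open>z\<close>.\<close>

definition others :: "((nat \<Rightarrow> 'a) \<Rightarrow> real) \<Rightarrow> nat \<Rightarrow> nat \<Rightarrow> nat \<Rightarrow> (nat \<Rightarrow> nat \<Rightarrow> 'a) \<Rightarrow> 'a \<Rightarrow> real"
  where "others \<phi> l p j h z = ev j (p - j) (\<lambda>h'. \<phi> ((h' p)(l := z))) h"

text \<open>
  Two independent copies of the path start from the history \<open>h\<close> at time \<open>j\<close>; at time \<open>p\<close> level \<open>l\<close> is
  read from one of them, and the other levels from the other.  For \<open>j = p\<close> this is \<open>\<phi> (h p)\<close>, so that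
  increasing \<open>j\<close> from \<open>0\<close> to \<open>p\<close> moves from independent levels to the true state.
\<close>

definition decoupled :: "((nat \<Rightarrow> 'a) \<Rightarrow> real) \<Rightarrow> nat \<Rightarrow> nat \<Rightarrow> nat \<Rightarrow> (nat \<Rightarrow> nat \<Rightarrow> 'a) \<Rightarrow> real"
  where "decoupled \<phi> l p j h = ev j (p - j) (\<lambda>h'. others \<phi> l p j h (h' p l)) h"

lemma section_bounded:
  assumes \<phi>: "bounded_by Em B \<phi>" and l: "l \<le> m" and z: "z \<in> space (S l)"
  shows "bounded_by Em B (\<lambda>x. \<phi> (x(l := z)))"
proof -
  have "(\<lambda>x. x(l := z)) \<in> Em \<rightarrow>\<^sub>M Em"
    using measurable_compose[OF measurable_Pair2'[OF z, of Em] measurable_Em_upd[OF l]] by simp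
  from bounded_by_comp[OF \<phi> this] show ?thesis .
qed

lemma level_fun_bounded: "bounded_by (S l) B g \<Longrightarrow> l \<le> m \<Longrightarrow> bounded_by Em B (\<lambda>x. g (x l))"
  by (rule bounded_by_comp[OF _ measurable_Em_coord])

lemma others_bounded:
  assumes \<phi>: "bounded_by Em B \<phi>" and l: "l \<le> m"
  shows "bounded_by (Hs \<Otimes>\<^sub>M S l) B (\<lambda>(h, z). others \<phi> l p j h z)"
proof -
  have "(\<lambda>q. (snd q p)(l := snd (fst q))) \<in> (Hs \<Otimes>\<^sub>M S l) \<Otimes>\<^sub>M Hs \<rightarrow>\<^sub>M Em"
    using measurable_compose[OF measurable_Pair[OF measurable_compose[OF measurable_snd measurable_Hs_coord]
      measurable_compose[OF measurable_fst measurable_snd]] measurable_Em_upd[OF l]] by simp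
  from bounded_by_comp[OF \<phi> this]
  have "bounded_by ((Hs \<Otimes>\<^sub>M S l) \<Otimes>\<^sub>M Hs) B (\<lambda>(q, h'). \<phi> ((h' p)(l := snd q)))"
    by (simp add: case_prod_beta')
  from bounded_by_kernel_integral[OF this measurable_compose[OF measurable_fst measurable_run]]
  show ?thesis by (simp add: others_def ev_def case_prod_beta')
qed

lemma others_bounded':
  assumes \<phi>: "bounded_by Em B \<phi>" and l: "l \<le> m" and h: "h \<in> space Hs"
  shows "bounded_by (S l) B (others \<phi> l p j h)"
  using bounded_by_comp[OF others_bounded[OF \<phi> l] measurable_Pair1'[OF h]] by simp

lemma decoupled_bounded:
  assumes \<phi>: "bounded_by Em B \<phi>" and l: "l \<le> m"
  shows "bounded_by Hs B (decoupled \<phi> l p j)"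
proof -
  have "bounded_by (Hs \<Otimes>\<^sub>M Hs) B (\<lambda>(h, h'). others \<phi> l p j h (h' p l))"
    using bounded_by_comp[OF others_bounded[OF \<phi> l]
      measurable_Pair[OF measurable_fst measurable_compose[OF measurable_snd measurable_Hs_coord2[OF l]]]]
    by (simp add: case_prod_beta')
  from bounded_by_kernel_integral[OF this measurable_run] show ?thesis
    by (simp add: decoupled_def[abs_def] ev_def)
qed

lemma indep_section: "indep l (\<lambda>x. \<phi> (x(l := z)))"
  by (simp add: indep_def)

lemma indep_level_fun: "l' \<noteq> l \<Longrightarrow> indep l' (\<lambda>x. g (x l))"
  by (simp add: indep_def)

text \<open>
  With \<open>v\<close> the law of level \<open>l\<close> and \<open>u\<close> that of the other levels at time \<open>p\<close>, the left-hand side is the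
  covariance, over the next state \<open>y\<close>, of \<open>v\<close> and \<open>u\<close>.  Coordinate \<open>l\<close> of \<open>y\<close> is remembered directly by
  \<open>v\<close> (size \<open>\<alpha>\<close>) but only indirectly by \<open>u\<close> (size \<open>\<beta>\<close>), and conversely for the other coordinates.
  As the coordinates of \<open>y\<close> are independent, \<open>PiM_decouple\<close> yields products \<open>\<alpha> * \<beta>\<close> and never
  \<open>\<alpha> * \<alpha>\<close>, which would not be summable to a small quantity.
\<close>

lemma decoupling_step:
  assumes st: "\<And>l. l \<le> m \<Longrightarrow> stab l A E" and AE: "0 \<le> A" "0 \<le> E"
    and \<phi>: "bounded_by Em B \<phi>" and l: "l \<le> m" and h: "h \<in> space Hs" and j: "j < p"
  shows "\<bar>ev j (Suc 0) (decoupled \<phi> l p (Suc j)) h - decoupled \<phi> l p j h\<bar>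
    \<le> B * (2 * (real m + 1)\<^sup>2 * ((A * \<rho> ^ (p - Suc j) + E * \<theta> (Suc j) p) * (E * \<theta> (Suc j) p)))"
proof -
  define k where "k = p - Suc j"
  define \<alpha> where "\<alpha> = A * \<rho> ^ k + E * \<theta> (Suc j) p"
  define \<beta> where "\<beta> = E * \<theta> (Suc j) p"
  define u where "u h = others \<phi> l p (Suc j) h" for h
  define v where "v h \<psi> = ev (Suc j) k (\<lambda>h'. \<psi> (h' p l)) h" for h and \<psi> :: "'a \<Rightarrow> real"
  define ub where "ub = others \<phi> l p j h"
  define \<Delta> where "\<Delta> y z = u (h(Suc j := y)) z - ub z" for y z
  define g where "g y' y = v (h(Suc j := y')) (\<Delta> y)" for y' y
  have B: "0 \<le> B" by (rule Em_bounded_nonneg[OF \<phi>])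
  have \<beta>: "0 \<le> \<beta>" using AE \<theta>_nonneg by (simp add: \<beta>_def)
  have \<alpha>: "\<beta> \<le> \<alpha>" using AE \<rho> by (simp add: \<alpha>_def \<beta>_def)
  have jp: "Suc j \<le> p" using j by simp
  have hy: "h(Suc j := y) \<in> space Hs" if "y \<in> space Em" for y by (rule space_Hs_upd[OF h that])
  have vb: "bounded_by Hs C (\<lambda>h'. \<psi> (h' p l))" if "bounded_by (S l) C \<psi>" for C \<psi>
    by (rule bounded_by_comp[OF that measurable_Hs_coord2[OF l]])
  have v_diff: "v h (\<lambda>z. \<psi> z - \<psi>' z) = v h \<psi> - v h \<psi>'"
    if "bounded_by (S l) C \<psi>" "bounded_by (S l) C' \<psi>'" "h \<in> space Hs" for \<psi> \<psi>' C C' h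
    unfolding v_def by (rule ev_diff[OF vb[OF that(1)] vb[OF that(2)] that(3)])
  have v_coord: "\<bar>v h \<psi> - v (h(Suc j := (h (Suc j))(l' := z))) \<psi>\<bar> \<le> C * (if l' = l then \<alpha> else \<beta>)"
    if \<psi>: "bounded_by (S l) C \<psi>" and l': "l' \<le> m" and "h \<in> space Hs" "z \<in> space (S l')" for C \<psi> l' h z
  proof -
    have C: "0 \<le> C" using bounded_by_nonneg[OF \<psi> space_S[OF l]] .
    have "\<bar>v h \<psi> - v (h(Suc j := (h (Suc j))(l' := z))) \<psi>\<bar>
        \<le> C * ((if indep l' (\<lambda>x. \<psi> (x l)) then 0 else A * \<rho> ^ k) + E * \<theta> (Suc j) p)"
      unfolding v_def k_def by (rule stab_osc[OF st[OF l'] l' level_fun_bounded[OF \<psi> l] jp that(3,4)])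
    also have "\<dots> \<le> C * (if l' = l then \<alpha> else \<beta>)"
      using C indep_level_fun[of l' l \<psi>] AE \<rho> by (intro mult_left_mono) (auto simp: \<alpha>_def \<beta>_def)
    finally show ?thesis .
  qed
  have u_coord: "\<bar>u h z - u (h(Suc j := (h (Suc j))(l' := w))) z\<bar> \<le> B * (if l' = l then \<beta> else \<alpha>)"
    if l': "l' \<le> m" and "h \<in> space Hs" "w \<in> space (S l')" and z: "z \<in> space (S l)" for l' h w z
  proof -
    have "\<bar>u h z - u (h(Suc j := (h (Suc j))(l' := w))) z\<bar>
        \<le> B * ((if indep l' (\<lambda>x. \<phi> (x(l := z))) then 0 else A * \<rho> ^ k) + E * \<theta> (Suc j) p)"
      unfolding u_def others_def k_def
      by (rule stab_osc[OF st[OF l'] l' section_bounded[OF \<phi> l z] jp that(2,3)])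
    also have "\<dots> \<le> B * (if l' = l then \<beta> else \<alpha>)"
      using B indep_section[of l \<phi> z] AE \<rho> by (intro mult_left_mono) (auto simp: \<alpha>_def \<beta>_def)
    finally show ?thesis .
  qed
  have u_all: "\<bar>u h z - u (h(Suc j := x)) z\<bar> \<le> (real m + 1) * (B * \<alpha>)"
    if "h \<in> space Hs" "x \<in> space Em" "z \<in> space (S l)" for h x z
  proof -
    have "\<bar>u h z - u (h(Suc j := x)) z\<bar> \<le> (\<Sum>l'\<le>m. B * (if l' = l then \<beta> else \<alpha>))"
      by (rule state_change[where F = "\<lambda>h. u h z", OF _ that(1,2)]) (rule u_coord[OF _ _ _ that(3)])
    also have "\<dots> \<le> (\<Sum>l'\<le>m. B * \<alpha>)" using B \<alpha> by (intro sum_mono mult_left_mono) auto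
    finally show ?thesis by (simp add: add.commute)
  qed
  have ubar: "bounded_by (S l) B (u h)" if "h \<in> space Hs" for h
    unfolding u_def by (rule others_bounded'[OF \<phi> l that])
  have ubb: "bounded_by (S l) B ub" unfolding ub_def by (rule others_bounded'[OF \<phi> l h])
  have u_meas: "bounded_by Em B (\<lambda>y. u (h(Suc j := y)) z)" if z: "z \<in> space (S l)" for z
    unfolding u_def others_def
    by (rule bounded_by_comp[OF ev_bounded_by[OF state_fun_bounded[OF section_bounded[OF \<phi> l z]]] measurable_Hs_upd'[OF h]])
  have ub_eq: "ub z = (\<integral>y. u (h(Suc j := y)) z \<partial>K j h)" if z: "z \<in> space (S l)" for z
    unfolding ub_def u_def others_def
    using ev_split_first[OF state_fun_bounded[OF section_bounded[OF \<phi> l z]] h j]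
      ev_1[OF ev_bounded_by[OF state_fun_bounded[OF section_bounded[OF \<phi> l z]]] h] by simp
  have Kp: "prob_space (K j h)" "sets (K j h) = sets Em" "space (K j h) = space Em"
    using K_prob[OF h, of j] by (auto simp: space_prob_algebra dest: sets_eq_imp_space_eq)
  interpret Kp: prob_space "K j h" by fact
  have \<Delta>_le: "\<bar>\<Delta> y z\<bar> \<le> (real m + 1) * (B * \<alpha>)" if y: "y \<in> space Em" and z: "z \<in> space (S l)" for y z
  proof -
    have "\<bar>(\<integral>y'. u (h(Suc j := y)) z \<partial>K j h) - (\<integral>y'. u (h(Suc j := y')) z \<partial>K j h)\<bar> \<le> (real m + 1) * (B * \<alpha>)"
    proof (rule Kp.abs_integral_diff_le)
      show "integrable (K j h) (\<lambda>y'. u (h(Suc j := y')) z)"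
        by (rule bounded_by_integrable[OF u_meas[OF z] K_prob[OF h]])
      fix y' assume "y' \<in> space (K j h)"
      then have "y' \<in> space Em" using Kp by simp
      from u_all[OF hy[OF y] this z]
      show "\<bar>u (h(Suc j := y)) z - u (h(Suc j := y')) z\<bar> \<le> (real m + 1) * (B * \<alpha>)" by simp
    qed simp
    then show ?thesis unfolding \<Delta>_def ub_eq[OF z] by (simp add: Kp.prob_space)
  qed
  have \<Delta>_meas: "bounded_by (S l) ((real m + 1) * (B * \<alpha>)) (\<Delta> y)" if y: "y \<in> space Em" for y
    using bounded_by_diff[OF ubar[OF hy[OF y]] ubb] \<Delta>_le[OF y] unfolding \<Delta>_def[abs_def]
    by (auto simp: bounded_by_def)
  have \<Delta>_pair: "bounded_by (Em \<Otimes>\<^sub>M S l) (B + B) (\<lambda>(y, z). \<Delta> y z)"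
  proof -
    have m1: "(\<lambda>q. (h(Suc j := fst q), snd q)) \<in> Em \<Otimes>\<^sub>M S l \<rightarrow>\<^sub>M Hs \<Otimes>\<^sub>M S l"
      by (rule measurable_Pair[OF measurable_compose[OF measurable_fst measurable_Hs_upd'[OF h]] measurable_snd])
    show ?thesis
      using bounded_by_diff[OF bounded_by_comp[OF others_bounded[OF \<phi> l, of p "Suc j"] m1] bounded_by_comp[OF ubb measurable_snd]]
      by (simp add: \<Delta>_def u_def case_prod_beta')
  qed
  have g_pair: "bounded_by (Em \<Otimes>\<^sub>M Em) (B + B) (\<lambda>(y', y). g y' y)"
  proof -
    have m1: "(\<lambda>q. (snd (fst q), snd q p l)) \<in> (Em \<Otimes>\<^sub>M Em) \<Otimes>\<^sub>M Hs \<rightarrow>\<^sub>M Em \<Otimes>\<^sub>M S l"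
      by (rule measurable_Pair[OF measurable_compose[OF measurable_fst measurable_snd]
        measurable_compose[OF measurable_snd measurable_Hs_coord2[OF l]]])
    have m2: "(\<lambda>q. run (Suc j) k (h(Suc j := fst q))) \<in> Em \<Otimes>\<^sub>M Em \<rightarrow>\<^sub>M prob_algebra Hs"
      by (rule measurable_compose[OF measurable_compose[OF measurable_fst measurable_Hs_upd'[OF h]] measurable_run])
    have "bounded_by ((Em \<Otimes>\<^sub>M Em) \<Otimes>\<^sub>M Hs) (B + B) (\<lambda>(q, h'). \<Delta> (snd q) (h' p l))"
      using bounded_by_comp[OF \<Delta>_pair m1] by (simp add: case_prod_beta')
    from bounded_by_kernel_integral[OF this m2] show ?thesis
      by (simp add: g_def v_def ev_def case_prod_beta')
  qed
  define Af where "Af = (\<lambda>l'. lk l' j h)"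
  have pA: "prob_space (Af l')" "sets (Af l') = sets (S l')" if "l' \<le> m" for l'
    using lk_prob[OF h that, of j] by (auto simp: Af_def space_prob_algebra)
  have KA: "K j h = PiM {..m} Af" by (simp add: K_def Af_def)
  have sA: "sets (PiM {..m} Af) = sets Em" and spA: "space (PiM {..m} Af) = space Em"
    using Kp unfolding KA by auto
  have hj: "h j \<in> space Em" by (rule space_Hs_coord[OF h])
  have "\<bar>\<integral>y. g y y \<partial>PiM {..m} Af\<bar> \<le> (real m + 1)\<^sup>2 * (B * \<alpha>) * \<beta> + (B * \<beta>) * \<alpha>"
  proof (rule PiM_decouple[where g = g and l = l and yr = "h j" and C = "B + B"])
    show "bounded_by (PiM {..m} Af \<Otimes>\<^sub>M PiM {..m} Af) (B + B) (\<lambda>(x, y). g x y)"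
      using g_pair sA by (auto simp: bounded_by_def space_pair_measure spA cong: measurable_cong_sets)
  next
    fix y' assume "y' \<in> space (PiM {..m} Af)"
    then have y': "y' \<in> space Em" using spA by simp
    have sw: "bounded_by (Em \<Otimes>\<^sub>M Hs) (B + B) (\<lambda>(y, h'). \<Delta> y (h' p l))"
      using bounded_by_comp[OF \<Delta>_pair measurable_Pair[OF measurable_fst measurable_compose[OF measurable_snd measurable_Hs_coord2[OF l]]]]
      by (simp add: case_prod_beta')
    have "(\<integral>y. g y' y \<partial>K j h) = (\<integral>h'. (\<integral>y. \<Delta> y (h' p l) \<partial>K j h) \<partial>run (Suc j) k (h(Suc j := y')))"
      unfolding g_def v_def ev_def by (rule Fubini_bounded[OF sw K_prob[OF h] run_prob[OF hy[OF y']]])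
    also have "\<dots> = (\<integral>h'. 0 \<partial>run (Suc j) k (h(Suc j := y')))"
    proof (rule Bochner_Integration.integral_cong[OF refl])
      fix h' assume "h' \<in> space (run (Suc j) k (h(Suc j := y')))"
      then have "h' \<in> space Hs"
        using run_prob[OF hy[OF y']] by (auto simp: space_prob_algebra dest: sets_eq_imp_space_eq)
      then have z: "h' p l \<in> space (S l)" by (rule space_Hs_coord2[OF _ l])
      show "(\<integral>y. \<Delta> y (h' p l) \<partial>K j h) = 0"
        unfolding \<Delta>_def using bounded_by_integrable[OF u_meas[OF z] K_prob[OF h, of j]] ub_eq[OF z]
        by (simp add: Kp.prob_space)
    qed
    finally show "(\<integral>y. g y' y \<partial>PiM {..m} Af) = 0" unfolding KA by simp
  next
    show "h j \<in> space (PiM {..m} Af)" using hj spA by simp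
  next
    fix y assume "y \<in> space (PiM {..m} Af)"
    then have y: "y \<in> space Em" using spA by simp
    have yl: "y l \<in> space (S l)" by (rule space_Em_coord[OF y l])
    define F where "F h' = v (h'(Suc j := (h' (Suc j))(l := y l))) (\<Delta> y)" for h' :: "nat \<Rightarrow> nat \<Rightarrow> 'a"
    have "\<bar>F (h(Suc j := y)) - F ((h(Suc j := y))(Suc j := h j))\<bar> \<le> (\<Sum>l'\<le>m. (real m + 1) * (B * \<alpha>) * \<beta>)"
    proof (rule state_change[OF _ hy[OF y] hj])
      fix l' h' z assume l': "l' \<le> m" and h': "h' \<in> space Hs" and z: "z \<in> space (S l')"
      show "\<bar>F h' - F (h'(Suc j := (h' (Suc j))(l' := z)))\<bar> \<le> (real m + 1) * (B * \<alpha>) * \<beta>"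
      proof (cases "l' = l")
        case True
        then show ?thesis using B \<alpha> \<beta> by (simp add: F_def)
      next
        case False
        define h'' where "h'' = h'(Suc j := (h' (Suc j))(l := y l))"
        have h'': "h'' \<in> space Hs" unfolding h''_def by (rule space_Hs_upd2[OF h' l yl])
        have "F (h'(Suc j := (h' (Suc j))(l' := z))) = v (h''(Suc j := (h'' (Suc j))(l' := z))) (\<Delta> y)"
          using False by (simp add: F_def h''_def fun_upd_twist)
        with v_coord[OF \<Delta>_meas[OF y] l' h'' z] False show ?thesis
          by (simp add: F_def h''_def)
      qed
    qed
    then show "\<bar>g y y - g ((h j)(l := y l)) y\<bar> \<le> (real m + 1)\<^sup>2 * (B * \<alpha>) * \<beta>"
      by (simp add: F_def g_def power2_eq_square algebra_simps)
  next
    fix y w assume "y \<in> space (PiM {..m} Af)" and "w \<in> space (Af l)"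
    then have y: "y \<in> space Em" and w: "w \<in> space (S l)"
      using spA sets_eq_imp_space_eq[OF pA(2)[OF l]] by auto
    have yw: "y(l := w) \<in> space Em" by (rule space_Em_upd[OF y l w])
    have hw: "(h j)(l := w) \<in> space Em" by (rule space_Em_upd[OF hj l w])
    define \<psi> where "\<psi> z = \<Delta> (y(l := w)) z - \<Delta> y z" for z
    have \<psi>: "bounded_by (S l) (B * \<beta>) \<psi>"
    proof (rule bounded_byI)
      show "\<psi> \<in> borel_measurable (S l)"
        unfolding \<psi>_def[abs_def]
        by (intro borel_measurable_diff bounded_by_measurable[OF \<Delta>_meas[OF yw]] bounded_by_measurable[OF \<Delta>_meas[OF y]])
      fix z assume z: "z \<in> space (S l)"
      show "\<bar>\<psi> z\<bar> \<le> B * \<beta>"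
        using u_coord[OF l hy[OF y] w z] by (simp add: \<psi>_def \<Delta>_def abs_minus_commute)
    qed
    have d: "g x (y(l := w)) - g x y = v (h(Suc j := x)) \<psi>" if "x \<in> space Em" for x
      unfolding g_def \<psi>_def by (rule v_diff[OF \<Delta>_meas[OF yw] \<Delta>_meas[OF y] hy[OF that], symmetric])
    have "\<bar>v (h(Suc j := h j)) \<psi> - v (h(Suc j := (h j)(l := w))) \<psi>\<bar> \<le> (B * \<beta>) * \<alpha>"
      using v_coord[OF \<psi> l hy[OF hj] w] by simp
    then show "\<bar>(g ((h j)(l := w)) (y(l := w)) - g (h j) (y(l := w))) - (g ((h j)(l := w)) y - g (h j) y)\<bar> \<le> (B * \<beta>) * \<alpha>"
      using d[OF hj] d[OF hw] by linarith
  qed (use pA l in auto)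
  moreover have "ev j (Suc 0) (decoupled \<phi> l p (Suc j)) h - decoupled \<phi> l p j h = (\<integral>y. g y y \<partial>K j h)"
  proof -
    have D1: "bounded_by Em B (\<lambda>y. decoupled \<phi> l p (Suc j) (h(Suc j := y)))"
      by (rule bounded_by_comp[OF decoupled_bounded[OF \<phi> l] measurable_Hs_upd'[OF h]])
    have D2: "bounded_by Em B (\<lambda>y. v (h(Suc j := y)) ub)"
      unfolding v_def by (rule bounded_by_comp[OF ev_bounded_by[OF vb[OF ubb]] measurable_Hs_upd'[OF h]])
    have "decoupled \<phi> l p j h = (\<integral>y. v (h(Suc j := y)) ub \<partial>K j h)"
      unfolding decoupled_def ub_def[symmetric] v_def k_def
      using ev_split_first[OF vb[OF ubb] h j] ev_1[OF ev_bounded_by[OF vb[OF ubb]] h] by simp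
    then have "ev j (Suc 0) (decoupled \<phi> l p (Suc j)) h - decoupled \<phi> l p j h
        = (\<integral>y. decoupled \<phi> l p (Suc j) (h(Suc j := y)) - v (h(Suc j := y)) ub \<partial>K j h)"
      unfolding ev_1[OF decoupled_bounded[OF \<phi> l] h]
      using bounded_by_integrable[OF D1 K_prob[OF h, of j]] bounded_by_integrable[OF D2 K_prob[OF h, of j]] by simp
    also have "\<dots> = (\<integral>y. g y y \<partial>K j h)"
    proof (rule Bochner_Integration.integral_cong[OF refl])
      fix y assume "y \<in> space (K j h)"
      then have y: "y \<in> space Em" using Kp by simp
      show "decoupled \<phi> l p (Suc j) (h(Suc j := y)) - v (h(Suc j := y)) ub = g y y"
        unfolding g_def \<Delta>_def using v_diff[OF ubar[OF hy[OF y]] ubb hy[OF y]]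
        by (simp add: decoupled_def u_def v_def k_def)
    qed
    finally show ?thesis .
  qed
  moreover have "(real m + 1)\<^sup>2 * (B * \<alpha>) * \<beta> + (B * \<beta>) * \<alpha> \<le> B * (2 * (real m + 1)\<^sup>2 * (\<alpha> * \<beta>))"
  proof -
    have "1 * (B * \<beta> * \<alpha>) \<le> (real m + 1)\<^sup>2 * (B * \<beta> * \<alpha>)"
      using B \<alpha> \<beta> by (intro mult_right_mono) auto
    then show ?thesis by (simp add: algebra_simps)
  qed
  ultimately show ?thesis unfolding KA[symmetric] \<alpha>_def \<beta>_def k_def by linarith
qed

lemma decoupling:
  "\<exists>C\<ge>0. \<forall>B \<phi> l p h. bounded_by Em B \<phi> \<longrightarrow> l \<le> m \<longrightarrow> h \<in> space Hs \<longrightarrow>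
    \<bar>ev 0 p (\<lambda>h'. \<phi> (h' p)) h - decoupled \<phi> l p 0 h\<bar> \<le> B * C / sqrt (real p + 1)"
proof -
  obtain A E where AE: "0 \<le> A" "0 \<le> E" and st: "\<And>l. l \<le> m \<Longrightarrow> stab l A E" using stability by blast
  define C where "C = 2 * (real m + 1)\<^sup>2 * (A * E / (1 - \<rho>) + 2 * E\<^sup>2)"
  have C: "0 \<le> C" using AE \<rho> by (simp add: C_def)
  have "\<bar>ev 0 p (\<lambda>h'. \<phi> (h' p)) h - decoupled \<phi> l p 0 h\<bar> \<le> B * C / sqrt (real p + 1)"
    if \<phi>: "bounded_by Em B \<phi>" and l: "l \<le> m" and h: "h \<in> space Hs" for B \<phi> l p h
  proof -
    define D where "D = decoupled \<phi> l p"
    define \<epsilon> where "\<epsilon> j = B * (2 * (real m + 1)\<^sup>2 * ((A * \<rho> ^ (p - Suc j) + E * \<theta> (Suc j) p) * (E * \<theta> (Suc j) p)))" for j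
    have B: "0 \<le> B" by (rule Em_bounded_nonneg[OF \<phi>])
    have D: "bounded_by Hs B (D j)" for j unfolding D_def by (rule decoupled_bounded[OF \<phi> l])
    have tele: "\<bar>ev 0 i (D i) h - D 0 h\<bar> \<le> (\<Sum>j<i. \<epsilon> j)" if "i \<le> p" for i
      using that
    proof (induction i)
      case 0
      then show ?case using ev_0[OF D h] by simp
    next
      case (Suc i)
      have "ev 0 (Suc i) (D (Suc i)) h = ev 0 i (ev i (Suc 0) (D (Suc i))) h"
        using ev_Suc_right[OF D h, of 0 i] by simp
      moreover have "\<bar>ev 0 i (ev i (Suc 0) (D (Suc i))) h - ev 0 i (D i) h\<bar> \<le> \<epsilon> i"
        using decoupling_step[OF st AE \<phi> l _ Suc_le_lessD[OF Suc.prems]]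
        by (intro ev_abs_diff_le[OF ev_bounded_by[OF D] D h]) (simp_all add: D_def \<epsilon>_def)
      ultimately show ?case using Suc.IH[OF Suc_leD[OF Suc.prems]] unfolding sum.lessThan_Suc by linarith
    qed
    have Dp: "ev 0 p (D p) h = ev 0 p (\<lambda>h'. \<phi> (h' p)) h"
    proof (rule ev_cong[OF h])
      fix h' assume h': "h' \<in> space Hs"
      have "D p h' = others \<phi> l p p h' (h' p l)"
        unfolding D_def decoupled_def
        using ev_0[OF state_fun_bounded[OF level_fun_bounded[OF others_bounded'[OF \<phi> l h'] l]] h'] by simp
      also have "\<dots> = \<phi> ((h' p)(l := h' p l))"
        unfolding others_def
        using ev_0[OF state_fun_bounded[OF section_bounded[OF \<phi> l space_Hs_coord2[OF h' l, of p]]] h'] by simp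
      finally show "D p h' = \<phi> (h' p)" by simp
    qed
    have \<theta>_le: "\<theta> q p \<le> 1 / sqrt (real p + 1)" for q
    proof -
      have "(real q + 1) powr (-1/4) \<le> 1 powr (-1/4)" by (intro powr_mono2') auto
      then have "\<theta> q p \<le> (real p + 1) powr (-3/4) * 1"
        unfolding \<theta>_def by (intro mult_left_mono) auto
      also have "\<dots> \<le> (real p + 1) powr (-1/2)" by (simp add: powr_mono)
      finally show ?thesis by (simp add: powr_minus_divide powr_half_sqrt)
    qed
    have "(\<Sum>j<p. \<epsilon> j) = (\<Sum>q\<in>{0<..p}. B * (2 * (real m + 1)\<^sup>2 * ((A * \<rho> ^ (p - q) + E * \<theta> q p) * (E * \<theta> q p))))"
      unfolding \<epsilon>_def by (rule sum.reindex_bij_witness[of _ "\<lambda>q. q - 1" Suc]) auto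
    also have "\<dots> = B * (2 * (real m + 1)\<^sup>2 * (A * E * (\<Sum>q\<in>{0<..p}. \<rho> ^ (p - q) * \<theta> q p) + E\<^sup>2 * (\<Sum>q\<in>{0<..p}. (\<theta> q p)\<^sup>2)))"
      by (simp add: sum_distrib_left sum.distrib power2_eq_square algebra_simps)
    also have "\<dots> \<le> B * (2 * (real m + 1)\<^sup>2 * (A * E * (1 / (1 - \<rho>) * (1 / sqrt (real p + 1))) + E\<^sup>2 * (2 * (1 / sqrt (real p + 1)))))"
    proof -
      have "(\<Sum>q\<in>{0<..p}. \<rho> ^ (p - q) * \<theta> q p) \<le> (\<Sum>q\<in>{0<..p}. \<rho> ^ (p - q) * (1 / sqrt (real p + 1)))"
        using \<theta>_le \<rho> by (intro sum_mono mult_left_mono) auto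
      also have "\<dots> = (\<Sum>k<p. \<rho> ^ k) * (1 / sqrt (real p + 1))"
        unfolding sum_distrib_right by (rule sum.reindex_bij_witness[of _ "\<lambda>k. p - k" "\<lambda>q. p - q"]) auto
      also have "\<dots> \<le> 1 / (1 - \<rho>) * (1 / sqrt (real p + 1))"
        using \<rho> by (intro mult_right_mono) (subst sum_gp_strict, auto simp: divide_right_mono)
      finally have 1: "(\<Sum>q\<in>{0<..p}. \<rho> ^ (p - q) * \<theta> q p) \<le> 1 / (1 - \<rho>) * (1 / sqrt (real p + 1))" .
      have "sqrt (real p + 1) * 1 \<le> sqrt (real p + 1) * sqrt (real p + 1)"
        by (intro mult_left_mono) auto
      then have "2 / (real p + 1) \<le> 2 * (1 / sqrt (real p + 1))"
        by (simp add: divide_left_mono)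
      then have 2: "(\<Sum>q\<in>{0<..p}. (\<theta> q p)\<^sup>2) \<le> 2 * (1 / sqrt (real p + 1))"
        using sum_\<theta>_squares[of p] by linarith
      show ?thesis using 1 2 B AE by (intro mult_left_mono add_mono) auto
    qed
    also have "\<dots> = B * C / sqrt (real p + 1)" by (simp only: C_def divide_inverse mult_1_left) (simp only: algebra_simps)
    finally show ?thesis using tele[of p] Dp by (simp add: D_def)
  qed
  with C show ?thesis by blast
qed

end



section \<open>Means of a single level\<close>

text \<open>
  The choice \<open>k = floor (p^(1/4))\<close>: the drift \<open>k^2 / p\<close> of the empirical measures over the window is
  \<open>O(p^(-1/2))\<close>, and \<open>\<kappa>^k\<close> is smaller still.
\<close>

lemma slow_window:
  fixes \<kappa> :: real
  assumes "0 < \<kappa>" "\<kappa> < 1"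
  shows "\<exists>C\<ge>0. \<forall>p::nat. \<exists>k\<le>p. (real k)\<^sup>2 / (real (p - k) + 1) \<le> C / sqrt (real p + 1) \<and>
    \<kappa> ^ k \<le> C / sqrt (real p + 1) \<and> 1 / sqrt (real (p - k) + 1) \<le> C / sqrt (real p + 1)"
proof -
  define R where "R = 1 / (1 - sqrt \<kappa>) ^ 4"
  define C where "C = max 3 R"
  have \<kappa>: "(real k + 1)\<^sup>2 * \<kappa> ^ k \<le> R" for k
  proof -
    have s: "0 < sqrt \<kappa>" "sqrt \<kappa> < 1" using assms by auto
    have "(real k + 1) * sqrt \<kappa> ^ k \<le> (\<Sum>i<Suc k. (real i + 1) * sqrt \<kappa> ^ i)"
      using s by (intro member_le_sum) auto
    also have "\<dots> \<le> 1 / (1 - sqrt \<kappa>)\<^sup>2" by (rule sum_arith_geometric_le[OF s])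
    finally have "((real k + 1) * sqrt \<kappa> ^ k)\<^sup>2 \<le> (1 / (1 - sqrt \<kappa>)\<^sup>2)\<^sup>2"
      using s by (intro power_mono) auto
    moreover have "(sqrt \<kappa> ^ k)\<^sup>2 = \<kappa> ^ k"
      using assms by (metis power_mult mult.commute real_sqrt_pow2 less_imp_le)
    ultimately show ?thesis
      by (simp add: R_def power_mult_distrib power_divide flip: power_mult)
  qed
  have "\<exists>k\<le>p. (real k)\<^sup>2 / (real (p - k) + 1) \<le> C / sqrt (real p + 1) \<and>
    \<kappa> ^ k \<le> C / sqrt (real p + 1) \<and> 1 / sqrt (real (p - k) + 1) \<le> C / sqrt (real p + 1)" for p :: nat
  \<comment> \<open>For \<open>5 \<le> p\<close> the window takes at most half of the time; below, \<open>k = 0\<close> and a large constant do.\<close>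
  proof (cases "p < 5")
    case True
    have "sqrt (real p + 1) \<le> sqrt 9" using True by (intro real_sqrt_le_mono) simp
    then have "sqrt (real p + 1) \<le> 3" by simp
    then have "1 \<le> C / sqrt (real p + 1)" by (simp add: C_def pos_le_divide_eq)
    moreover have "1 / sqrt (real (p - 0) + 1) \<le> 1" by simp
    ultimately have "1 / sqrt (real (p - 0) + 1) \<le> C / sqrt (real p + 1)" by linarith
    moreover have "0 \<le> C / sqrt (real p + 1)" by (simp add: C_def le_max_iff_disj)
    moreover have "(real 0)\<^sup>2 / (real (p - 0) + 1) = 0" "\<kappa> ^ 0 = 1" by simp_all
    ultimately show ?thesis using \<open>1 \<le> C / sqrt (real p + 1)\<close> by (metis le0)
  next
    case False
    define x where "x = real p + 1"
    define s where "s = sqrt (sqrt x)"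
    have x: "6 \<le> x" using False by (simp add: x_def)
    have s4: "s ^ 2 = sqrt x" "s ^ 4 = x" using x by (auto simp: s_def power4_eq_xxxx power2_eq_square mult.assoc)
    have s0: "0 < s" using x by (simp add: s_def)
    have s3: "2 \<le> s ^ 3"
    proof (rule ccontr)
      assume "\<not> 2 \<le> s ^ 3"
      then have *: "s ^ 3 < 2" by simp
      have "s < 3/2"
      proof (rule ccontr)
        assume "\<not> s < 3/2"
        then have "(3/2) ^ 3 \<le> s ^ 3" by (intro power_mono) auto
        with * show False by (simp add: power3_eq_cube)
      qed
      then have "s * s ^ 3 \<le> (3/2) * 2" using * s0 by (intro mult_mono) auto
      with s4 x show False by (simp add: power_def numeral_eq_Suc)
    qed
    have sx: "s \<le> x / 2"
    proof -
      have "s * 2 \<le> s * s ^ 3" using s3 s0 by (intro mult_left_mono) auto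
      then show ?thesis using s4 by (simp add: numeral_eq_Suc)
    qed
    define k where "k = nat \<lfloor>s\<rfloor>"
    have k: "real k \<le> s" "s < real k + 1"
      using s0 by (auto simp: k_def) 
    have kp: "k \<le> p"
    proof -
      have "real k < real p + 1" using k sx x by (simp add: x_def)
      then show ?thesis by simp
    qed
    have q: "x / 2 \<le> real (p - k) + 1" using k sx kp by (simp add: x_def of_nat_diff)
    have sq: "0 < sqrt x" using x by simp
    have "(real k)\<^sup>2 / (real (p - k) + 1) \<le> s\<^sup>2 / (x / 2)"
      using k q x by (intro frac_le power_mono) auto
    also have "\<dots> = 2 / sqrt x"
      using s4 x by (simp add: field_simps)
    also have "\<dots> \<le> C / sqrt x" using sq by (intro divide_right_mono) (auto simp: C_def)
    finally have 1: "(real k)\<^sup>2 / (real (p - k) + 1) \<le> C / sqrt x" .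
    have "s\<^sup>2 * \<kappa> ^ k \<le> (real k + 1)\<^sup>2 * \<kappa> ^ k"
      using k s0 assms by (intro mult_right_mono power_mono) auto
    also have "\<dots> \<le> C" using \<kappa>[of k] by (simp add: C_def)
    finally have 2: "\<kappa> ^ k \<le> C / sqrt x" using sq s4 by (simp add: pos_le_divide_eq mult.commute)
    have "sqrt x / 2 \<le> sqrt (x / 2)"
    proof -
      have "sqrt x / 2 = sqrt (x / 4)" by (simp add: real_sqrt_divide)
      also have "\<dots> \<le> sqrt (x / 2)" using x by (intro real_sqrt_le_mono) auto
      finally show ?thesis .
    qed
    also have "\<dots> \<le> sqrt (real (p - k) + 1)" using q by (rule real_sqrt_le_mono)
    finally have "1 / sqrt (real (p - k) + 1) \<le> 1 / (sqrt x / 2)"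
      using sq by (intro divide_left_mono) auto
    also have "\<dots> \<le> C / sqrt x" using sq by (simp add: C_def divide_right_mono)
    finally have 3: "1 / sqrt (real (p - k) + 1) \<le> C / sqrt x" .
    show ?thesis using kp 1 2 3 unfolding x_def by blast
  qed
  moreover have "0 \<le> C" by (simp add: C_def le_max_iff_disj)
  ultimately show ?thesis by blast
qed

context triangular_chain
begin

lemma T_decay:
  assumes l: "l \<le> m" and \<mu>: "\<mu> \<in> prob_measures (S (l - 1))" and f: "bounded_by (S l) B f"
    and "x \<in> space (S l)" "y \<in> space (S l)"
    and d: "\<And>x y. x \<in> space (S l) \<Longrightarrow> y \<in> space (S l) \<Longrightarrow> \<bar>f x - f y\<bar> \<le> d"
  shows "\<bar>T l \<mu> k f x - T l \<mu> k f y\<bar> \<le> \<kappa> ^ k * (d / \<kappa> ^ N)"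
  using assms(4,5)
proof (induction k arbitrary: x y rule: less_induct)
  case (less k)
  show ?case
  proof (cases "k < N")
    case True
    then show ?thesis using contr_of_osc[OF l \<mu> f d] less.prems unfolding contr_def by blast
  next
    case False
    then have k: "k = N + (k - N)" and less_k: "k - N < k" using N_pos by auto
    have T: "T l \<mu> k f z = T l \<mu> N (T l \<mu> (k - N) f) z" for z
      by (subst k) (simp add: funpow_add)
    have "\<bar>T l \<mu> k f x - T l \<mu> k f y\<bar> \<le> \<kappa> ^ N * (\<kappa> ^ (k - N) * (d / \<kappa> ^ N))"
      unfolding T
      by (rule contraction[OF l \<mu> T_bounded_by[OF l \<mu> f] less.IH[OF less_k] less.prems])
    also have "\<dots> = \<kappa> ^ k * (d / \<kappa> ^ N)" by (metis k power_add mult.assoc)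
    finally show ?thesis .
  qed
qed

lemma T_ergodic:
  assumes l: "l \<le> m" and \<mu>: "\<mu> \<in> prob_measures (S (l - 1))" and f: "bounded_by (S l) B f"
    and \<nu>: "\<nu> \<in> prob_measures (S l)"
    and inv: "\<And>B g. bounded_by (S l) B g \<Longrightarrow> (\<integral>x. kernel_op (M l \<mu>) g x \<partial>\<nu>) = (\<integral>x. g x \<partial>\<nu>)"
    and x: "x \<in> space (S l)"
  shows "\<bar>T l \<mu> k f x - (\<integral>x. f x \<partial>\<nu>)\<bar> \<le> \<kappa> ^ k * (2 * B / \<kappa> ^ N)"
proof -
  have "(\<integral>x. T l \<mu> k f x \<partial>\<nu>) = (\<integral>x. f x \<partial>\<nu>)"
  proof (induction k)
    case (Suc k)
    then show ?case using inv[OF T_bounded_by[OF l \<mu> f, of k]] by simp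
  qed simp
  moreover have "\<bar>(\<integral>y. T l \<mu> k f x \<partial>\<nu>) - (\<integral>y. T l \<mu> k f y \<partial>\<nu>)\<bar> \<le> \<kappa> ^ k * (2 * B / \<kappa> ^ N)"
  proof (rule bounded_by_integral_diff_le[OF _ T_bounded_by[OF l \<mu> f] \<nu>])
    show "bounded_by (S l) B (\<lambda>y. T l \<mu> k f x)"
      using bounded_by_abs[OF T_bounded_by[OF l \<mu> f] x] by (simp add: bounded_by_def)
    fix y assume y: "y \<in> space (S l)"
    show "\<bar>T l \<mu> k f x - T l \<mu> k f y\<bar> \<le> \<kappa> ^ k * (2 * B / \<kappa> ^ N)"
    proof (rule T_decay[OF l \<mu> f x y])
      fix x y assume "x \<in> space (S l)" "y \<in> space (S l)"
      with bounded_by_abs[OF f this(1)] bounded_by_abs[OF f this(2)] show "\<bar>f x - f y\<bar> \<le> 2 * B" by linarith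
    qed
  qed
  ultimately show ?thesis using \<nu> by (simp add: space_prob_algebra prob_space.prob_space)
qed

lemma K_marginal:
  assumes l: "l \<le> m" and h: "h \<in> space Hs" and \<psi>: "bounded_by (S l) B \<psi>"
  shows "(\<integral>y. \<psi> (y l) \<partial>K j h) = (\<integral>z. \<psi> z \<partial>lk l j h)"
proof -
  define A where "A = (\<lambda>l'. lk l' j h)"
  have pA: "prob_space (A l')" "sets (A l') = sets (S l')" if "l' \<le> m" for l'
    using lk_prob[OF h that, of j] by (auto simp: A_def space_prob_algebra)
  have sA: "sets (PiM {..m} A) = sets Em" using pA by (intro sets_PiM_cong) auto
  have f: "bounded_by Em B (\<lambda>y. \<psi> (y l))" by (rule level_fun_bounded[OF \<psi> l])
  have "(\<integral>y. \<psi> (y l) \<partial>PiM {..m} (A(l := A l))) = (\<integral>y. (\<integral>z. \<psi> ((y(l := z)) l) \<partial>A l) \<partial>PiM {..m} A)"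
    by (rule integral_PiM_resample(1)[where B = B])
       (use pA l bounded_by_measurable[OF f] bounded_by_abs[OF f] sA sets_eq_imp_space_eq[OF sA] in
         \<open>auto cong: measurable_cong_sets\<close>)
  also have "\<dots> = (\<integral>z. \<psi> z \<partial>A l)"
    using prob_space.prob_space[OF prob_space_PiM_on[of "{..m}" A]] pA by simp
  finally show ?thesis unfolding fun_upd_triv by (simp add: K_def A_def)
qed

lemma emp_gap:
  assumes l: "l \<le> m" and h: "h \<in> space Hs" and g: "bounded_by (S (l - 1)) 1 g" and "q \<le> j"
  shows "\<bar>(\<integral>z. g z \<partial>emp l j h) - (\<integral>z. g z \<partial>emp l q h)\<bar> \<le> 2 * real (j - q) / (real q + 1)"
  using \<open>q \<le> j\<close>
proof (induction j rule: dec_induct)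
  case (step j)
  have "2 / (real j + 2) \<le> 2 / (real q + 1)" using step by (intro divide_left_mono) auto
  moreover have "2 * real (Suc j - q) / (real q + 1) = 2 * real (j - q) / (real q + 1) + 2 / (real q + 1)"
    using step by (simp add: Suc_diff_le add_divide_distrib)
  ultimately show ?case using step.IH emp_extend[OF l h g, of j] by linarith
qed simp

text \<open>
  Between the times \<open>q\<close> and \<open>p\<close> the empirical measures stay within \<open>2 (p - q) / (q + 1)\<close> of the one at
  time \<open>q\<close>, so each of the \<open>p - j\<close> remaining steps may be made with the kernel frozen at time \<open>q\<close>.
\<close>

lemma frozen_kernel:
  assumes l: "l \<le> m" and g: "bounded_by (S l) B g" and h: "h \<in> space Hs" and "q \<le> j" "j \<le> p"
  shows "\<bar>ev j (p - j) (\<lambda>h. g (h p l)) h - T l (emp l q h) (p - j) g (h j l)\<bar>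
    \<le> real (p - j) * (c * (2 * real (p - q) / (real q + 1)) * B)"
  using \<open>j \<le> p\<close> \<open>q \<le> j\<close> h
proof (induction j arbitrary: h rule: inc_induct)
  case base
  then show ?case using ev_0[OF state_fun_bounded[OF level_fun_bounded[OF g l]]] by simp
next
  case (step j)
  note h = step.prems(2) and qj = step.prems(1)
  have j: "j < p" using step by simp
  define k where "k = p - Suc j"
  define \<mu> where "\<mu> = emp l q h"
  define \<tau> where "\<tau> = 2 * real (p - q) / (real q + 1)"
  define e where "e = c * \<tau> * B"
  have \<mu>: "\<mu> \<in> prob_measures (S (l - 1))" unfolding \<mu>_def by (rule emp_prob[OF h l])
  have gb: "bounded_by Hs B (\<lambda>h. g (h p l))" by (rule state_fun_bounded[OF level_fun_bounded[OF g l]])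
  have Tk: "bounded_by (S l) B (T l \<mu> k g)" by (rule T_bounded_by[OF l \<mu> g])
  have "\<bar>(\<integral>y. ev (Suc j) k (\<lambda>h. g (h p l)) (h(Suc j := y)) \<partial>K j h) - (\<integral>y. T l \<mu> k g (y l) \<partial>K j h)\<bar> \<le> real k * e"
  proof (rule bounded_by_integral_diff_le[OF _ level_fun_bounded[OF Tk l] K_prob[OF h]])
    show "bounded_by Em B (\<lambda>y. ev (Suc j) k (\<lambda>h. g (h p l)) (h(Suc j := y)))"
      by (rule bounded_by_comp[OF ev_bounded_by[OF gb] measurable_Hs_upd'[OF h]])
    fix y assume y: "y \<in> space Em"
    have hy: "h(Suc j := y) \<in> space Hs" by (rule space_Hs_upd[OF h y])
    have emp_eq: "emp l q (h(Suc j := y)) = \<mu>" unfolding \<mu>_def using qj by (intro emp_cong) auto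
    show "\<bar>ev (Suc j) k (\<lambda>h. g (h p l)) (h(Suc j := y)) - T l \<mu> k g (y l)\<bar> \<le> real k * e"
      using step.IH[OF le_SucI[OF qj] hy] unfolding emp_eq fun_upd_same k_def e_def \<tau>_def .
  qed
  moreover have "(\<integral>y. T l \<mu> k g (y l) \<partial>K j h) = kernel_op (M l (emp l j h)) (T l \<mu> k g) (h j l)"
    using K_marginal[OF l h Tk, of j] by (simp add: lk_def kernel_op_def)
  moreover have "\<bar>kernel_op (M l (emp l j h)) (T l \<mu> k g) (h j l) - kernel_op (M l \<mu>) (T l \<mu> k g) (h j l)\<bar> \<le> e"
    unfolding e_def
  proof (rule lipschitz[OF l emp_prob[OF h l] \<mu> Tk _ space_Hs_coord2[OF h l]])
    fix u :: "'a \<Rightarrow> real" assume u: "bounded_by (S (l - 1)) 1 u"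
    have "2 * real (j - q) / (real q + 1) \<le> \<tau>"
      unfolding \<tau>_def using j by (intro divide_right_mono) auto
    then show "\<bar>integral\<^sup>L (emp l j h) u - integral\<^sup>L \<mu> u\<bar> \<le> \<tau>"
      using emp_gap[OF l h u qj] unfolding \<mu>_def by linarith
  qed
  moreover have "ev j (p - j) (\<lambda>h. g (h p l)) h = (\<integral>y. ev (Suc j) k (\<lambda>h. g (h p l)) (h(Suc j := y)) \<partial>K j h)"
    using ev_split_first[OF gb h j] ev_1[OF ev_bounded_by[OF gb] h] by (simp add: k_def)
  moreover have "T l \<mu> (p - j) g (h j l) = kernel_op (M l \<mu>) (T l \<mu> k g) (h j l)"
    using Suc_diff_Suc[OF j] unfolding k_def by (metis funpow.simps(2) comp_apply)
  moreover have "real (p - j) * e = real k * e + e"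
    using Suc_diff_Suc[OF j, symmetric] by (simp add: k_def algebra_simps)
  ultimately show ?case unfolding e_def \<tau>_def \<mu>_def by linarith
qed

text \<open>
  From the exponential moment by \<open>x \<le> exp x\<close>; the choice \<open>t = 1 / B\<close> makes the bound linear in \<open>B\<close>.
\<close>

lemma mean_deviation:
  "\<exists>D\<ge>0. \<forall>B f n h. bounded_by Em B f \<longrightarrow> h \<in> space Hs \<longrightarrow>
    ev 0 n (\<lambda>h'. \<bar>avg n f h' - ev 0 n (avg n f) h\<bar>) h \<le> B * D / sqrt (real n + 1)"
proof -
  obtain C where C: "0 \<le> C" "\<And>B f n h t. bounded_by Em B f \<Longrightarrow> h \<in> space Hs \<Longrightarrow> 0 \<le> t \<Longrightarrow>
    ev 0 n (\<lambda>h'. exp (t * (sqrt (real n + 1) * \<bar>avg n f h' - ev 0 n (avg n f) h\<bar>))) h \<le> 2 * exp (t\<^sup>2 * B\<^sup>2 * C)"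
    using concentration_abs by blast
  have "ev 0 n (\<lambda>h'. \<bar>avg n f h' - ev 0 n (avg n f) h\<bar>) h \<le> B * (2 * exp C) / sqrt (real n + 1)"
    if f: "bounded_by Em B f" and h: "h \<in> space Hs" for B f n h
  proof -
    define a where "a = ev 0 n (avg n f) h"
    have B: "0 \<le> B" by (rule Em_bounded_nonneg[OF f])
    have a: "\<bar>a\<bar> \<le> B" unfolding a_def by (rule bounded_by_abs[OF ev_bounded_by[OF avg_bounded[OF f]] h])
    have dev: "bounded_by Hs (2 * B) (\<lambda>h'. \<bar>avg n f h' - a\<bar>)"
      using bounded_by_abs_diff_const[OF avg_bounded[OF f] a, of n] by simp
    show ?thesis
    proof (cases "B = 0")
      case True
      then show ?thesis
        using bounded_by_abs[OF ev_bounded_by[OF dev] h, of 0 n] unfolding a_def by simp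
    next
      case False
      define s where "s = sqrt (real n + 1)"
      have s: "0 < s" by (simp add: s_def)
      have Bp: "0 < B" using False B by simp
      have sd: "bounded_by Hs (1 / B * s * (2 * B)) (\<lambda>h'. 1 / B * (s * \<bar>avg n f h' - a\<bar>))"
      proof (rule bounded_byI)
        show "(\<lambda>h'. 1 / B * (s * \<bar>avg n f h' - a\<bar>)) \<in> borel_measurable Hs"
          using bounded_by_measurable[OF dev] by measurable
        fix h' assume "h' \<in> space Hs"
        from mult_left_mono[OF bounded_by_abs[OF dev this], of "1 / B * s"] Bp s
        show "\<bar>1 / B * (s * \<bar>avg n f h' - a\<bar>)\<bar> \<le> 1 / B * s * (2 * B)"
          by (simp add: abs_mult)
      qed
      have "1 / B * s * ev 0 n (\<lambda>h'. \<bar>avg n f h' - a\<bar>) h = ev 0 n (\<lambda>h'. 1 / B * (s * \<bar>avg n f h' - a\<bar>)) h"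
        unfolding ev_def by simp
      also have "\<dots> \<le> ev 0 n (\<lambda>h'. exp (1 * (1 / B * (s * \<bar>avg n f h' - a\<bar>)))) h"
        by (rule ev_mono[OF sd ev_exp_bounded[OF sd] h]) (simp add: less_imp_le exp_gt_self)
      also have "\<dots> \<le> 2 * exp ((1 / B)\<^sup>2 * B\<^sup>2 * C)"
        using C(2)[OF f h, of "1 / B" n] Bp unfolding a_def s_def by simp
      also have "(1 / B)\<^sup>2 * B\<^sup>2 = 1" using Bp by (simp add: power_divide)
      finally have "1 / B * s * ev 0 n (\<lambda>h'. \<bar>avg n f h' - a\<bar>) h \<le> 2 * exp C" by simp
      then show ?thesis using Bp s unfolding a_def s_def by (simp add: field_simps)
    qed
  qed
  moreover have "0 \<le> 2 * exp C" by simp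
  ultimately show ?thesis by blast
qed

lemma sum_inverse_sqrt: "(\<Sum>p\<le>n. 1 / sqrt (real p + 1)) / (real n + 1) \<le> 2 / sqrt (real n + 1)"
proof -
  have "(\<Sum>p\<le>n. 1 / sqrt (real p + 1)) = (\<Sum>p<Suc n. (real p + 1) powr (1/2 - 1))"
    unfolding lessThan_Suc_atMost by (intro sum.cong) (auto simp: powr_minus_divide powr_half_sqrt)
  also have "\<dots> \<le> real (Suc n) powr (1/2) / (1/2)" by (rule sum_powr_le) auto
  also have "\<dots> = 2 * sqrt (real n + 1)" by (simp add: powr_half_sqrt add.commute)
  finally have "(\<Sum>p\<le>n. 1 / sqrt (real p + 1)) / (real n + 1) \<le> 2 * sqrt (real n + 1) / (real n + 1)"
    by (rule divide_right_mono) simp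
  also have "\<dots> = 2 / sqrt (real n + 1)"
    using real_sqrt_mult_self[of "real n + 1"] by (subst frac_eq_eq) (auto simp: mult.assoc)
  finally show ?thesis .
qed

lemma avg_mean_le:
  assumes f: "bounded_by Em B f" and h: "h \<in> space Hs"
    and mean: "\<And>p. \<bar>ev 0 p (\<lambda>h'. f (h' p)) h - a\<bar> \<le> D / sqrt (real p + 1)" and D: "0 \<le> D"
  shows "\<bar>ev 0 n (avg n f) h - a\<bar> \<le> 2 * D / sqrt (real n + 1)"
proof -
  have "ev 0 n (avg n f) h - a = (\<Sum>p\<le>n. ev 0 p (\<lambda>h'. f (h' p)) h - a) / (real n + 1)"
    unfolding ev_avg[OF f h] using ev_state(2)[OF f h, of 0 _ n]
    by (simp add: sum_subtractf diff_divide_distrib add.commute)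
  also have "\<bar>\<dots>\<bar> \<le> (\<Sum>p\<le>n. D / sqrt (real p + 1)) / (real n + 1)"
    using mean by (simp add: divide_right_mono order_trans[OF sum_abs sum_mono])
  also have "\<dots> = D * ((\<Sum>p\<le>n. 1 / sqrt (real p + 1)) / (real n + 1))"
    by (simp add: sum_distrib_left sum_divide_distrib)
  also have "\<dots> \<le> D * (2 / sqrt (real n + 1))"
    by (intro mult_left_mono sum_inverse_sqrt D)
  also have "\<dots> = 2 * D / sqrt (real n + 1)" by simp
  finally show ?thesis .
qed

end

locale triangular_targets = triangular_chain +
  fixes \<Phi> :: "nat \<Rightarrow> 'a measure \<Rightarrow> 'a measure" and \<pi> :: "nat \<Rightarrow> 'a measure"
  assumes \<pi>_prob: "\<And>l. l \<le> m \<Longrightarrow> \<pi> l \<in> prob_measures (S l)"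
    and \<Phi>_prob: "\<And>l \<mu>. 1 \<le> l \<Longrightarrow> l \<le> m \<Longrightarrow> \<mu> \<in> prob_measures (S (l - 1)) \<Longrightarrow> \<Phi> l \<mu> \<in> prob_measures (S l)"
    and \<pi>_rec: "\<And>l. 1 \<le> l \<Longrightarrow> l \<le> m \<Longrightarrow> \<pi> l = \<Phi> l (\<pi> (l - 1))"
    and \<pi>_0_invariant: "\<And>\<mu> B g. \<mu> \<in> prob_measures (S 0) \<Longrightarrow> bounded_by (S 0) B g \<Longrightarrow>
      (\<integral>x. kernel_op (M 0 \<mu>) g x \<partial>\<pi> 0) = (\<integral>x. g x \<partial>\<pi> 0)"
    and \<Phi>_invariant: "\<And>l \<mu> B g. 1 \<le> l \<Longrightarrow> l \<le> m \<Longrightarrow> \<mu> \<in> prob_measures (S (l - 1)) \<Longrightarrow> bounded_by (S l) B g \<Longrightarrow>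
      (\<integral>x. kernel_op (M l \<mu>) g x \<partial>\<Phi> l \<mu>) = (\<integral>x. g x \<partial>\<Phi> l \<mu>)"
    and R1: "R1 S \<Phi>"
begin

definition level_mean :: "nat \<Rightarrow> real \<Rightarrow> bool"
  where "level_mean l C \<longleftrightarrow> 0 \<le> C \<and> (\<forall>B g p h. bounded_by (S l) B g \<longrightarrow> h \<in> space Hs \<longrightarrow>
    \<bar>ev 0 p (\<lambda>h'. g (h' p l)) h - (\<integral>x. g x \<partial>\<pi> l)\<bar> \<le> B * C / sqrt (real p + 1))"

lemma level_deviation:
  assumes l: "l \<le> m" and lm: "level_mean l C"
  shows "\<exists>C'\<ge>0. \<forall>B g n h. bounded_by (S l) B g \<longrightarrow> h \<in> space Hs \<longrightarrow>
    ev 0 n (\<lambda>h'. \<bar>avg n (\<lambda>x. g (x l)) h' - (\<integral>x. g x \<partial>\<pi> l)\<bar>) h \<le> B * C' / sqrt (real n + 1)"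
proof -
  obtain D where D: "0 \<le> D" "\<And>B f n h. bounded_by Em B f \<Longrightarrow> h \<in> space Hs \<Longrightarrow>
    ev 0 n (\<lambda>h'. \<bar>avg n f h' - ev 0 n (avg n f) h\<bar>) h \<le> B * D / sqrt (real n + 1)"
    using mean_deviation by blast
  have C: "0 \<le> C" using lm by (simp add: level_mean_def)
  have "ev 0 n (\<lambda>h'. \<bar>avg n (\<lambda>x. g (x l)) h' - (\<integral>x. g x \<partial>\<pi> l)\<bar>) h \<le> B * (D + 2 * C) / sqrt (real n + 1)"
    if g: "bounded_by (S l) B g" and h: "h \<in> space Hs" for B g n h
  proof -
    define f where "f = (\<lambda>x :: nat \<Rightarrow> 'a. g (x l))"
    have f: "bounded_by Em B f" unfolding f_def by (rule level_fun_bounded[OF g l])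
    have B: "0 \<le> B" by (rule Em_bounded_nonneg[OF f])
    define a where "a = ev 0 n (avg n f) h"
    define b where "b = (\<integral>x. g x \<partial>\<pi> l)"
    have "\<bar>a - b\<bar> \<le> 2 * (B * C) / sqrt (real n + 1)"
      unfolding a_def b_def
      by (rule avg_mean_le[OF f h]) (use lm g h B C in \<open>auto simp: level_mean_def f_def\<close>)
    moreover have da: "bounded_by Hs (B + \<bar>a\<bar>) (\<lambda>h'. \<bar>avg n f h' - a\<bar>)"
      and db: "bounded_by Hs (B + \<bar>b\<bar>) (\<lambda>h'. \<bar>avg n f h' - b\<bar>)"
      by (rule bounded_by_abs_diff_const[OF avg_bounded[OF f] order_refl])+
    have dc: "bounded_by Hs \<bar>a - b\<bar> (\<lambda>_. \<bar>a - b\<bar>)" by (simp add: bounded_by_def)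
    have "ev 0 n (\<lambda>h'. \<bar>avg n f h' - b\<bar>) h \<le> ev 0 n (\<lambda>h'. \<bar>avg n f h' - a\<bar> + \<bar>a - b\<bar>) h"
      by (rule ev_mono[OF db bounded_by_add[OF da dc] h]) simp
    moreover have "ev 0 n (\<lambda>h'. \<bar>avg n f h' - a\<bar> + \<bar>a - b\<bar>) h = ev 0 n (\<lambda>h'. \<bar>avg n f h' - a\<bar>) h + \<bar>a - b\<bar>"
      using Bochner_Integration.integral_add[OF ev_integrable[OF da h] ev_integrable[OF dc h]]
        ev_const[OF h] unfolding ev_def by metis
    moreover have "ev 0 n (\<lambda>h'. \<bar>avg n f h' - a\<bar>) h \<le> B * D / sqrt (real n + 1)"
      unfolding a_def by (rule D(2)[OF f h])
    ultimately have "ev 0 n (\<lambda>h'. \<bar>avg n f h' - b\<bar>) h \<le> B * D / sqrt (real n + 1) + 2 * (B * C) / sqrt (real n + 1)"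
      by linarith
    then show ?thesis unfolding f_def b_def by (simp add: add_divide_distrib[symmetric] algebra_simps)
  qed
  moreover have "0 \<le> D + 2 * C" using D C by simp
  ultimately show ?thesis by blast
qed

text \<open>
  \<open>\<mu> \<mapsto> \<Phi> l \<mu>\<close> need not be measurable.  Its error at the empirical measure is therefore bounded by a
  measurable function \<open>R\<close> of the history, and \<open>R\<close> is what gets integrated.
\<close>

definition target_error :: "nat \<Rightarrow> ('a measure \<Rightarrow> 'a measure) \<Rightarrow> real \<Rightarrow> bool"
  where "target_error l \<Psi> C \<longleftrightarrow> 0 \<le> C \<and> (\<forall>B g q. bounded_by (S l) B g \<longrightarrow> (\<exists>R\<in>borel_measurable Hs.
    (\<forall>h\<in>space Hs. ennreal \<bar>(\<integral>x. g x \<partial>\<Psi> (emp l q h)) - (\<integral>x. g x \<partial>\<pi> l)\<bar> \<le> R h) \<and>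
    (\<forall>h\<in>space Hs. (\<integral>\<^sup>+h'. R h' \<partial>run 0 q h) \<le> ennreal (B * C / sqrt (real q + 1)))))"

text \<open>
  \<open>R\<close> is the right-hand side of the regularity assumption, and its mean is computed by exchanging the
  integrals over the history and over the test functions \<open>g\<close>.  Since \<open>\<Gamma> f\<close> may fail to be sigma-finite,
  it is first weighted by \<open>\<parallel>g\<parallel>\<close>, which makes it finite; the integrand vanishes wherever \<open>\<parallel>g\<parallel>\<close> does.
\<close>

lemma R1_deviation:
  assumes l: "1 \<le> l" "l \<le> m" and C: "0 \<le> C"
    and dev: "\<And>B g n h. bounded_by (S (l - 1)) B g \<Longrightarrow> h \<in> space Hs \<Longrightarrow>
      ev 0 n (\<lambda>h'. \<bar>avg n (\<lambda>x. g (x (l - 1))) h' - (\<integral>x. g x \<partial>\<pi> (l - 1))\<bar>) h \<le> B * C / sqrt (real n + 1)"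
  shows "\<exists>C'. target_error l (\<Phi> l) C'"
proof -
  have l1: "l - 1 \<le> m" using l by simp
  obtain \<Gamma> :: "('a \<Rightarrow> real) \<Rightarrow> ('a \<Rightarrow> real) measure" and \<Lambda> :: real where
    \<Gamma>: "\<forall>f\<in>bounded_measurable (S l).
      space (\<Gamma> f) \<subseteq> bounded_measurable (S (l - 1)) \<and>
      (\<lambda>(g, x). g x) \<in> borel_measurable (\<Gamma> f \<Otimes>\<^sub>M S (l - 1)) \<and>
      sup_norm (S (l - 1)) \<in> borel_measurable (\<Gamma> f) \<and>
      (\<forall>\<mu>\<in>prob_measures (S (l - 1)). \<forall>\<nu>\<in>prob_measures (S (l - 1)).
        ennreal \<bar>(\<integral>x. f x \<partial>\<Phi> l \<mu>) - (\<integral>x. f x \<partial>\<Phi> l \<nu>)\<bar>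
          \<le> (\<integral>\<^sup>+g. ennreal \<bar>(\<integral>x. g x \<partial>\<mu>) - (\<integral>x. g x \<partial>\<nu>)\<bar> \<partial>\<Gamma> f)) \<and>
      (\<integral>\<^sup>+g. ennreal (sup_norm (S (l - 1)) g) \<partial>\<Gamma> f) \<le> ennreal (\<Lambda> * sup_norm (S l) f)"
    using R1 l(1) unfolding R1_def by blast
  define C' where "C' = C * \<bar>\<Lambda>\<bar>"
  have "\<exists>R\<in>borel_measurable Hs.
    (\<forall>h\<in>space Hs. ennreal \<bar>(\<integral>x. f x \<partial>\<Phi> l (emp l q h)) - (\<integral>x. f x \<partial>\<pi> l)\<bar> \<le> R h) \<and>
    (\<forall>h\<in>space Hs. (\<integral>\<^sup>+h'. R h' \<partial>run 0 q h) \<le> ennreal (B * C' / sqrt (real q + 1)))"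
    if f: "bounded_by (S l) B f" for B f q
  proof -
    have fb: "f \<in> bounded_measurable (S l)" using f bounded_measurable_iff by blast
    define G where "G = \<Gamma> f"
    define s where "s = sqrt (real q + 1)"
    have s: "0 < s" by (simp add: s_def)
    have G1: "space G \<subseteq> bounded_measurable (S (l - 1))"
      and G2: "(\<lambda>(g, x). g x) \<in> borel_measurable (G \<Otimes>\<^sub>M S (l - 1))"
      and G3: "sup_norm (S (l - 1)) \<in> borel_measurable G"
      and G4: "\<And>\<mu> \<nu>. \<mu> \<in> prob_measures (S (l - 1)) \<Longrightarrow> \<nu> \<in> prob_measures (S (l - 1)) \<Longrightarrow>
        ennreal \<bar>(\<integral>x. f x \<partial>\<Phi> l \<mu>) - (\<integral>x. f x \<partial>\<Phi> l \<nu>)\<bar>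
          \<le> (\<integral>\<^sup>+g. ennreal \<bar>(\<integral>x. g x \<partial>\<mu>) - (\<integral>x. g x \<partial>\<nu>)\<bar> \<partial>G)"
      and G5: "(\<integral>\<^sup>+g. ennreal (sup_norm (S (l - 1)) g) \<partial>G) \<le> ennreal (\<Lambda> * sup_norm (S l) f)"
      using \<Gamma> fb unfolding G_def by auto
    define w where "w g = ennreal (sup_norm (S (l - 1)) g)" for g
    have w: "w \<in> borel_measurable G" unfolding w_def[abs_def] using G3 by measurable
    define D where "D = density G w"
    have gb: "bounded_by (S (l - 1)) (sup_norm (S (l - 1)) g) g" if "g \<in> space G" for g
      using G1 that by (intro bounded_by_sup_norm) auto
    have B: "0 \<le> B" using bounded_by_nonneg[OF f space_S[OF l(2)]] .
    have D_space: "emeasure D (space D) \<le> ennreal (\<bar>\<Lambda>\<bar> * B)"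
    proof -
      have "emeasure D (space D) = (\<integral>\<^sup>+g. w g \<partial>G)"
        unfolding D_def using w by (simp add: emeasure_density cong: nn_integral_cong)
      also have "\<dots> \<le> ennreal (\<Lambda> * sup_norm (S l) f)" using G5 by (simp add: w_def)
      also have "\<dots> \<le> ennreal (\<bar>\<Lambda>\<bar> * B)"
      proof (rule ennreal_leI)
        have "0 \<le> sup_norm (S l) f"
          using bounded_by_nonneg[OF bounded_by_sup_norm[OF fb] space_S[OF l(2)]] .
        then show "\<Lambda> * sup_norm (S l) f \<le> \<bar>\<Lambda>\<bar> * B"
          using sup_norm_le[OF f space_S[OF l(2)]] B by (intro mult_mono) auto
      qed
      finally show ?thesis .
    qed
    interpret D: finite_measure D
      by (rule finite_measureI) (use D_space in \<open>auto simp: top_unique\<close>)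
    have \<pi>l: "\<pi> (l - 1) \<in> prob_measures (S (l - 1))" by (rule \<pi>_prob[OF l1])
    interpret \<pi>l: prob_space "\<pi> (l - 1)" using \<pi>l by (simp add: space_prob_algebra)
    define a where "a h g = ennreal \<bar>(\<Sum>p\<le>q. g (h p (l - 1))) / (real q + 1) - (\<integral>x. g x \<partial>\<pi> (l - 1))\<bar>"
      for h :: "nat \<Rightarrow> nat \<Rightarrow> 'a" and g :: "'a \<Rightarrow> real"
    have a_meas: "(\<lambda>(h, g). a h g) \<in> borel_measurable (Hs \<Otimes>\<^sub>M D)"
    proof -
      have sD: "sets (Hs \<Otimes>\<^sub>M D) = sets (Hs \<Otimes>\<^sub>M G)" by (rule sets_pair_measure_cong) (auto simp: D_def)
      have "(\<lambda>r. (snd r, fst r p (l - 1))) \<in> Hs \<Otimes>\<^sub>M G \<rightarrow>\<^sub>M G \<Otimes>\<^sub>M S (l - 1)" for p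
        by (rule measurable_Pair[OF measurable_snd measurable_compose[OF measurable_fst measurable_Hs_coord2[OF l1]]])
      from measurable_compose[OF this G2]
      have 1: "(\<lambda>r. (snd r) (fst r p (l - 1))) \<in> borel_measurable (Hs \<Otimes>\<^sub>M G)" for p by simp
      have "sets (G \<Otimes>\<^sub>M \<pi> (l - 1)) = sets (G \<Otimes>\<^sub>M S (l - 1))"
        using \<pi>l by (intro sets_pair_measure_cong) (auto simp: space_prob_algebra)
      then have "(\<lambda>(g, x). g x) \<in> borel_measurable (G \<Otimes>\<^sub>M \<pi> (l - 1))"
        using G2 measurable_cong_sets by blast
      then have "(\<lambda>g. \<integral>x. g x \<partial>\<pi> (l - 1)) \<in> borel_measurable G"
        by (rule \<pi>l.borel_measurable_lebesgue_integral)
      then have 2: "(\<lambda>r. \<integral>x. snd r x \<partial>\<pi> (l - 1)) \<in> borel_measurable (Hs \<Otimes>\<^sub>M G)"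
        by (rule measurable_compose[OF measurable_snd])
      have "(\<lambda>r. a (fst r) (snd r)) \<in> borel_measurable (Hs \<Otimes>\<^sub>M G)"
        unfolding a_def using 1 2 by measurable
      then have "(\<lambda>r. a (fst r) (snd r)) \<in> borel_measurable (Hs \<Otimes>\<^sub>M D)"
        using sD measurable_cong_sets by blast
      then show ?thesis by (simp add: case_prod_beta')
    qed
    have wD: "(\<lambda>(h, g). w g) \<in> borel_measurable (Hs \<Otimes>\<^sub>M D)"
    proof -
      have "w \<in> borel_measurable D" using w by (simp add: D_def)
      from measurable_compose[OF measurable_snd this] show ?thesis by (simp add: case_prod_beta')
    qed
    have aw_meas: "(\<lambda>(h, g). a h g / w g) \<in> borel_measurable (Hs \<Otimes>\<^sub>M D)"
      using borel_measurable_divide_ennreal[OF a_meas wD] by (simp add: case_prod_beta')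
    define R where "R h = (\<integral>\<^sup>+g. a h g / w g \<partial>D)" for h
    have R_meas: "R \<in> borel_measurable Hs"
      unfolding R_def[abs_def] using aw_meas by (rule D.borel_measurable_nn_integral)
    have upper: "ennreal \<bar>(\<integral>x. f x \<partial>\<Phi> l (emp l q h)) - (\<integral>x. f x \<partial>\<pi> l)\<bar> \<le> R h" if h: "h \<in> space Hs" for h
    proof -
      have "ennreal \<bar>(\<integral>x. f x \<partial>\<Phi> l (emp l q h)) - (\<integral>x. f x \<partial>\<pi> l)\<bar>
          \<le> (\<integral>\<^sup>+g. ennreal \<bar>(\<integral>x. g x \<partial>emp l q h) - (\<integral>x. g x \<partial>\<pi> (l - 1))\<bar> \<partial>G)"
        unfolding \<pi>_rec[OF l] by (rule G4[OF emp_prob[OF h l(2)] \<pi>l])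
      also have "\<dots> = (\<integral>\<^sup>+g. w g * (a h g / w g) \<partial>G)"
      proof (rule nn_integral_cong)
        fix g assume g: "g \<in> space G"
        have a: "ennreal \<bar>(\<integral>x. g x \<partial>emp l q h) - (\<integral>x. g x \<partial>\<pi> (l - 1))\<bar> = a h g"
          unfolding a_def integral_emp[OF h l(2) gb[OF g]] ..
        show "ennreal \<bar>(\<integral>x. g x \<partial>emp l q h) - (\<integral>x. g x \<partial>\<pi> (l - 1))\<bar> = w g * (a h g / w g)"
        proof (cases "sup_norm (S (l - 1)) g = 0")
          case True
          then have "g x = 0" if "x \<in> space (S (l - 1))" for x using bounded_by_abs[OF gb[OF g] that] by simp
          then have "g (h p (l - 1)) = 0" for p using space_Hs_coord2[OF h l1] by blast
          moreover have "\<bar>\<integral>x. g x \<partial>\<pi> (l - 1)\<bar> \<le> 0"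
            using bounded_by_integral_le[OF gb[OF g] \<pi>l] True by simp
          ultimately have "a h g = 0" by (simp add: a_def)
          then show ?thesis using a True by (simp add: w_def)
        next
          case False
          then have "0 < sup_norm (S (l - 1)) g"
            using bounded_by_nonneg[OF gb[OF g] space_S[OF l1]] by simp
          then show ?thesis
            unfolding a by (simp add: w_def ennreal_times_divide mult_divide_eq_ennreal mult.commute)
        qed
      qed
      also have "\<dots> = R h"
        unfolding R_def D_def
        using w measurable_compose[OF measurable_Pair1'[OF h] aw_meas]
        by (subst nn_integral_density) (auto simp: D_def)
      finally show ?thesis .
    qed
    have total: "(\<integral>\<^sup>+h'. R h' \<partial>run 0 q h) \<le> ennreal (B * C' / s)" if h: "h \<in> space Hs" for h
    proof -
      have rp: "prob_space (run 0 q h)" "sets (run 0 q h) = sets Hs"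
        using run_prob[OF h] by (auto simp: space_prob_algebra)
      interpret r: prob_space "run 0 q h" by fact
      interpret rD: pair_sigma_finite "run 0 q h" D ..
      have sr: "sets (run 0 q h \<Otimes>\<^sub>M D) = sets (Hs \<Otimes>\<^sub>M D)" by (rule sets_pair_measure_cong) (auto simp: rp)
      have aw: "(\<lambda>(h, g). a h g / w g) \<in> borel_measurable (run 0 q h \<Otimes>\<^sub>M D)"
        using aw_meas sr measurable_cong_sets by blast
      have "(\<integral>\<^sup>+h'. R h' \<partial>run 0 q h) = (\<integral>\<^sup>+g. (\<integral>\<^sup>+h'. a h' g / w g \<partial>run 0 q h) \<partial>D)"
        unfolding R_def using rD.Fubini'[OF aw] by simp
      also have "\<dots> \<le> (\<integral>\<^sup>+g. ennreal (C / s) \<partial>D)"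
      proof (rule nn_integral_mono)
        fix g assume "g \<in> space D"
        then have g: "g \<in> space G" by (simp add: D_def)
        define b where "b = sup_norm (S (l - 1)) g"
        define F where "F h' = \<bar>avg q (\<lambda>x. g (x (l - 1))) h' - (\<integral>x. g x \<partial>\<pi> (l - 1))\<bar>" for h'
        have F: "bounded_by Hs (b + b) F"
          unfolding F_def b_def
          by (rule bounded_by_abs_diff_const[OF avg_bounded[OF level_fun_bounded[OF gb[OF g] l1]]
            bounded_by_integral_le[OF gb[OF g] \<pi>l]])
        have aF: "a h' g = ennreal (F h')" for h' by (simp add: a_def F_def avg_def)
        have b0: "0 \<le> b" unfolding b_def by (rule bounded_by_nonneg[OF gb[OF g] space_S[OF l1]])
        have am: "(\<lambda>h'. ennreal (F h')) \<in> borel_measurable (run 0 q h)"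
          using bounded_by_measurable[OF F] rp(2) by (simp cong: measurable_cong_sets)
        have "(\<integral>\<^sup>+h'. a h' g / w g \<partial>run 0 q h) = (\<integral>\<^sup>+h'. ennreal (F h') \<partial>run 0 q h) / w g"
          unfolding aF using am by (rule nn_integral_divide)
        also have "(\<integral>\<^sup>+h'. ennreal (F h') \<partial>run 0 q h) = ennreal (ev 0 q F h)"
          unfolding ev_def by (rule nn_integral_eq_integral[OF ev_integrable[OF F h]]) (simp add: F_def)
        also have "ennreal (ev 0 q F h) / w g \<le> ennreal (b * C / s) / w g"
          using dev[OF gb[OF g] h, of q] unfolding F_def b_def s_def
          by (intro divide_right_mono_ennreal ennreal_leI)
        also have "\<dots> \<le> ennreal (C / s)"
        proof (cases "b = 0")
          case True
          then show ?thesis by simp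
        next
          case False
          then have "0 < b" using b0 by simp
          moreover have "w g = ennreal b" by (simp add: w_def b_def)
          ultimately show ?thesis using C s by (simp add: divide_ennreal)
        qed
        finally show "(\<integral>\<^sup>+h'. a h' g / w g \<partial>run 0 q h) \<le> ennreal (C / s)" .
      qed
      also have "\<dots> = ennreal (C / s) * emeasure D (space D)" by simp
      also have "\<dots> \<le> ennreal (C / s) * ennreal (\<bar>\<Lambda>\<bar> * B)" by (rule mult_left_mono[OF D_space]) simp
      also have "\<dots> = ennreal (B * C' / s)"
        using C s B by (simp add: C'_def ennreal_mult[symmetric] mult.commute mult.left_commute)
      finally show ?thesis .
    qed
    show ?thesis using R_meas upper total unfolding s_def by blast
  qed
  moreover have "0 \<le> C'" using C by (simp add: C'_def)
  ultimately show ?thesis unfolding target_error_def by blast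
qed

text \<open>
  At time \<open>p\<close> look back over the window of \<open>slow_window\<close>: the conditional mean given the history at time
  \<open>q = p - k\<close> is close to the frozen kernel's, hence to the mean under its invariant law.
\<close>

lemma level_mean_step:
  assumes l: "l \<le> m"
    and dev: "1 \<le> l \<Longrightarrow> \<exists>C'. target_error l (\<Phi> l) C'"
  shows "\<exists>C. level_mean l C"
proof -
  define inv where "inv \<mu> = (if l = 0 then \<pi> 0 else \<Phi> l \<mu>)" for \<mu>
  have inv_prob: "inv \<mu> \<in> prob_measures (S l)" if "\<mu> \<in> prob_measures (S (l - 1))" for \<mu>
    using \<pi>_prob[of 0] \<Phi>_prob[of l \<mu>] l that by (auto simp: inv_def)
  have inv_inv: "(\<integral>x. kernel_op (M l \<mu>) g x \<partial>inv \<mu>) = (\<integral>x. g x \<partial>inv \<mu>)"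
    if "\<mu> \<in> prob_measures (S (l - 1))" "bounded_by (S l) B g" for \<mu> B g
    using \<pi>_0_invariant[of \<mu> B g] \<Phi>_invariant[of l \<mu> B g] l that by (auto simp: inv_def)
  have "\<exists>C'. target_error l inv C'"
  proof (cases "l = 0")
    case True
    then have "target_error l inv 0"
      unfolding target_error_def by (intro conjI allI impI bexI[of _ "\<lambda>_. 0"]) (auto simp: inv_def)
    then show ?thesis by blast
  next
    case False
    then have "inv = \<Phi> l" by (simp add: inv_def fun_eq_iff)
    then show ?thesis using dev False by simp
  qed
  then obtain C' where C': "0 \<le> C'" and dev': "\<And>B g q. bounded_by (S l) B g \<Longrightarrow> \<exists>R\<in>borel_measurable Hs.
    (\<forall>h\<in>space Hs. ennreal \<bar>(\<integral>x. g x \<partial>inv (emp l q h)) - (\<integral>x. g x \<partial>\<pi> l)\<bar> \<le> R h) \<and>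
    (\<forall>h\<in>space Hs. (\<integral>\<^sup>+h'. R h' \<partial>run 0 q h) \<le> ennreal (B * C' / sqrt (real q + 1)))"
    unfolding target_error_def by blast
  obtain D where D: "0 \<le> D" and window: "\<And>p. \<exists>k\<le>p. (real k)\<^sup>2 / (real (p - k) + 1) \<le> D / sqrt (real p + 1) \<and>
    \<kappa> ^ k \<le> D / sqrt (real p + 1) \<and> 1 / sqrt (real (p - k) + 1) \<le> D / sqrt (real p + 1)"
    using slow_window[OF \<kappa>_pos \<kappa>_less] by blast
  define C where "C = (2 * c + 2 / \<kappa> ^ N + C') * D"
  have "\<bar>ev 0 p (\<lambda>h'. g (h' p l)) h - (\<integral>x. g x \<partial>\<pi> l)\<bar> \<le> B * C / sqrt (real p + 1)"
    if g: "bounded_by (S l) B g" and h: "h \<in> space Hs" for B g p h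
  proof -
    define s where "s = sqrt (real p + 1)"
    have s: "0 < s" by (simp add: s_def)
    have B: "0 \<le> B" by (rule bounded_by_nonneg[OF g space_S[OF l]])
    obtain k where k: "k \<le> p" "(real k)\<^sup>2 / (real (p - k) + 1) \<le> D / s" "\<kappa> ^ k \<le> D / s"
      "1 / sqrt (real (p - k) + 1) \<le> D / s"
      using window[of p] unfolding s_def by blast
    define q where "q = p - k"
    have pq: "p - q = k" "q \<le> p" using k by (auto simp: q_def)
    define a where "a = (\<integral>x. g x \<partial>\<pi> l)"
    define F where "F = ev q k (\<lambda>h'. g (h' p l))"
    define e where "e = B * ((2 * c + 2 / \<kappa> ^ N) * (D / s))"
    have e: "0 \<le> e" using B c_nonneg D \<kappa>_pos s by (simp add: e_def)
    have gb: "bounded_by Hs B (\<lambda>h. g (h p l))" by (rule state_fun_bounded[OF level_fun_bounded[OF g l]])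
    have F: "bounded_by Hs B F" unfolding F_def by (rule ev_bounded_by[OF gb])
    obtain R where R: "R \<in> borel_measurable Hs"
      "\<And>h. h \<in> space Hs \<Longrightarrow> ennreal \<bar>(\<integral>x. g x \<partial>inv (emp l q h)) - a\<bar> \<le> R h"
      "\<And>h. h \<in> space Hs \<Longrightarrow> (\<integral>\<^sup>+h'. R h' \<partial>run 0 q h) \<le> ennreal (B * C' / sqrt (real q + 1))"
      using dev'[OF g, of q] unfolding a_def by blast
    have F_near: "\<bar>F h' - (\<integral>x. g x \<partial>inv (emp l q h'))\<bar> \<le> e" if h': "h' \<in> space Hs" for h'
    proof -
      have \<mu>: "emp l q h' \<in> prob_measures (S (l - 1))" by (rule emp_prob[OF h' l])
      have "\<bar>F h' - T l (emp l q h') k g (h' q l)\<bar> \<le> real k * (c * (2 * real k / (real q + 1)) * B)"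
        using frozen_kernel[OF l g h' order_refl pq(2)] unfolding F_def pq .
      also have "\<dots> = B * (2 * c * ((real k)\<^sup>2 / (real q + 1)))"
        by (simp add: power2_eq_square)
      also have "\<dots> \<le> B * (2 * c * (D / s))"
        using k(2) B c_nonneg unfolding q_def by (intro mult_left_mono) auto
      finally have 1: "\<bar>F h' - T l (emp l q h') k g (h' q l)\<bar> \<le> B * (2 * c * (D / s))" .
      have "\<bar>T l (emp l q h') k g (h' q l) - (\<integral>x. g x \<partial>inv (emp l q h'))\<bar> \<le> \<kappa> ^ k * (2 * B / \<kappa> ^ N)"
        by (rule T_ergodic[OF l \<mu> g inv_prob[OF \<mu>] inv_inv[OF \<mu>] space_Hs_coord2[OF h' l]])
      also have "\<dots> \<le> D / s * (2 * B / \<kappa> ^ N)"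
        using k(3) B \<kappa>_pos by (intro mult_right_mono) auto
      finally have 2: "\<bar>T l (emp l q h') k g (h' q l) - (\<integral>x. g x \<partial>inv (emp l q h'))\<bar> \<le> D / s * (2 * B / \<kappa> ^ N)" .
      have "e = B * (2 * c * (D / s)) + D / s * (2 * B / \<kappa> ^ N)"
        by (simp only: e_def divide_inverse) (simp only: algebra_simps)
      with 1 2 show ?thesis by linarith
    qed
    have Fa: "bounded_by Hs (B + \<bar>a\<bar>) (\<lambda>h'. \<bar>F h' - a\<bar>)"
      by (rule bounded_by_abs_diff_const[OF F order_refl])
    have rp: "prob_space (run 0 q h)" "sets (run 0 q h) = sets Hs" "space (run 0 q h) = space Hs"
      using run_prob[OF h, of 0 q] by (auto simp: space_prob_algebra dest: sets_eq_imp_space_eq)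
    have "ennreal (ev 0 q (\<lambda>h'. \<bar>F h' - a\<bar>) h) = (\<integral>\<^sup>+h'. ennreal \<bar>F h' - a\<bar> \<partial>run 0 q h)"
      unfolding ev_def by (rule nn_integral_eq_integral[OF ev_integrable[OF Fa h], symmetric]) simp
    also have "\<dots> \<le> (\<integral>\<^sup>+h'. ennreal e + R h' \<partial>run 0 q h)"
    proof (rule nn_integral_mono)
      fix h' assume "h' \<in> space (run 0 q h)"
      then have h': "h' \<in> space Hs" using rp by simp
      have "ennreal \<bar>F h' - a\<bar> \<le> ennreal (e + \<bar>(\<integral>x. g x \<partial>inv (emp l q h')) - a\<bar>)"
        using F_near[OF h'] by (intro ennreal_leI) linarith
      also have "\<dots> \<le> ennreal e + R h'"
        using R(2)[OF h'] e by (simp add: ennreal_plus add_left_mono)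
      finally show "ennreal \<bar>F h' - a\<bar> \<le> ennreal e + R h'" .
    qed
    also have "\<dots> = ennreal e + (\<integral>\<^sup>+h'. R h' \<partial>run 0 q h)"
      using R(1) rp prob_space.emeasure_space_1[OF rp(1)]
      by (subst nn_integral_add) (auto cong: measurable_cong_sets)
    also have "\<dots> \<le> ennreal e + ennreal (B * C' / sqrt (real q + 1))"
      by (rule add_left_mono[OF R(3)[OF h]])
    also have "\<dots> = ennreal (e + B * C' / sqrt (real q + 1))"
      using e B C' by (simp add: ennreal_plus)
    finally have *: "ennreal (ev 0 q (\<lambda>h'. \<bar>F h' - a\<bar>) h) \<le> ennreal (e + B * C' / sqrt (real q + 1))" .
    have "0 \<le> e + B * C' / sqrt (real q + 1)" using e B C' by simp
    then have "ev 0 q (\<lambda>h'. \<bar>F h' - a\<bar>) h \<le> e + B * C' / sqrt (real q + 1)"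
      using * by (rule iffD1[OF ennreal_le_iff])
    moreover have "B * C' * (1 / sqrt (real q + 1)) \<le> B * C' * (D / s)"
      using k(4) B C' unfolding q_def by (intro mult_left_mono) auto
    moreover have "e + B * C' * (D / s) = B * C / s"
      by (simp add: e_def C_def algebra_simps add_divide_distrib)
    ultimately have "ev 0 q (\<lambda>h'. \<bar>F h' - a\<bar>) h \<le> B * C / s" by simp
    moreover have "\<bar>ev 0 p (\<lambda>h'. g (h' p l)) h - a\<bar> \<le> ev 0 q (\<lambda>h'. \<bar>F h' - a\<bar>) h"
    proof -
      have "ev 0 p (\<lambda>h'. g (h' p l)) h = ev 0 q F h"
        using ev_add[OF gb h, of 0 q k] k(1) unfolding F_def q_def by simp
      moreover have "ev 0 q (\<lambda>h'. F h' - a) h = ev 0 q F h - a"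
        using ev_diff[OF F _ h, of "\<bar>a\<bar>" "\<lambda>_. a" 0 q] ev_const[OF h, of 0 q a] by (simp add: bounded_by_def)
      ultimately show ?thesis
        using integral_abs_bound[of "run 0 q h" "\<lambda>h'. F h' - a"] unfolding ev_def by simp
    qed
    ultimately show ?thesis unfolding a_def s_def by linarith
  qed
  moreover have "0 \<le> C" using c_nonneg \<kappa>_pos C' D by (simp add: C_def)
  ultimately show ?thesis unfolding level_mean_def by blast
qed

lemma level_means: "l \<le> m \<Longrightarrow> \<exists>C. level_mean l C"
proof (induction l)
  case 0
  then show ?case by (intro level_mean_step) auto
next
  case (Suc l)
  then obtain C where C: "level_mean l C" by auto
  have l: "l \<le> m" using Suc.prems by simp
  obtain C' where C': "0 \<le> C'" "\<And>B g n h. bounded_by (S l) B g \<Longrightarrow> h \<in> space Hs \<Longrightarrow>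
    ev 0 n (\<lambda>h'. \<bar>avg n (\<lambda>x. g (x l)) h' - (\<integral>x. g x \<partial>\<pi> l)\<bar>) h \<le> B * C' / sqrt (real n + 1)"
    using level_deviation[OF l C] by blast
  show ?case
    by (rule level_mean_step[OF Suc.prems], rule R1_deviation[OF _ Suc.prems C'(1)]) (use C'(2) in auto)
qed

section \<open>Joint means and moments\<close>

definition resample :: "nat \<Rightarrow> ((nat \<Rightarrow> 'a) \<Rightarrow> real) \<Rightarrow> (nat \<Rightarrow> 'a) \<Rightarrow> real"
  where "resample l \<phi> x = (\<integral>z. \<phi> (x(l := z)) \<partial>\<pi> l)"

lemma resample_bounded:
  assumes \<phi>: "bounded_by Em B \<phi>" and l: "l \<le> m"
  shows "bounded_by Em B (resample l \<phi>)"
  unfolding resample_def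
  using bounded_by_comp[OF \<phi> measurable_Em_upd[OF l]] \<pi>_prob[OF l]
  by (intro bounded_by_kernel_integral[where N = "S l"]) (auto simp: case_prod_beta')

text \<open>
  Decouple level \<open>l\<close> from the others, then replace its law by \<open>\<pi> l\<close>; the test function in the second
  step, \<open>others \<phi> l p 0 h\<close>, is deterministic.
\<close>

lemma resample_mean:
  "\<exists>C\<ge>0. \<forall>l\<le>m. \<forall>B \<phi> p h. bounded_by Em B \<phi> \<longrightarrow> h \<in> space Hs \<longrightarrow>
    \<bar>ev 0 p (\<lambda>h'. \<phi> (h' p)) h - ev 0 p (\<lambda>h'. resample l \<phi> (h' p)) h\<bar> \<le> B * C / sqrt (real p + 1)"
proof -
  obtain D where D: "0 \<le> D" "\<And>B \<phi> l p h. bounded_by Em B \<phi> \<Longrightarrow> l \<le> m \<Longrightarrow> h \<in> space Hs \<Longrightarrow>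
    \<bar>ev 0 p (\<lambda>h'. \<phi> (h' p)) h - decoupled \<phi> l p 0 h\<bar> \<le> B * D / sqrt (real p + 1)"
    using decoupling by blast
  obtain L where L: "\<And>l. l \<le> m \<Longrightarrow> level_mean l (L l)" using level_means by metis
  define C where "C = D + (\<Sum>l\<le>m. L l)"
  have L0: "0 \<le> L l" if "l \<le> m" for l using L[OF that] by (simp add: level_mean_def)
  have "\<bar>ev 0 p (\<lambda>h'. \<phi> (h' p)) h - ev 0 p (\<lambda>h'. resample l \<phi> (h' p)) h\<bar> \<le> B * C / sqrt (real p + 1)"
    if \<phi>: "bounded_by Em B \<phi>" and l: "l \<le> m" and h: "h \<in> space Hs" for B \<phi> l p h
  proof -
    define u where "u = others \<phi> l p 0 h"
    have B: "0 \<le> B" by (rule Em_bounded_nonneg[OF \<phi>])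
    have u: "bounded_by (S l) B u" unfolding u_def by (rule others_bounded'[OF \<phi> l h])
    have "decoupled \<phi> l p 0 h = ev 0 p (\<lambda>h'. u (h' p l)) h" by (simp add: decoupled_def u_def)
    moreover have "\<bar>ev 0 p (\<lambda>h'. u (h' p l)) h - (\<integral>z. u z \<partial>\<pi> l)\<bar> \<le> B * L l / sqrt (real p + 1)"
      using L[OF l] u h unfolding level_mean_def by blast
    moreover have "(\<integral>z. u z \<partial>\<pi> l) = ev 0 p (\<lambda>h'. resample l \<phi> (h' p)) h"
    proof -
      have "(\<lambda>r. (fst r p)(l := snd r)) \<in> Hs \<Otimes>\<^sub>M S l \<rightarrow>\<^sub>M Em"
        using measurable_compose[OF measurable_Pair[OF measurable_compose[OF measurable_fst measurable_Hs_coord]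
          measurable_snd] measurable_Em_upd[OF l]] by simp
      from bounded_by_comp[OF \<phi> this]
      have "bounded_by (Hs \<Otimes>\<^sub>M S l) B (\<lambda>(h', z). \<phi> ((h' p)(l := z)))" by (simp add: case_prod_beta')
      from Fubini_bounded[OF this run_prob[OF h, of 0 p] \<pi>_prob[OF l]]
      show ?thesis by (simp add: u_def others_def resample_def ev_def)
    qed
    moreover have "B * D / sqrt (real p + 1) + B * L l / sqrt (real p + 1) \<le> B * C / sqrt (real p + 1)"
    proof -
      have "L l \<le> (\<Sum>l\<le>m. L l)" using l L0 by (intro member_le_sum) auto
      then have "B * (D + L l) \<le> B * C" using B by (intro mult_left_mono) (auto simp: C_def)
      from divide_right_mono[OF this, of "sqrt (real p + 1)"] show ?thesis
        by (simp add: add_divide_distrib distrib_left)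
    qed
    ultimately show ?thesis using D(2)[OF \<phi> l h, of p] by linarith
  qed
  moreover have "0 \<le> C" using D L0 by (auto simp: C_def intro!: add_nonneg_nonneg sum_nonneg)
  ultimately show ?thesis by blast
qed

abbreviation \<Pi>\<pi> :: "(nat \<Rightarrow> 'a) measure"
  where "\<Pi>\<pi> \<equiv> \<Pi>\<^sub>M l\<in>{..m}. \<pi> l"

lemma \<Pi>\<pi>_prob: "\<Pi>\<pi> \<in> prob_measures Em"
  using \<pi>_prob by (auto simp: space_prob_algebra intro!: prob_space_PiM_on sets_PiM_cong)

lemma resample_integral:
  assumes \<phi>: "bounded_by Em B \<phi>" and l: "l \<le> m"
  shows "(\<integral>x. resample l \<phi> x \<partial>\<Pi>\<pi>) = (\<integral>x. \<phi> x \<partial>\<Pi>\<pi>)"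
proof -
  have s: "sets \<Pi>\<pi> = sets Em" using \<Pi>\<pi>_prob by (simp add: space_prob_algebra)
  have p: "prob_space (\<pi> l)" if "l \<le> m" for l using \<pi>_prob[OF that] by (simp add: space_prob_algebra)
  have "(\<integral>x. \<phi> x \<partial>PiM {..m} (\<pi>(l := \<pi> l))) = (\<integral>y. (\<integral>z. \<phi> (y(l := z)) \<partial>\<pi> l) \<partial>PiM {..m} \<pi>)"
    by (rule integral_PiM_resample(1)[where B = B])
       (use p l bounded_by_measurable[OF \<phi>] bounded_by_abs[OF \<phi>] s sets_eq_imp_space_eq[OF s] in
         \<open>auto cong: measurable_cong_sets\<close>)
  then show ?thesis by (simp add: resample_def)
qed

text \<open>
  After all levels have been resampled the test function is constant on the state space, and its value
  is the integral against the product law, which resampling preserves.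
\<close>

lemma joint_mean:
  "\<exists>C\<ge>0. \<forall>B \<phi> p h. bounded_by Em B \<phi> \<longrightarrow> h \<in> space Hs \<longrightarrow>
    \<bar>ev 0 p (\<lambda>h'. \<phi> (h' p)) h - (\<integral>x. \<phi> x \<partial>\<Pi>\<pi>)\<bar> \<le> B * C / sqrt (real p + 1)"
proof -
  obtain C where C: "0 \<le> C" "\<And>l B \<phi> p h. l \<le> m \<Longrightarrow> bounded_by Em B \<phi> \<Longrightarrow> h \<in> space Hs \<Longrightarrow>
    \<bar>ev 0 p (\<lambda>h'. \<phi> (h' p)) h - ev 0 p (\<lambda>h'. resample l \<phi> (h' p)) h\<bar> \<le> B * C / sqrt (real p + 1)"
    using resample_mean by blast
  have "\<bar>ev 0 p (\<lambda>h'. \<phi> (h' p)) h - (\<integral>x. \<phi> x \<partial>\<Pi>\<pi>)\<bar> \<le> B * ((real m + 1) * C) / sqrt (real p + 1)"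
    if \<phi>: "bounded_by Em B \<phi>" and h: "h \<in> space Hs" for B \<phi> p h
  proof -
    define \<psi> where "\<psi> k = rec_nat \<phi> (\<lambda>l. resample l) k" for k
    have \<psi>0: "\<psi> 0 = \<phi>" and \<psi>Suc: "\<psi> (Suc k) = resample k (\<psi> k)" for k by (simp_all add: \<psi>_def)
    have inv: "bounded_by Em B (\<psi> k) \<and> (\<integral>x. \<psi> k x \<partial>\<Pi>\<pi>) = (\<integral>x. \<phi> x \<partial>\<Pi>\<pi>) \<and>
        \<bar>ev 0 p (\<lambda>h'. \<phi> (h' p)) h - ev 0 p (\<lambda>h'. \<psi> k (h' p)) h\<bar> \<le> real k * (B * C / sqrt (real p + 1)) \<and>
        (\<forall>l<k. \<forall>x\<in>space Em. \<forall>z\<in>space (S l). \<psi> k (x(l := z)) = \<psi> k x)" if "k \<le> Suc m" for k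
      using that
    proof (induction k)
      case 0
      then show ?case using \<phi> by (simp add: \<psi>0)
    next
      case (Suc k)
      have k: "k \<le> m" using Suc.prems by simp
      have IH: "bounded_by Em B (\<psi> k)" "(\<integral>x. \<psi> k x \<partial>\<Pi>\<pi>) = (\<integral>x. \<phi> x \<partial>\<Pi>\<pi>)"
        "\<bar>ev 0 p (\<lambda>h'. \<phi> (h' p)) h - ev 0 p (\<lambda>h'. \<psi> k (h' p)) h\<bar> \<le> real k * (B * C / sqrt (real p + 1))"
        "\<And>l x z. l < k \<Longrightarrow> x \<in> space Em \<Longrightarrow> z \<in> space (S l) \<Longrightarrow> \<psi> k (x(l := z)) = \<psi> k x"
        using Suc.IH[OF Suc_leD[OF Suc.prems]] by blast+
      have free: "\<psi> (Suc k) (x(l := z)) = \<psi> (Suc k) x"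
        if l: "l < Suc k" and x: "x \<in> space Em" and z: "z \<in> space (S l)" for l x z
      proof (cases "l = k")
        case True
        then show ?thesis by (simp add: \<psi>Suc resample_def)
      next
        case False
        have "space (\<pi> k) = space (S k)"
          using \<pi>_prob[OF k] by (auto simp: space_prob_algebra dest: sets_eq_imp_space_eq)
        then have "(\<integral>w. \<psi> k ((x(l := z))(k := w)) \<partial>\<pi> k) = (\<integral>w. \<psi> k (x(k := w)) \<partial>\<pi> k)"
          using False l IH(4)[OF _ space_Em_upd[OF x k] z]
          by (intro Bochner_Integration.integral_cong) (auto simp: fun_upd_twist)
        then show ?thesis by (simp add: \<psi>Suc resample_def)
      qed
      have close: "\<bar>ev 0 p (\<lambda>h'. \<psi> k (h' p)) h - ev 0 p (\<lambda>h'. \<psi> (Suc k) (h' p)) h\<bar> \<le> B * C / sqrt (real p + 1)"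
        unfolding \<psi>Suc by (rule C(2)[OF k IH(1) h])
      have dist: "real (Suc k) * (B * C / sqrt (real p + 1)) = real k * (B * C / sqrt (real p + 1)) + B * C / sqrt (real p + 1)"
        by (simp only: of_nat_Suc distrib_right mult_1_left)
      show ?case
      proof (intro conjI)
        show "bounded_by Em B (\<psi> (Suc k))" unfolding \<psi>Suc by (rule resample_bounded[OF IH(1) k])
        show "(\<integral>x. \<psi> (Suc k) x \<partial>\<Pi>\<pi>) = (\<integral>x. \<phi> x \<partial>\<Pi>\<pi>)"
          unfolding \<psi>Suc resample_integral[OF IH(1) k] by (rule IH(2))
        show "\<bar>ev 0 p (\<lambda>h'. \<phi> (h' p)) h - ev 0 p (\<lambda>h'. \<psi> (Suc k) (h' p)) h\<bar>
            \<le> real (Suc k) * (B * C / sqrt (real p + 1))"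
          using IH(3) close unfolding dist by linarith
        show "\<forall>l<Suc k. \<forall>x\<in>space Em. \<forall>z\<in>space (S l). \<psi> (Suc k) (x(l := z)) = \<psi> (Suc k) x"
          using free by blast
      qed
    qed
    define \<xi> where "\<xi> = \<psi> (Suc m)"
    have \<xi>: "bounded_by Em B \<xi>" "(\<integral>x. \<xi> x \<partial>\<Pi>\<pi>) = (\<integral>x. \<phi> x \<partial>\<Pi>\<pi>)"
      "\<bar>ev 0 p (\<lambda>h'. \<phi> (h' p)) h - ev 0 p (\<lambda>h'. \<xi> (h' p)) h\<bar> \<le> real (Suc m) * (B * C / sqrt (real p + 1))"
      "\<And>l x z. l \<le> m \<Longrightarrow> x \<in> space Em \<Longrightarrow> z \<in> space (S l) \<Longrightarrow> \<xi> (x(l := z)) = \<xi> x"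
      using inv[of "Suc m"] unfolding \<xi>_def by auto
    have const: "\<xi> x = \<xi> (h 0)" if x: "x \<in> space Em" for x
    proof -
      have "\<bar>\<xi> (h 0) - \<xi> ((h(0 := x)) 0)\<bar> \<le> (\<Sum>l\<le>m. 0)"
        by (rule state_change[where F = "\<lambda>h. \<xi> (h 0)", OF _ h x]) (simp add: \<xi>(4) space_Hs_coord)
      then show ?thesis by simp
    qed
    have "ev 0 p (\<lambda>h'. \<xi> (h' p)) h = \<xi> (h 0)"
      using ev_cong[OF h, of "\<lambda>h'. \<xi> (h' p)" "\<lambda>_. \<xi> (h 0)" 0 p] const[OF space_Hs_coord] ev_const[OF h] by simp
    moreover have "(\<integral>x. \<xi> x \<partial>\<Pi>\<pi>) = \<xi> (h 0)"
    proof -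
      have sp: "space \<Pi>\<pi> = space Em" and ps: "prob_space \<Pi>\<pi>"
        using \<Pi>\<pi>_prob by (auto simp: space_prob_algebra dest: sets_eq_imp_space_eq)
      have "(\<integral>x. \<xi> x \<partial>\<Pi>\<pi>) = (\<integral>x. \<xi> (h 0) \<partial>\<Pi>\<pi>)"
        using const sp by (intro Bochner_Integration.integral_cong) auto
      then show ?thesis using prob_space.prob_space[OF ps] by simp
    qed
    ultimately have "\<bar>ev 0 p (\<lambda>h'. \<phi> (h' p)) h - (\<integral>x. \<phi> x \<partial>\<Pi>\<pi>)\<bar> \<le> real (Suc m) * (B * C / sqrt (real p + 1))"
      using \<xi>(2,3) by simp
    also have "\<dots> = B * ((real m + 1) * C) / sqrt (real p + 1)" by (simp add: add.commute)
    finally show ?thesis .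
  qed
  moreover have "0 \<le> (real m + 1) * C" using C by simp
  ultimately show ?thesis by blast
qed

theorem moment_bound:
  assumes f: "bounded_by Em B f" and r: "0 \<le> r"
  shows "\<exists>C. \<forall>n. \<forall>h\<in>space Hs.
    ev 0 n (\<lambda>h'. (sqrt (real n + 1) * \<bar>avg n f h' - (\<integral>x. f x \<partial>\<Pi>\<pi>)\<bar>) powr r) h \<le> C"
proof -
  obtain D where D: "0 \<le> D" "\<And>p h. h \<in> space Hs \<Longrightarrow>
    \<bar>ev 0 p (\<lambda>h'. f (h' p)) h - (\<integral>x. f x \<partial>\<Pi>\<pi>)\<bar> \<le> B * D / sqrt (real p + 1)"
    using joint_mean f by blast
  obtain C where C: "0 \<le> C" "\<And>n h t. h \<in> space Hs \<Longrightarrow> 0 \<le> t \<Longrightarrow>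
    ev 0 n (\<lambda>h'. exp (t * (sqrt (real n + 1) * \<bar>avg n f h' - ev 0 n (avg n f) h\<bar>))) h \<le> 2 * exp (t\<^sup>2 * B\<^sup>2 * C)"
    using concentration_abs f by blast
  have B: "0 \<le> B" by (rule Em_bounded_nonneg[OF f])
  have "ev 0 n (\<lambda>h'. (sqrt (real n + 1) * \<bar>avg n f h' - (\<integral>x. f x \<partial>\<Pi>\<pi>)\<bar>) powr r) h
      \<le> exp (r * (2 * (B * D))) * (2 * exp (r\<^sup>2 * B\<^sup>2 * C))" if h: "h \<in> space Hs" for n h
  proof -
    define s where "s = sqrt (real n + 1)"
    define a where "a = (\<integral>x. f x \<partial>\<Pi>\<pi>)"
    define b where "b = ev 0 n (avg n f) h"
    have s: "0 < s" by (simp add: s_def)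
    have ab: "s * \<bar>b - a\<bar> \<le> 2 * (B * D)"
    proof -
      have "\<bar>b - a\<bar> \<le> 2 * (B * D) / s"
        unfolding a_def b_def s_def using D B by (intro avg_mean_le[OF f h D(2)[OF h]]) simp
      then show ?thesis using s by (simp add: pos_le_divide_eq mult.commute)
    qed
    have pw: "x powr r \<le> exp (r * x)" if "0 \<le> x" for x :: real
    proof (cases "x = 0")
      case False
      then have x: "0 < x" using that by simp
      have "r * ln x \<le> r * x" by (rule mult_left_mono[OF less_imp_le[OF ln_less_self[OF x]] r])
      then show ?thesis using x by (simp add: powr_def)
    qed simp
    have b1: "bounded_by Hs (s * (B + \<bar>b\<bar>)) (\<lambda>h'. s * \<bar>avg n f h' - b\<bar>)"
      using bounded_by_abs_diff_const[where a = b, OF avg_bounded[OF f, where n = n] order_refl] s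
      by (auto simp: bounded_by_def abs_mult)
    have b2: "bounded_by Hs (s * (B + \<bar>a\<bar>)) (\<lambda>h'. s * \<bar>avg n f h' - a\<bar>)"
      using bounded_by_abs_diff_const[where a = a, OF avg_bounded[OF f, where n = n] order_refl] s
      by (auto simp: bounded_by_def abs_mult)
    have lhs: "bounded_by Hs (exp (\<bar>r\<bar> * (s * (B + \<bar>a\<bar>)))) (\<lambda>h'. (s * \<bar>avg n f h' - a\<bar>) powr r)"
    proof (rule bounded_byI)
      show "(\<lambda>h'. (s * \<bar>avg n f h' - a\<bar>) powr r) \<in> borel_measurable Hs"
        using bounded_by_measurable[OF b2] by measurable
      fix h' assume h': "h' \<in> space Hs"
      have "(s * \<bar>avg n f h' - a\<bar>) powr r \<le> exp (r * (s * \<bar>avg n f h' - a\<bar>))"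
        using s by (intro pw) simp
      also have "\<dots> \<le> exp (\<bar>r\<bar> * (s * (B + \<bar>a\<bar>)))"
        using bounded_by_abs[OF ev_exp_bounded[OF b2, of r] h'] by simp
      finally show "\<bar>(s * \<bar>avg n f h' - a\<bar>) powr r\<bar> \<le> exp (\<bar>r\<bar> * (s * (B + \<bar>a\<bar>)))" by simp
    qed
    have rhs: "bounded_by Hs (exp (r * (2 * (B * D))) * exp (\<bar>r\<bar> * (s * (B + \<bar>b\<bar>))))
        (\<lambda>h'. exp (r * (2 * (B * D))) * exp (r * (s * \<bar>avg n f h' - b\<bar>)))"
      using ev_exp_bounded[OF b1, of r] by (auto simp: bounded_by_def abs_mult)
    have "ev 0 n (\<lambda>h'. (s * \<bar>avg n f h' - a\<bar>) powr r) h
        \<le> ev 0 n (\<lambda>h'. exp (r * (2 * (B * D))) * exp (r * (s * \<bar>avg n f h' - b\<bar>))) h"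
    proof (rule ev_mono[OF lhs rhs h])
      fix h' assume "h' \<in> space Hs"
      have "s * \<bar>avg n f h' - a\<bar> \<le> s * (\<bar>avg n f h' - b\<bar> + \<bar>b - a\<bar>)"
        using s by (intro mult_left_mono) auto
      with ab have "s * \<bar>avg n f h' - a\<bar> \<le> s * \<bar>avg n f h' - b\<bar> + 2 * (B * D)"
        by (simp add: distrib_left)
      from mult_left_mono[OF this r] have "r * (s * \<bar>avg n f h' - a\<bar>) \<le> r * (s * \<bar>avg n f h' - b\<bar> + 2 * (B * D))" .
      with pw[of "s * \<bar>avg n f h' - a\<bar>"] s
      have "(s * \<bar>avg n f h' - a\<bar>) powr r \<le> exp (r * (s * \<bar>avg n f h' - b\<bar> + 2 * (B * D)))"
        by (meson abs_ge_zero exp_le_cancel_iff less_imp_le mult_nonneg_nonneg order_trans)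
      then show "(s * \<bar>avg n f h' - a\<bar>) powr r \<le> exp (r * (2 * (B * D))) * exp (r * (s * \<bar>avg n f h' - b\<bar>))"
        by (simp add: distrib_left exp_add mult.commute)
    qed
    also have "\<dots> = exp (r * (2 * (B * D))) * ev 0 n (\<lambda>h'. exp (r * (s * \<bar>avg n f h' - b\<bar>))) h"
      unfolding ev_def by simp
    also have "\<dots> \<le> exp (r * (2 * (B * D))) * (2 * exp (r\<^sup>2 * B\<^sup>2 * C))"
      using C(2)[OF h r, of n] unfolding s_def b_def by (intro mult_left_mono) auto
    finally show ?thesis unfolding s_def a_def .
  qed
  then show ?thesis by blast
qed

end



section \<open>Uniform constants\<close>

lemma bind_invariant_integral:
  assumes "\<pi> \<in> prob_measures S" "K \<in> S \<rightarrow>\<^sub>M prob_algebra S" "\<pi> \<bind> K = \<pi>" "bounded_by S B g"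
  shows "(\<integral>x. kernel_op K g x \<partial>\<pi>) = (\<integral>x. g x \<partial>\<pi>)"
  using bind_integral_bounded[OF assms(1,2,4)] assms(3) by (simp add: kernel_op_def)

lemma kernel_op_divide: "kernel_op K (\<lambda>x. f x / a) = (\<lambda>x. kernel_op K f x / a)"
  by (simp add: kernel_op_def fun_eq_iff)

lemma kernel_op_pow_divide: "(kernel_op K ^^ k) (\<lambda>x. f x / a) = (\<lambda>x. (kernel_op K ^^ k) f x / a)"
  by (induction k) (simp_all add: kernel_op_divide)

lemma unit_ball_iff:
  assumes "space Q \<noteq> {}"
  shows "f \<in> unit_ball Q \<longleftrightarrow> bounded_by Q 1 f"
proof
  assume f: "f \<in> unit_ball Q"
  then have "bounded_by Q (sup_norm Q f) f" by (intro bounded_by_sup_norm) (simp add: unit_ball_def)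
  then show "bounded_by Q 1 f" using f unfolding unit_ball_def by (force simp: bounded_by_def)
next
  assume "bounded_by Q 1 f"
  then show "f \<in> unit_ball Q"
    using sup_norm_le[OF _ assms] bounded_measurable_iff unfolding unit_ball_def by blast
qed

text \<open>
  The norms are suprema of sets of reals, so that boundedness of these sets has to be established before
  a member can be compared with the supremum.  Rescaling \<open>f\<close> to the unit ball gives the factor \<open>B\<close>.
\<close>

lemma lipschitz_of_op_norm:
  assumes S: "space S \<noteq> {}" "space S' \<noteq> {}"
    and K: "K \<in> S \<rightarrow>\<^sub>M prob_algebra S" "K' \<in> S \<rightarrow>\<^sub>M prob_algebra S"
    and le: "op_norm S (\<lambda>f x. kernel_op K f x - kernel_op K' f x)
      \<le> c * signed_norm S' (\<lambda>f. (\<integral>x. f x \<partial>\<mu>) - (\<integral>x. f x \<partial>\<nu>))"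
    and f: "bounded_by S B f"
    and \<tau>: "\<And>g. bounded_by S' 1 g \<Longrightarrow> \<bar>(\<integral>x. g x \<partial>\<mu>) - (\<integral>x. g x \<partial>\<nu>)\<bar> \<le> \<tau>"
    and x: "x \<in> space S"
  shows "\<bar>kernel_op K f x - kernel_op K' f x\<bar> \<le> \<bar>c\<bar> * \<tau> * B"
proof (cases "B = 0")
  case True
  have "kernel_op K f x = 0" "kernel_op K' f x = 0"
    using bounded_by_abs[OF kernel_op_bounded_by[OF K(1) f] x] bounded_by_abs[OF kernel_op_bounded_by[OF K(2) f] x] True
    by auto
  then show ?thesis using True by simp
next
  case False
  have B: "0 < B" using bounded_by_nonneg[OF f S(1)] False by simp
  define g where "g y = f y / B" for y
  have g: "bounded_by S 1 g"
    using f B by (auto simp: g_def[abs_def] bounded_by_def)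
  have D: "bounded_by S 2 (\<lambda>x. kernel_op K u x - kernel_op K' u x)" if "bounded_by S 1 u" for u
    using bounded_by_diff[OF kernel_op_bounded_by[OF K(1) that] kernel_op_bounded_by[OF K(2) that]] by simp
  have "\<bar>kernel_op K g x - kernel_op K' g x\<bar> \<le> sup_norm S (\<lambda>x. kernel_op K g x - kernel_op K' g x)"
    unfolding sup_norm_def
    by (rule cSUP_upper[OF x]) (use bounded_by_abs[OF D[OF g]] in \<open>auto intro!: bdd_aboveI[where M = 2]\<close>)
  also have "\<dots> \<le> op_norm S (\<lambda>f x. kernel_op K f x - kernel_op K' f x)"
    unfolding op_norm_def
  proof (rule cSUP_upper)
    show "g \<in> unit_ball S" using g unit_ball_iff[OF S(1)] by simp
    show "bdd_above ((\<lambda>f. sup_norm S (\<lambda>x. kernel_op K f x - kernel_op K' f x)) ` unit_ball S)"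
    proof (rule bdd_aboveI2[where M = 2])
      fix u assume "u \<in> unit_ball S"
      then have "bounded_by S 1 u" using unit_ball_iff[OF S(1)] by simp
      from bounded_by_abs[OF D[OF this]] show "sup_norm S (\<lambda>x. kernel_op K u x - kernel_op K' u x) \<le> 2"
        unfolding sup_norm_def using S(1) by (intro cSUP_least) auto
    qed
  qed
  also have "\<dots> \<le> c * signed_norm S' (\<lambda>f. (\<integral>x. f x \<partial>\<mu>) - (\<integral>x. f x \<partial>\<nu>))" by (rule le)
  also have "\<dots> \<le> \<bar>c\<bar> * \<tau>"
  proof -
    have zero: "bounded_by S' 1 (\<lambda>_. 0)" by (simp add: bounded_by_def)
    have b: "\<bar>(\<integral>x. u x \<partial>\<mu>) - (\<integral>x. u x \<partial>\<nu>)\<bar> \<le> \<tau>" if "u \<in> unit_ball S'" for u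
      using \<tau> that unit_ball_iff[OF S(2)] by simp
    have z: "(\<lambda>_. 0) \<in> unit_ball S'" using zero unit_ball_iff[OF S(2)] by simp
    have up: "signed_norm S' (\<lambda>f. (\<integral>x. f x \<partial>\<mu>) - (\<integral>x. f x \<partial>\<nu>)) \<le> \<tau>"
      unfolding signed_norm_def by (rule cSUP_least) (use b z in auto)
    have "\<bar>(\<integral>x. (\<lambda>_. 0) x \<partial>\<mu>) - (\<integral>x. (\<lambda>_. 0) x \<partial>\<nu>)\<bar> \<le> signed_norm S' (\<lambda>f. (\<integral>x. f x \<partial>\<mu>) - (\<integral>x. f x \<partial>\<nu>))"
      unfolding signed_norm_def by (rule cSUP_upper[OF z]) (use b in \<open>auto intro!: bdd_aboveI2[where M = \<tau>]\<close>)
    then have "0 \<le> signed_norm S' (\<lambda>f. (\<integral>x. f x \<partial>\<mu>) - (\<integral>x. f x \<partial>\<nu>))" by simp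
    with up show ?thesis by (intro mult_mono) auto
  qed
  finally have "\<bar>kernel_op K g x - kernel_op K' g x\<bar> \<le> \<bar>c\<bar> * \<tau>" .
  moreover have "kernel_op K g x - kernel_op K' g x = (kernel_op K f x - kernel_op K' f x) / B"
    by (simp add: g_def[abs_def] kernel_op_def diff_divide_distrib)
  ultimately show ?thesis using B by (simp add: pos_divide_le_eq)
qed

text \<open>
  Rescale \<open>f\<close> to oscillation \<open>1\<close>; all the suprema involved are at most \<open>1\<close> because Markov operators do
  not increase oscillations.
\<close>

lemma dobrushin_contraction:
  assumes S: "space S \<noteq> {}" and K: "\<And>\<mu>. \<mu> \<in> I \<Longrightarrow> K \<mu> \<in> S \<rightarrow>\<^sub>M prob_algebra S" and \<mu>: "\<mu> \<in> I"
    and f: "bounded_by S B f"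
    and d: "\<And>x y. x \<in> space S \<Longrightarrow> y \<in> space S \<Longrightarrow> \<bar>f x - f y\<bar> \<le> d"
    and xy: "x \<in> space S" "y \<in> space S"
  shows "\<bar>(kernel_op (K \<mu>) ^^ n) f x - (kernel_op (K \<mu>) ^^ n) f y\<bar>
    \<le> (SUP \<mu>\<in>I. dobrushin S (kernel_op (K \<mu>) ^^ n)) * d"
proof (cases "d = 0")
  case True
  then show ?thesis using kernel_op_pow_osc[OF K[OF \<mu>] f d xy, of n] by simp
next
  case False
  have d0: "0 < d" using d[OF xy(1) xy(1)] False by simp
  have osc_bdd: "bdd_above ((\<lambda>(x, y). \<bar>u x - u y\<bar>) ` (space S \<times> space S))" if "bounded_by S C u" for u C
  proof (rule bdd_aboveI2[where M = "2 * C"], clarsimp)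
    fix x y assume "x \<in> space S" "y \<in> space S"
    with bounded_by_abs[OF that this(1)] bounded_by_abs[OF that this(2)] show "\<bar>u x - u y\<bar> \<le> 2 * C" by linarith
  qed
  have Osc1: "\<exists>C. bounded_by S C u \<and> (\<forall>x\<in>space S. \<forall>y\<in>space S. \<bar>u x - u y\<bar> \<le> 1)" if u: "u \<in> Osc1 S" for u
  proof -
    obtain C where C: "bounded_by S C u"
      using u bounded_measurable_iff by (auto simp: Osc1_def)
    have "\<bar>u x - u y\<bar> \<le> 1" if "x \<in> space S" "y \<in> space S" for x y
    proof -
      have "\<bar>u x - u y\<bar> \<le> osc S u"
        unfolding osc_def using cSUP_upper[OF _ osc_bdd[OF C], of "(x, y)"] that by simp
      then show ?thesis using u by (simp add: Osc1_def)
    qed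
    with C show ?thesis by blast
  qed
  have osc_le: "osc S ((kernel_op (K \<mu>') ^^ n) u) \<le> 1" if \<mu>': "\<mu>' \<in> I" and u: "u \<in> Osc1 S" for \<mu>' u
  proof -
    obtain C where C: "bounded_by S C u" "\<And>x y. x \<in> space S \<Longrightarrow> y \<in> space S \<Longrightarrow> \<bar>u x - u y\<bar> \<le> 1"
      using Osc1[OF u] by blast
    show ?thesis unfolding osc_def
      by (rule cSUP_least) (use S kernel_op_pow_osc[OF K[OF \<mu>'] C] in auto)
  qed
  have zero: "(\<lambda>_. 0) \<in> Osc1 S"
    using S by (auto simp: Osc1_def bounded_measurable_def osc_def bounded_iff image_constant_conv)
  have dob_bdd: "bdd_above ((\<lambda>u. osc S ((kernel_op (K \<mu>') ^^ n) u)) ` Osc1 S)" if "\<mu>' \<in> I" for \<mu>'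
    by (rule bdd_aboveI2[where M = 1]) (rule osc_le[OF that])
  have dob_le: "dobrushin S (kernel_op (K \<mu>') ^^ n) \<le> 1" if "\<mu>' \<in> I" for \<mu>'
    unfolding dobrushin_def by (rule cSUP_least) (use zero osc_le[OF that] in auto)
  define g where "g y = f y / d" for y
  have g: "bounded_by S (B / d) g" using f d0 by (auto simp: g_def[abs_def] bounded_by_def divide_right_mono)
  have "osc S g \<le> 1"
    unfolding osc_def
  proof (rule cSUP_least)
    show "space S \<times> space S \<noteq> {}" using S by simp
    fix q assume "q \<in> space S \<times> space S"
    then obtain x y where q: "q = (x, y)" "x \<in> space S" "y \<in> space S" by auto
    have "g x - g y = (f x - f y) / d" by (simp add: g_def diff_divide_distrib)
    then show "(case q of (x, y) \<Rightarrow> \<bar>g x - g y\<bar>) \<le> 1" using d[OF q(2,3)] d0 q by simp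
  qed
  then have gO: "g \<in> Osc1 S" using g bounded_measurable_iff by (auto simp: Osc1_def)
  have "\<bar>(kernel_op (K \<mu>) ^^ n) g x - (kernel_op (K \<mu>) ^^ n) g y\<bar> \<le> osc S ((kernel_op (K \<mu>) ^^ n) g)"
    unfolding osc_def
    using cSUP_upper[OF _ osc_bdd[OF kernel_op_pow_bounded_by[OF K[OF \<mu>] g]], of "(x, y)"] xy by simp
  also have "\<dots> \<le> dobrushin S (kernel_op (K \<mu>) ^^ n)"
    unfolding dobrushin_def by (rule cSUP_upper[OF gO dob_bdd[OF \<mu>]])
  also have "\<dots> \<le> (SUP \<mu>\<in>I. dobrushin S (kernel_op (K \<mu>) ^^ n))"
    by (rule cSUP_upper[OF \<mu>]) (use dob_le in \<open>auto intro!: bdd_aboveI2[where M = 1]\<close>)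
  finally show ?thesis
    using d0 by (simp add: g_def[abs_def] kernel_op_pow_divide diff_divide_distrib[symmetric] pos_divide_le_eq)
qed

context interacting_mcmc
begin

lemma space_S_nonempty: "space (S l) \<noteq> {}"
proof -
  interpret n: prob_space "\<nu> l" using \<nu>[of l] by (simp add: space_prob_algebra)
  have "space (\<nu> l) = space (S l)" using \<nu>[of l] by (auto simp: space_prob_algebra dest: sets_eq_imp_space_eq)
  then show ?thesis using n.not_empty by simp
qed

lemma M_kernel: "\<mu> \<in> prob_measures (S (l - 1)) \<Longrightarrow> M l \<mu> \<in> S l \<rightarrow>\<^sub>M prob_algebra (S l)"
  using M_markov[of l \<mu>] M_0[of \<mu>] M0_markov by (cases "l = 0") auto

lemma \<pi>_in_prob: "\<pi> l \<in> prob_measures (S l)"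
proof (induction l)
  case (Suc l)
  then show ?case using \<Phi>[of "Suc l"] \<pi>_rec[of "Suc l"] by auto
qed (rule \<pi>_0)

text \<open>
  A power larger than the one given by the mixing assumption contracts at least as well, so the levels
  \<open>0, \<dots>, m\<close> can share the power \<open>N\<close> and the worst of their contraction factors, \<open>q = \<kappa>^N\<close>.
\<close>

lemma triangular:
  assumes R1: "R1 S \<Phi>" and R2: "R2 S M"
  shows "\<exists>N \<kappa> c. triangular_targets m S M N \<kappa> c \<Phi> \<pi>"
proof -
  have "\<forall>l. \<exists>c :: real. \<forall>\<mu>\<in>prob_measures (S (l - 1)). \<forall>\<nu>\<in>prob_measures (S (l - 1)).
      op_norm (S l) (\<lambda>f x. kernel_op (M l \<mu>) f x - kernel_op (M l \<nu>) f x)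
        \<le> c * signed_norm (S (l - 1)) (\<lambda>f. (\<integral>x. f x \<partial>\<mu>) - (\<integral>x. f x \<partial>\<nu>))"
    using R2 unfolding R2_def by blast
  from choice[OF this] obtain c :: "nat \<Rightarrow> real" where
    lip: "\<And>l \<mu> \<nu>. \<mu> \<in> prob_measures (S (l - 1)) \<Longrightarrow> \<nu> \<in> prob_measures (S (l - 1)) \<Longrightarrow>
      op_norm (S l) (\<lambda>f x. kernel_op (M l \<mu>) f x - kernel_op (M l \<nu>) f x)
        \<le> c l * signed_norm (S (l - 1)) (\<lambda>f. (\<integral>x. f x \<partial>\<mu>) - (\<integral>x. f x \<partial>\<nu>))" by blast
  have "\<forall>l. \<exists>N :: nat. (SUP \<mu>\<in>prob_measures (S (l - 1)). dobrushin (S l) (kernel_op (M l \<mu>) ^^ N)) < 1"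
    using R2 unfolding R2_def by blast
  from choice[OF this] obtain n :: "nat \<Rightarrow> nat" where
    dob: "\<And>l. (SUP \<mu>\<in>prob_measures (S (l - 1)). dobrushin (S l) (kernel_op (M l \<mu>) ^^ n l)) < 1" by blast
  define N where "N = Suc (\<Sum>l\<le>m. n l)"
  define cc where "cc = (\<Sum>l\<le>m. \<bar>c l\<bar>)"
  define b where "b l = (SUP \<mu>\<in>prob_measures (S (l - 1)). dobrushin (S l) (kernel_op (M l \<mu>) ^^ n l))" for l
  \<comment> \<open>The element \<open>1/2\<close> keeps \<open>q\<close>, and with it \<open>\<kappa>\<close>, positive.\<close>
  define q where "q = Max (insert (1/2) (b ` {..m}))"
  have "b l < 1" for l unfolding b_def by (rule dob)
  then have q: "1/2 \<le> q" "q < 1" by (auto simp: q_def)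
  have q_ge: "b l \<le> q" if "l \<le> m" for l
    unfolding q_def by (rule Max_ge) (use that in auto)
  define \<kappa> where "\<kappa> = root N q"
  have N: "0 < N" by (simp add: N_def)
  have \<kappa>N: "\<kappa> ^ N = q" using q N by (simp add: \<kappa>_def)
  have \<kappa>: "0 < \<kappa>" "\<kappa> < 1" using q N by (auto simp: \<kappa>_def)
  have nN: "n l \<le> N" if "l \<le> m" for l
    using member_le_sum[of l "{..m}" n] that by (simp add: N_def)
  have ccl: "\<bar>c l\<bar> \<le> cc" if "l \<le> m" for l
    using member_le_sum[of l "{..m}" "\<lambda>l. \<bar>c l\<bar>"] that by (simp add: cc_def)
  have "triangular_targets m S M N \<kappa> cc \<Phi> \<pi>"
  proof unfold_locales
    show "space (S l) \<noteq> {}" for l by (rule space_S_nonempty)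
    show "M l \<mu> \<in> S l \<rightarrow>\<^sub>M prob_algebra (S l)" if "\<mu> \<in> prob_measures (S (l - 1))" for l \<mu>
      by (rule M_kernel[OF that])
    show "(\<lambda>(x, y). M l (empirical (S (l - 1)) n x) y)
      \<in> (\<Pi>\<^sub>M p\<in>{..n}. S (l - 1)) \<Otimes>\<^sub>M S l \<rightarrow>\<^sub>M prob_algebra (S l)" for l n
    proof (cases "l = 0")
      case True
      then show ?thesis using M_0 measurable_compose[OF measurable_snd M0_markov] by (simp add: case_prod_beta')
    next
      case False
      then show ?thesis using M_path_measurable[of l n] by simp
    qed
    show "M 0 \<mu> = M 0 \<nu>" for \<mu> \<nu> by (simp add: M_0)
    show "1 \<le> N" "0 < \<kappa>" "\<kappa> < 1" "0 \<le> cc" using \<kappa> by (auto simp: N_def cc_def intro: sum_nonneg)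
    show "\<bar>(kernel_op (M l \<mu>) ^^ N) f x - (kernel_op (M l \<mu>) ^^ N) f y\<bar> \<le> \<kappa> ^ N * d"
      if l: "l \<le> m" and \<mu>: "\<mu> \<in> prob_measures (S (l - 1))" and f: "bounded_by (S l) B f"
        and d: "\<And>x y. x \<in> space (S l) \<Longrightarrow> y \<in> space (S l) \<Longrightarrow> \<bar>f x - f y\<bar> \<le> d"
        and xy: "x \<in> space (S l)" "y \<in> space (S l)" for l \<mu> f B d x y
    proof -
      have "(kernel_op (M l \<mu>) ^^ N) f = (kernel_op (M l \<mu>) ^^ (N - n l)) ((kernel_op (M l \<mu>) ^^ n l) f)"
        using nN[OF l] by (metis comp_apply funpow_add le_add_diff_inverse2)
      moreover have "\<bar>(kernel_op (M l \<mu>) ^^ (N - n l)) ((kernel_op (M l \<mu>) ^^ n l) f) x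
          - (kernel_op (M l \<mu>) ^^ (N - n l)) ((kernel_op (M l \<mu>) ^^ n l) f) y\<bar> \<le> b l * d"
        unfolding b_def
        by (rule kernel_op_pow_osc[OF M_kernel[OF \<mu>] kernel_op_pow_bounded_by[OF M_kernel[OF \<mu>] f] _ xy],
            rule dobrushin_contraction[OF space_S_nonempty M_kernel \<mu> f d])
      moreover have "b l * d \<le> q * d"
        using q_ge[OF l] d[OF xy(1) xy(1)] by (intro mult_right_mono) auto
      ultimately show ?thesis by (simp add: \<kappa>N)
    qed
    show "\<bar>kernel_op (M l \<mu>) f x - kernel_op (M l \<nu>) f x\<bar> \<le> cc * \<tau> * B"
      if l: "l \<le> m" and \<mu>: "\<mu> \<in> prob_measures (S (l - 1))" and \<nu>: "\<nu> \<in> prob_measures (S (l - 1))"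
        and f: "bounded_by (S l) B f"
        and \<tau>: "\<And>g. bounded_by (S (l - 1)) 1 g \<Longrightarrow> \<bar>(\<integral>x. g x \<partial>\<mu>) - (\<integral>x. g x \<partial>\<nu>)\<bar> \<le> \<tau>"
        and x: "x \<in> space (S l)" for l \<mu> \<nu> f B \<tau> x
    proof -
      have "\<bar>kernel_op (M l \<mu>) f x - kernel_op (M l \<nu>) f x\<bar> \<le> \<bar>c l\<bar> * \<tau> * B"
        by (rule lipschitz_of_op_norm[OF space_S_nonempty space_S_nonempty M_kernel[OF \<mu>] M_kernel[OF \<nu>] lip[OF \<mu> \<nu>] f \<tau> x])
      also have "\<dots> \<le> cc * \<tau> * B"
      proof -
        have "0 \<le> \<tau>" using \<tau>[of "\<lambda>_. 0"] by (simp add: bounded_by_def)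
        then show ?thesis
          using ccl[OF l] bounded_by_nonneg[OF f space_S_nonempty] by (intro mult_right_mono) auto
      qed
      finally show ?thesis .
    qed
    show "\<pi> l \<in> prob_measures (S l)" for l by (rule \<pi>_in_prob)
    show "\<Phi> l \<mu> \<in> prob_measures (S l)" if "1 \<le> l" "\<mu> \<in> prob_measures (S (l - 1))" for l \<mu>
      using \<Phi>[OF that(1)] that(2) by auto
    show "\<pi> l = \<Phi> l (\<pi> (l - 1))" if "1 \<le> l" for l by (rule \<pi>_rec[OF that])
    show "(\<integral>x. kernel_op (M 0 \<mu>) g x \<partial>\<pi> 0) = (\<integral>x. g x \<partial>\<pi> 0)" if "bounded_by (S 0) B g" for \<mu> B g
      using bind_invariant_integral[OF \<pi>_0 M0_markov M0_invariant that] by (simp add: M_0)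
    show "(\<integral>x. kernel_op (M l \<mu>) g x \<partial>\<Phi> l \<mu>) = (\<integral>x. g x \<partial>\<Phi> l \<mu>)"
      if "1 \<le> l" "\<mu> \<in> prob_measures (S (l - 1))" "bounded_by (S l) B g" for l \<mu> B g
      using bind_invariant_integral[OF _ M_kernel[OF that(2)] M_invariant[OF that(1,2)] that(3)] \<Phi>[OF that(1)] that(2)
      by auto
    show "R1 S \<Phi>" by fact
  qed
  then show ?thesis by blast
qed

end

section \<open>From the sampled process to its transition kernels\<close>

text \<open>
  \<open>cond_law\<close> speaks of single events of \<open>Y\<close>; against the events of \<open>Z\<close> it identifies the joint law of
  \<open>(Z, Y)\<close> on rectangles, which determine it.
\<close>

lemma (in prob_space) cond_law_integral:
  assumes sub: "subalgebra M F" and Z: "Z \<in> F \<rightarrow>\<^sub>M H" and Y: "Y \<in> M \<rightarrow>\<^sub>M N"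
    and L: "L \<in> H \<rightarrow>\<^sub>M prob_algebra N" and cl: "cond_law M F N Y (\<lambda>\<omega>. L (Z \<omega>))"
    and g: "bounded_by (H \<Otimes>\<^sub>M N) B (\<lambda>(h, y). g h y)"
  shows "(\<integral>\<omega>. g (Z \<omega>) (Y \<omega>) \<partial>M) = (\<integral>\<omega>. (\<integral>y. g (Z \<omega>) y \<partial>L (Z \<omega>)) \<partial>M)"
proof -
  interpret fs: finite_measure_subalgebra M F by unfold_locales (rule sub)
  have ZM: "Z \<in> M \<rightarrow>\<^sub>M H" by (rule measurable_from_subalg[OF sub Z])
  have ZY: "(\<lambda>\<omega>. (Z \<omega>, Y \<omega>)) \<in> M \<rightarrow>\<^sub>M H \<Otimes>\<^sub>M N" by (rule measurable_Pair[OF ZM Y])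
  define \<mu> where "\<mu> = distr M (H \<Otimes>\<^sub>M N) (\<lambda>\<omega>. (Z \<omega>, Y \<omega>))"
  define J where "J h = distr (L h) (H \<Otimes>\<^sub>M N) (Pair h)" for h
  define Q where "Q = distr M H Z"
  have J: "J \<in> H \<rightarrow>\<^sub>M prob_algebra (H \<Otimes>\<^sub>M N)"
    unfolding J_def[abs_def] by (rule measurable_distr_prob_space2[OF L]) simp
  have Q: "Q \<in> space (prob_algebra H)"
    unfolding Q_def using ZM by (simp add: space_prob_algebra prob_space_distr)
  have Lh: "sets (L h) = sets N" "prob_space (L h)" if "h \<in> space H" for h
    using measurable_space[OF L that] by (auto simp: space_prob_algebra)
  have Pair_m: "Pair h \<in> L h \<rightarrow>\<^sub>M H \<Otimes>\<^sub>M N" if "h \<in> space H" for h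
    using measurable_Pair1'[OF that, of N] Lh(1)[OF that] measurable_cong_sets by blast
  have "\<mu> = Q \<bind> J"
  proof (rule measure_eqI_generator_eq[OF Int_stable_pair_measure_generator[of H N]])
    show "{a \<times> b |a b. a \<in> sets H \<and> b \<in> sets N} \<subseteq> Pow (space H \<times> space N)"
      using sets.space_closed[of H] sets.space_closed[of N] by auto
    show "sets \<mu> = sigma_sets (space H \<times> space N) {a \<times> b |a b. a \<in> sets H \<and> b \<in> sets N}"
      by (simp add: \<mu>_def sets_pair_measure)
    show "sets (Q \<bind> J) = sigma_sets (space H \<times> space N) {a \<times> b |a b. a \<in> sets H \<and> b \<in> sets N}"
      using sets_bind'[OF Q J] by (simp add: sets_pair_measure)
    show "range (\<lambda>_::nat. space H \<times> space N) \<subseteq> {a \<times> b |a b. a \<in> sets H \<and> b \<in> sets N}" by auto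
    show "(\<Union>i::nat. space H \<times> space N) = space H \<times> space N" by simp
    show "emeasure \<mu> (space H \<times> space N) \<noteq> \<infinity>" for i :: nat
    proof -
      interpret mu: prob_space \<mu> unfolding \<mu>_def by (rule prob_space_distr[OF ZY])
      show ?thesis using mu.emeasure_finite by simp
    qed
    fix C assume "C \<in> {a \<times> b |a b. a \<in> sets H \<and> b \<in> sets N}"
    then obtain a b where C: "C = a \<times> b" and a: "a \<in> sets H" and b: "b \<in> sets N" by auto
    have ia: "(\<lambda>\<omega>. indicator a (Z \<omega>) :: real) \<in> borel_measurable F"
      by (rule measurable_compose[OF Z]) (use a in simp)
    have ib: "(\<lambda>\<omega>. indicator b (Y \<omega>) :: real) \<in> borel_measurable M"
      by (rule measurable_compose[OF Y]) (use b in simp)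
    have iaM: "(\<lambda>\<omega>. indicator a (Z \<omega>) :: real) \<in> borel_measurable M"
      by (rule measurable_from_subalg[OF sub ia])
    have Lb: "(\<lambda>\<omega>. measure (L (Z \<omega>)) b) \<in> borel_measurable M"
      by (rule measurable_compose[OF ZM measurable_compose[OF L measurable_measure_prob_algebra[OF b]]])
    have int: "integrable M (\<lambda>\<omega>. indicator a (Z \<omega>) * indicator b (Y \<omega>) :: real)"
      using iaM ib by (intro integrable_bounded[where B = 1]) (auto simp: indicator_def)
    have "(\<integral>\<omega>. indicator a (Z \<omega>) * indicator b (Y \<omega>) \<partial>M)
        = (\<integral>\<omega>. indicator a (Z \<omega>) * real_cond_exp M F (\<lambda>\<omega>. indicator b (Y \<omega>)) \<omega> \<partial>M)"
      using fs.real_cond_exp_intg(2)[OF int ia ib] by simp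
    also have "\<dots> = (\<integral>\<omega>. indicator a (Z \<omega>) * measure (L (Z \<omega>)) b \<partial>M)"
    proof (rule integral_cong_AE)
      have "AE \<omega> in M. real_cond_exp M F (\<lambda>\<omega>. indicator b (Y \<omega>)) \<omega> = measure (L (Z \<omega>)) b"
        using cl b unfolding cond_law_def by blast
      then show "AE \<omega> in M. indicator a (Z \<omega>) * real_cond_exp M F (\<lambda>\<omega>. indicator b (Y \<omega>)) \<omega>
          = indicator a (Z \<omega>) * measure (L (Z \<omega>)) b" by auto
    qed (use iaM Lb in measurable)
    finally have key: "(\<integral>\<omega>. indicator a (Z \<omega>) * indicator b (Y \<omega>) \<partial>M)
        = (\<integral>\<omega>. indicator a (Z \<omega>) * measure (L (Z \<omega>)) b \<partial>M)" .
    have "emeasure \<mu> C = ennreal (\<integral>\<omega>. indicator a (Z \<omega>) * indicator b (Y \<omega>) \<partial>M)"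
    proof -
      have Cs: "C \<in> sets (H \<Otimes>\<^sub>M N)" using a b C by simp
      have "emeasure \<mu> C = (\<integral>\<^sup>+z. indicator C z \<partial>\<mu>)" using Cs by (simp add: \<mu>_def)
      also have "\<dots> = (\<integral>\<^sup>+\<omega>. indicator C (Z \<omega>, Y \<omega>) \<partial>M)"
        unfolding \<mu>_def using Cs by (intro nn_integral_distr[OF ZY]) simp
      also have "\<dots> = (\<integral>\<^sup>+\<omega>. ennreal (indicator a (Z \<omega>) * indicator b (Y \<omega>)) \<partial>M)"
        unfolding C by (intro nn_integral_cong) (auto simp: indicator_def)
      also have "\<dots> = ennreal (\<integral>\<omega>. indicator a (Z \<omega>) * indicator b (Y \<omega>) \<partial>M)"
        by (rule nn_integral_eq_integral[OF int]) (auto simp: indicator_def)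
      finally show ?thesis .
    qed
    moreover have "emeasure (Q \<bind> J) C = ennreal (\<integral>\<omega>. indicator a (Z \<omega>) * measure (L (Z \<omega>)) b \<partial>M)"
    proof -
      have Jm: "(\<lambda>h. emeasure (J h) C) \<in> borel_measurable H"
        using measurable_compose[OF measurable_prob_algebraD[OF J] measurable_emeasure_subprob_algebra] a b C by auto
      have "emeasure (Q \<bind> J) C = (\<integral>\<^sup>+h. emeasure (J h) C \<partial>Q)"
        using a b C by (intro emeasure_bind_prob_algebra[OF Q J]) auto
      also have "\<dots> = (\<integral>\<^sup>+\<omega>. emeasure (J (Z \<omega>)) C \<partial>M)"
        unfolding Q_def by (rule nn_integral_distr[OF ZM]) (use Jm in simp)
      also have "\<dots> = (\<integral>\<^sup>+\<omega>. ennreal (indicator a (Z \<omega>) * measure (L (Z \<omega>)) b) \<partial>M)"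
      proof (rule nn_integral_cong)
        fix \<omega> assume "\<omega> \<in> space M"
        then have z: "Z \<omega> \<in> space H" by (rule measurable_space[OF ZM])
        interpret Lz: prob_space "L (Z \<omega>)" by (rule Lh(2)[OF z])
        have "Pair (Z \<omega>) -` C \<inter> space (L (Z \<omega>)) = (if Z \<omega> \<in> a then b else {})"
          using sets.sets_into_space[OF b] sets_eq_imp_space_eq[OF Lh(1)[OF z]] by (auto simp: C)
        then show "emeasure (J (Z \<omega>)) C = ennreal (indicator a (Z \<omega>) * measure (L (Z \<omega>)) b)"
          unfolding J_def using a b C
          by (subst emeasure_distr[OF Pair_m[OF z]]) (auto simp: indicator_def Lz.emeasure_eq_measure)
      qed
      also have "\<dots> = ennreal (\<integral>\<omega>. indicator a (Z \<omega>) * measure (L (Z \<omega>)) b \<partial>M)"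
      proof (rule nn_integral_eq_integral)
        show "integrable M (\<lambda>\<omega>. indicator a (Z \<omega>) * measure (L (Z \<omega>)) b)"
        proof (rule integrable_bounded[where B = 1])
          fix \<omega> assume "\<omega> \<in> space M"
          then have "prob_space (L (Z \<omega>))" using measurable_space[OF ZM] Lh(2) by blast
          then show "\<bar>indicator a (Z \<omega>) * measure (L (Z \<omega>)) b\<bar> \<le> 1"
            by (simp add: indicator_def prob_space.prob_le_1)
        qed (use iaM Lb in measurable)
      qed (auto simp: indicator_def)
      finally show ?thesis .
    qed
    ultimately show "emeasure \<mu> C = emeasure (Q \<bind> J) C" using key by simp
  qed
  have gm: "(\<lambda>(h, y). g h y) \<in> borel_measurable (H \<Otimes>\<^sub>M N)" by (rule bounded_by_measurable[OF g])
  have "(\<integral>\<omega>. g (Z \<omega>) (Y \<omega>) \<partial>M) = (\<integral>q. (case q of (h, y) \<Rightarrow> g h y) \<partial>\<mu>)"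
    unfolding \<mu>_def by (subst integral_distr[OF ZY gm]) simp
  also have "\<dots> = (\<integral>h. (\<integral>q. (case q of (h, y) \<Rightarrow> g h y) \<partial>J h) \<partial>Q)"
    unfolding \<open>\<mu> = Q \<bind> J\<close> by (rule bind_integral_bounded[OF Q J g])
  also have "\<dots> = (\<integral>h. (\<integral>y. g h y \<partial>L h) \<partial>Q)"
  proof (rule Bochner_Integration.integral_cong[OF refl])
    fix h assume "h \<in> space Q"
    then have h: "h \<in> space H" by (simp add: Q_def)
    show "(\<integral>q. (case q of (h, y) \<Rightarrow> g h y) \<partial>J h) = (\<integral>y. g h y \<partial>L h)"
      unfolding J_def by (subst integral_distr[OF Pair_m[OF h] gm]) simp
  qed
  also have "\<dots> = (\<integral>\<omega>. (\<integral>y. g (Z \<omega>) y \<partial>L (Z \<omega>)) \<partial>M)"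
    unfolding Q_def by (rule integral_distr[OF ZM integral_kernel_measurable[OF gm L]])
  finally show ?thesis .
qed

context interacting_mcmc
begin

text \<open>
  The path known at time \<open>j\<close>.  Padding it by the state at time \<open>0\<close> makes the path at time \<open>Suc j\<close> the
  one at time \<open>j\<close> with a single entry overwritten, exactly as in the definition of \<open>run\<close>.
\<close>

definition past_path :: "nat \<Rightarrow> nat \<Rightarrow> 'w \<Rightarrow> nat \<Rightarrow> nat \<Rightarrow> 'a"
  where "past_path m j \<omega> = (\<lambda>p. joint_state X m (if p \<le> j then p else 0) \<omega>)"

lemma generated_subalgebra: "subalgebra P (generated P S X J)"
proof -
  have "{X l p -` A \<inter> space P | l p A. (l, p) \<in> J \<and> A \<in> sets (S l)} \<subseteq> sets P"
    using measurable_sets[OF X_measurable] by blast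
  then show ?thesis
    unfolding subalgebra_def generated_def
    by (auto simp: sets_measure_of_conv space_measure_of_conv intro: sets.sigma_sets_subset[THEN subsetD])
qed

lemma generated_measurable:
  assumes "(l, p) \<in> J"
  shows "X l p \<in> generated P S X J \<rightarrow>\<^sub>M S l"
proof (rule measurableI)
  have sp: "space (generated P S X J) = space P" by (simp add: generated_def space_measure_of_conv)
  show "X l p \<omega> \<in> space (S l)" if "\<omega> \<in> space (generated P S X J)" for \<omega>
    using measurable_space[OF X_measurable] that sp by blast
  fix A assume A: "A \<in> sets (S l)"
  have "{X l p -` A \<inter> space P | l p A. (l, p) \<in> J \<and> A \<in> sets (S l)} \<subseteq> Pow (space P)" by auto
  then show "X l p -` A \<inter> space (generated P S X J) \<in> sets (generated P S X J)"
    unfolding sp unfolding generated_def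
    using assms A by (auto simp: sets_measure_of_conv intro!: sigma_sets.Basic)
qed

lemma past_path_measurable:
  "past_path m j \<in> generated P S X ({..m} \<times> {..j}) \<rightarrow>\<^sub>M (\<Pi>\<^sub>M p\<in>(UNIV :: nat set). \<Pi>\<^sub>M l\<in>{..m}. S l)"
proof -
  have "joint_state X m p \<in> generated P S X ({..m} \<times> {..j}) \<rightarrow>\<^sub>M (\<Pi>\<^sub>M l\<in>{..m}. S l)" if "p \<le> j" for p
    unfolding joint_state_def[abs_def]
    by (rule measurable_restrict) (use that in \<open>auto intro!: generated_measurable\<close>)
  then have "(\<lambda>\<omega>. \<lambda>p\<in>UNIV. joint_state X m (if p \<le> j then p else 0) \<omega>)
      \<in> generated P S X ({..m} \<times> {..j}) \<rightarrow>\<^sub>M (\<Pi>\<^sub>M p\<in>(UNIV :: nat set). \<Pi>\<^sub>M l\<in>{..m}. S l)"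
    by (intro measurable_restrict) simp
  then show ?thesis by (simp add: past_path_def[abs_def] restrict_UNIV)
qed

lemma joint_state_measurable: "joint_state X m p \<in> P \<rightarrow>\<^sub>M (\<Pi>\<^sub>M l\<in>{..m}. S l)"
  unfolding joint_state_def[abs_def] by (rule measurable_restrict) (rule X_measurable)

text \<open>
  Conditioning on the path known at time \<open>n - 1\<close>, then \<open>n - 2\<close>, and so on, turns the steps of the
  process one by one into steps of \<open>ev\<close>; only the initial state remains random.
\<close>

lemma past_path_law:
  assumes tri: "triangular_chain m S M N \<kappa> c" and m: "1 \<le> m"
    and F: "bounded_by (\<Pi>\<^sub>M p\<in>(UNIV :: nat set). \<Pi>\<^sub>M l\<in>{..m}. S l) B F"
  shows "(\<integral>\<omega>. F (past_path m n \<omega>) \<partial>P) = (\<integral>\<omega>. triangular_chain.ev m S M 0 n F (past_path m 0 \<omega>) \<partial>P)"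
proof -
  interpret T: triangular_chain m S M N \<kappa> c by fact
  have path: "past_path m j \<omega> \<in> space T.Hs" if "\<omega> \<in> space P" for j \<omega>
    using measurable_space[OF measurable_from_subalg[OF generated_subalgebra past_path_measurable]] that by blast
  have kernel: "(\<Pi>\<^sub>M l\<in>{..m}. M l (empirical (S (l - 1)) j (\<lambda>p. X (l - 1) p \<omega>)) (X l j \<omega>)) = T.K j (past_path m j \<omega>)" for j \<omega>
    unfolding T.K_def
  proof (rule PiM_cong[OF refl])
    fix l assume "l \<in> {..m}"
    then have l: "l \<le> m" "l - 1 \<le> m" by auto
    have "empirical (S (l - 1)) j (\<lambda>p. X (l - 1) p \<omega>) = T.emp l j (past_path m j \<omega>)"
      unfolding T.emp_def by (rule empirical_cong) (use l in \<open>simp add: past_path_def joint_state_def\<close>)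
    then show "M l (empirical (S (l - 1)) j (\<lambda>p. X (l - 1) p \<omega>)) (X l j \<omega>) = T.lk l j (past_path m j \<omega>)"
      using l by (simp add: T.lk_def past_path_def joint_state_def)
  qed
  have step: "past_path m (Suc j) \<omega> = (past_path m j \<omega>)(Suc j := joint_state X m (Suc j) \<omega>)" for j \<omega>
    by (auto simp: past_path_def fun_eq_iff)
  have one: "(\<integral>\<omega>. F (past_path m (Suc j) \<omega>) \<partial>P) = (\<integral>\<omega>. T.ev j (Suc 0) F (past_path m j \<omega>) \<partial>P)"
    if F: "bounded_by T.Hs B F" for F j
  proof -
    have "(\<integral>\<omega>. F ((past_path m j \<omega>)(Suc j := joint_state X m (Suc j) \<omega>)) \<partial>P)
        = (\<integral>\<omega>. (\<integral>y. F ((past_path m j \<omega>)(Suc j := y)) \<partial>T.K j (past_path m j \<omega>)) \<partial>P)"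
    proof (rule cond_law_integral[OF generated_subalgebra past_path_measurable joint_state_measurable T.measurable_K])
      show "cond_law P (generated P S X ({..m} \<times> {..j})) T.Em (joint_state X m (Suc j)) (\<lambda>\<omega>. T.K j (past_path m j \<omega>))"
        using joint_transition[OF m, of j] unfolding kernel .
      show "bounded_by (T.Hs \<Otimes>\<^sub>M T.Em) B (\<lambda>(h, y). F (h(Suc j := y)))"
        by (rule T.step_bounded_by[OF F])
    qed
    also have "\<dots> = (\<integral>\<omega>. T.ev j (Suc 0) F (past_path m j \<omega>) \<partial>P)"
      by (rule Bochner_Integration.integral_cong[OF refl]) (use T.ev_1[OF F path] in simp)
    finally show ?thesis unfolding step .
  qed
  show ?thesis using F
  proof (induction n arbitrary: F)
    case 0
    show ?case by (rule Bochner_Integration.integral_cong[OF refl]) (use T.ev_0[OF 0 path] in simp)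
  next
    case (Suc n)
    have "(\<integral>\<omega>. F (past_path m (Suc n) \<omega>) \<partial>P) = (\<integral>\<omega>. T.ev 0 n (T.ev n (Suc 0) F) (past_path m 0 \<omega>) \<partial>P)"
      unfolding one[OF Suc.prems] by (rule Suc.IH[OF T.ev_bounded_by[OF Suc.prems]])
    also have "\<dots> = (\<integral>\<omega>. T.ev 0 (Suc n) F (past_path m 0 \<omega>) \<partial>P)"
      by (rule Bochner_Integration.integral_cong[OF refl]) (use T.ev_Suc_right[OF Suc.prems path, of _ 0 n] in simp)
    finally show ?case .
  qed
qed

lemma empirical_moment_bound:
  assumes R1: "R1 S \<Phi>" and R2: "R2 S M" and m: "1 \<le> m" and r: "0 \<le> r"
    and f: "bounded_by (\<Pi>\<^sub>M l\<in>{..m}. S l) B f"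
  shows "\<exists>C. \<forall>n. (\<integral>\<omega>. (sqrt (real n + 1) *
      \<bar>(\<integral>x. f x \<partial>empirical (\<Pi>\<^sub>M l\<in>{..m}. S l) n (\<lambda>p. joint_state X m p \<omega>))
        - (\<integral>x. f x \<partial>(\<Pi>\<^sub>M l\<in>{..m}. \<pi> l))\<bar>) powr r \<partial>P) \<le> C"
proof -
  obtain N \<kappa> c where tri: "triangular_targets m S M N \<kappa> c \<Phi> \<pi>" using triangular[OF R1 R2] by blast
  interpret T: triangular_targets m S M N \<kappa> c \<Phi> \<pi> by fact
  define G where "G n h = (sqrt (real n + 1) * \<bar>T.avg n f h - (\<integral>x. f x \<partial>T.\<Pi>\<pi>)\<bar>) powr r" for n h
  obtain C where C: "\<And>n h. h \<in> space T.Hs \<Longrightarrow> T.ev 0 n (G n) h \<le> C"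
    using T.moment_bound[OF f r] unfolding G_def by blast
  have path: "past_path m j \<omega> \<in> space T.Hs" if "\<omega> \<in> space P" for j \<omega>
    using measurable_space[OF measurable_from_subalg[OF generated_subalgebra past_path_measurable]] that by blast
  have "(\<integral>\<omega>. (sqrt (real n + 1) *
      \<bar>(\<integral>x. f x \<partial>empirical T.Em n (\<lambda>p. joint_state X m p \<omega>)) - (\<integral>x. f x \<partial>T.\<Pi>\<pi>)\<bar>) powr r \<partial>P) \<le> C" for n
  proof -
    obtain A where A: "bounded_by T.Hs A (G n)"
    proof -
      define a where "a = (\<integral>x. f x \<partial>T.\<Pi>\<pi>)"
      have b: "bounded_by T.Hs (B + \<bar>a\<bar>) (\<lambda>h. \<bar>T.avg n f h - a\<bar>)"
        by (rule bounded_by_abs_diff_const[OF T.avg_bounded[OF f] order_refl])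
      have "bounded_by T.Hs ((sqrt (real n + 1) * (B + \<bar>a\<bar>)) powr r) (G n)"
      proof (rule bounded_byI)
        show "G n \<in> borel_measurable T.Hs"
          unfolding G_def[abs_def] a_def[symmetric] using bounded_by_measurable[OF b] by measurable
        show "\<bar>G n h\<bar> \<le> (sqrt (real n + 1) * (B + \<bar>a\<bar>)) powr r" if "h \<in> space T.Hs" for h
          using bounded_by_abs[OF b that] r unfolding G_def a_def[symmetric]
          by (auto intro!: powr_mono2 mult_left_mono)
      qed
      then show thesis by (rule that)
    qed
    have "(\<integral>\<omega>. (sqrt (real n + 1) *
      \<bar>(\<integral>x. f x \<partial>empirical T.Em n (\<lambda>p. joint_state X m p \<omega>)) - (\<integral>x. f x \<partial>T.\<Pi>\<pi>)\<bar>) powr r \<partial>P)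
      = (\<integral>\<omega>. G n (past_path m n \<omega>) \<partial>P)"
    proof (rule Bochner_Integration.integral_cong[OF refl])
      fix \<omega> assume \<omega>: "\<omega> \<in> space P"
      have "(\<integral>x. f x \<partial>empirical T.Em n (\<lambda>p. joint_state X m p \<omega>)) = (\<Sum>p\<le>n. f (joint_state X m p \<omega>)) / (real n + 1)"
        by (rule integral_empirical[OF measurable_space[OF joint_state_measurable \<omega>] bounded_by_measurable[OF f]])
      also have "\<dots> = T.avg n f (past_path m n \<omega>)" by (simp add: T.avg_def past_path_def)
      finally show "(sqrt (real n + 1) *
          \<bar>(\<integral>x. f x \<partial>empirical T.Em n (\<lambda>p. joint_state X m p \<omega>)) - (\<integral>x. f x \<partial>T.\<Pi>\<pi>)\<bar>) powr r = G n (past_path m n \<omega>)"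
        by (simp add: G_def)
    qed
    also have "\<dots> = (\<integral>\<omega>. T.ev 0 n (G n) (past_path m 0 \<omega>) \<partial>P)"
      by (rule past_path_law[OF T.triangular_chain_axioms m A])
    also have "\<dots> \<le> (\<integral>\<omega>. C \<partial>P)"
    proof (rule integral_mono)
      show "integrable P (\<lambda>\<omega>. T.ev 0 n (G n) (past_path m 0 \<omega>))"
        using bounded_by_comp[OF T.ev_bounded_by[OF A] measurable_from_subalg[OF generated_subalgebra past_path_measurable], of 0 n 0]
        by (intro integrable_bounded) (auto simp: bounded_by_def)
      show "T.ev 0 n (G n) (past_path m 0 \<omega>) \<le> C" if "\<omega> \<in> space P" for \<omega> by (rule C[OF path[OF that]])
    qed simp
    finally show ?thesis by (simp add: prob_space)
  qed
  then show ?thesis by blast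
qed

end

theorem theorem6p1:
  fixes P :: "'w measure"
    and S :: "nat \<Rightarrow> 'a measure"
    and \<Phi> :: "nat \<Rightarrow> 'a measure \<Rightarrow> 'a measure"
    and \<pi> :: "nat \<Rightarrow> 'a measure"
    and M0 :: "'a \<Rightarrow> 'a measure"
    and M :: "nat \<Rightarrow> 'a measure \<Rightarrow> 'a \<Rightarrow> 'a measure"
    and \<nu> :: "nat \<Rightarrow> 'a measure"
    and X :: "nat \<Rightarrow> nat \<Rightarrow> 'w \<Rightarrow> 'a"
    and m :: nat and r :: real and f :: "(nat \<Rightarrow> 'a) \<Rightarrow> real"
  assumes "interacting_mcmc P S \<Phi> \<pi> M0 M \<nu> X"
    and "R1 S \<Phi>" and "R2 S M"
    and "m \<ge> 1" and "r \<ge> 1"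
    and "f \<in> bounded_measurable (\<Pi>\<^sub>M l\<in>{..m}. S l)"
  shows "(SUP n\<in>{1..}. ereal (sqrt (real n) *
      (\<integral>\<omega>. \<bar>(\<integral>x. f x \<partial>empirical (\<Pi>\<^sub>M l\<in>{..m}. S l) n (\<lambda>p. joint_state X m p \<omega>))
            - (\<integral>x. f x \<partial>(\<Pi>\<^sub>M l\<in>{..m}. \<pi> l))\<bar> powr r \<partial>P) powr (1 / r))) < \<infinity>"
proof -
  interpret interacting_mcmc P S \<Phi> \<pi> M0 M \<nu> X by fact
  define D where "D n \<omega> = \<bar>(\<integral>x. f x \<partial>empirical (\<Pi>\<^sub>M l\<in>{..m}. S l) n (\<lambda>p. joint_state X m p \<omega>))
      - (\<integral>x. f x \<partial>(\<Pi>\<^sub>M l\<in>{..m}. \<pi> l))\<bar>" for n \<omega>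
  obtain B where "bounded_by (\<Pi>\<^sub>M l\<in>{..m}. S l) B f"
    using assms(6) bounded_measurable_iff by blast
  from empirical_moment_bound[OF assms(2,3,4) _ this, of r] assms(5) obtain C where
    C: "\<And>n. (\<integral>\<omega>. (sqrt (real n + 1) * D n \<omega>) powr r \<partial>P) \<le> C"
    unfolding D_def by auto
  have "sqrt (real n) * (\<integral>\<omega>. D n \<omega> powr r \<partial>P) powr (1 / r) \<le> C powr (1 / r)" for n
  proof -
    define I where "I = (\<integral>\<omega>. D n \<omega> powr r \<partial>P)"
    define s where "s = sqrt (real n + 1)"
    have I: "0 \<le> I" unfolding I_def by (rule Bochner_Integration.integral_nonneg) simp
    have s: "0 < s" by (simp add: s_def)
    have "(s * D n \<omega>) powr r = s powr r * D n \<omega> powr r" for \<omega>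
      using s by (simp add: D_def powr_mult)
    then have "s powr r * I \<le> C"
      using C[of n] unfolding s_def[symmetric] I_def by simp
    then have "(s powr r * I) powr (1 / r) \<le> C powr (1 / r)"
      using I assms(5) by (intro powr_mono2) auto
    moreover have "(s powr r * I) powr (1 / r) = s * I powr (1 / r)"
      using I s assms(5) by (simp add: powr_mult powr_powr)
    moreover have "sqrt (real n) * I powr (1 / r) \<le> s * I powr (1 / r)"
      unfolding s_def by (intro mult_right_mono) auto
    ultimately show ?thesis unfolding I_def by linarith
  qed
  then have "(SUP n\<in>{1..}. ereal (sqrt (real n) * (\<integral>\<omega>. D n \<omega> powr r \<partial>P) powr (1 / r))) \<le> ereal (C powr (1 / r))"
    by (intro SUP_least) simp
  also have "\<dots> < \<infinity>" by simp
  finally show ?thesis unfolding D_def .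
qed

end
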